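(* Let $\varphi\in\mathcal{A}=\mathbf{F}[x,y,z]$ be a weight homogeneous polynomial with an isolated singularity, and let $\pi_0:=\{\cdot,\cdot\}_\varphi$ be the Poisson bracket $$\{\cdot,\cdot\}_\varphi=\frac{\partial\varphi}{\partial x}\frac{\partial}{\partial y}\wedge\frac{\partial}{\partial z}+\frac{\partial\varphi}{\partial y}\frac{\partial}{\partial z}\wedge\frac{\partial}{\partial x}+\frac{\partial\varphi}{\partial z}\frac{\partial}{\partial x}\wedge\frac{\partial}{\partial y}.$$ Let $u_0=1,u_1,\dots,u_{\mu-1}\in\mathcal{A}$ be weight homogeneous polynomials whose images in $\mathcal{A}_{sing}(\varphi)$ form an $\mathbf{F}$-basis of $\mathcal{A}_{sing}(\varphi)$. Call admissible a pair of families of constants $(c^k_{l,i}\in\mathbf{F})_{(l,i)\in\mathbf{N}\times\mathcal{E}_\varphi,\,k\in\mathbf{N}^*}$ and $(\bar c^{\,k}_r\in\mathbf{F})_{1\le r\le\mu-1,\,k\in\mathbf{N}^*}$ such that, for every $k_0\in\mathbf{N}^*$, only finitely many $c^{k_0}_{l,i}$ and $\bar c^{\,k_0}_r$ are nonzero. To an admissible pair associate $\pi_*=\{\cdot,\cdot\}_\varphi+\sum_{n\in\mathbf{N}^*}\pi_n\nu^n$, where $$\pi_n=\sum_{(l,i)\in\mathbf{N}\times\mathcal{E}_\varphi,\ 1\le r\le\mu-1}\ \ \sum_{a+b=n,\ a,b\in\mathbf{N}^*}c^a_{l,i}\,\bar c^{\,b}_r\,\varphi^l u_i\vec\nabla u_r+\sum_{(m,j)\in\mathbf{N}\times\mathcal{E}_\varphi}c^n_{m,j}\,\varphi^m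 u_j\vec\nabla\varphi+\sum_{1\le s\le\mu-1}\bar c^{\,n}_s\,\vec\nabla u_s .$$ Then: (a) For every admissible pair, $\pi_*$ is a formal deformation of $\{\cdot,\cdot\}_\varphi$. (b) For any formal deformation $\pi'_*$ of $\{\cdot,\cdot\}_\varphi$, there is an admissible pair such that $\pi'_*$ is equivalent to the associated $\pi_*$. (c) If moreover $\varpi(\varphi)\neq|\varpi|$, then for any formal deformation $\pi'_*$ of $\{\cdot,\cdot\}_\varphi$, there is a unique admissible pair such that $\pi'_*$ is equivalent to the associated $\pi_*$. (That is, the $\pi_*$ form a system of representatives of all formal deformations of $\{\cdot,\cdot\}_\varphi$ modulo equivalence.) (d) The analogous results hold for $m$-th order deformations, for every $m\in\mathbf{N}^*$: for every admissible pair, $\{\cdot,\cdot\}_\varphi+\sum_{n=1}^m\pi_n\nu^n$ is an $m$-th order deformation; every $m$-th order deformation of $\{\cdot,\cdot\}_\varphi$ is equivalent (as an $m$-th order deformation) to one of this form; and if $\varpi(\varphi)\neq|\varpi|$, the admissible pair is unique when one imposes $c^k_{l,i}=0$ and $\bar c^{\,k}_r=0$ for all $k\ge m+1$.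
   Context: $\mathbf{F}$ is a field of characteristic zero, $\mathbf{N}=\{0,1,\dots\}$, $\mathbf{N}^*=\{1,2,\dots\}$. A polynomial $\varphi\in\mathbf{F}[x,y,z]$ is weight homogeneous of weighted degree $\varpi(\varphi)\in\mathbf{N}$ if there are (fixed) positive integers $\varpi_1,\varpi_2,\varpi_3$ without common divisor (the weights of $x,y,z$) with $\varpi_1x\frac{\partial\varphi}{\partial x}+\varpi_2y\frac{\partial\varphi}{\partial y}+\varpi_3z\frac{\partial\varphi}{\partial z}=\varpi(\varphi)\varphi$; $|\varpi|:=\varpi_1+\varpi_2+\varpi_3$. Weight homogeneity of other polynomials refers to the same weights. $\varphi$ has an isolated singularity (at the origin) if $\mathcal{A}_{sing}(\varphi)=\mathbf{F}[x,y,z]/\langle\frac{\partial\varphi}{\partial x},\frac{\partial\varphi}{\partial y},\frac{\partial\varphi}{\partial z}\rangle$ is finite-dimensional over $\mathbf{F}$; its dimension is $\mu\ge1$. Put $\mathcal{E}_\varphi=\{0,\dots,\mu-1\}$ if $\varpi(\varphi)=|\varpi|$, and $\mathcal{E}_\varphi=\{1,\dots,\mu-1\}$ if $\varpi(\varphi)\ne|\varpi|$. $\mathfrak{X}^2(\mathcal{A})$ is the space of skew-symmetric $\mathbf{F}$-bilinear maps $\mathcal{A}\times\mathcal{A}\to\mathcal{A}$ that are derivations in each argument. It is identified with $\mathcal{A}^3$ via $V\mapsto(V[y,z],V[z,x],V[x,y])$; so for $F,G\in\mathcal{A}$, $F\vec\nabla G$ ($\vec\nabla$ the gradient) denotes the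 biderivation $F\{\cdot,\cdot\}_G$, and $\{\cdot,\cdot\}_\varphi$ corresponds to $\vec\nabla\varphi$. A formal deformation of a Poisson structure $\pi_0$ on $\mathcal{A}$ is a map $\pi_*=\pi_0+\pi_1\nu+\pi_2\nu^2+\cdots:\mathcal{A}[[\nu]]\times\mathcal{A}[[\nu]]\to\mathcal{A}[[\nu]]$, with all $\pi_i\in\mathfrak{X}^2(\mathcal{A})$ extended $\mathbf{F}[[\nu]]$-bilinearly, which satisfies the Jacobi identity. Two formal deformations $\pi_*,\pi'_*$ are equivalent if there is an $\mathbf{F}[[\nu]]$-linear morphism of associative algebras $\Phi:\mathcal{A}[[\nu]]\to\mathcal{A}[[\nu]]$, equal to the identity modulo $\nu$, with $\Phi(\pi_*[F,G])=\pi'_*[\Phi(F),\Phi(G)]$ for all $F,G$. $m$-th order deformations and their equivalence are defined in the same way, replacing $\mathbf{F}[[\nu]]$ and $\mathcal{A}[[\nu]]$ by $\mathbf{F}[[\nu]]/\langle\nu^{m+1}\rangle$ and $\mathcal{A}[[\nu]]/\langle\nu^{m+1}\rangle$ (so $\pi_{(m)}=\pi_0+\pi_1\nu+\cdots+\pi_m\nu^m$). *)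

theory Defs
  imports
    "HOL-Computational_Algebra.Polynomial"
    "HOL-Computational_Algebra.Formal_Power_Series"
begin

section \<open>The algebra \<open>F[x,y,z]\<close>\<close>

text \<open>
  The polynomial algebra \<open>A = F[x,y,z]\<close> is the iterated polynomial ring \<open>F[x][y][z]\<close>:
  \<open>x\<close> is the innermost and \<open>z\<close> the outermost variable. A partial derivative
  in an inner variable therefore acts coefficientwise.
\<close>

type_synonym 'a poly3 = "'a poly poly poly"

definition cst :: "'a::field_char_0 \<Rightarrow> 'a poly3" where
  "cst a = [:[:[:a:]:]:]"

definition Xv :: "'a::field_char_0 poly3" where "Xv = [:[:[:0, 1:]:]:]"
definition Yv :: "'a::field_char_0 poly3" where "Yv = [:[:0, 1:]:]"
definition Zv :: "'a::field_char_0 poly3" where "Zv = [:0, 1:]"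

definition dx :: "'a::field_char_0 poly3 \<Rightarrow> 'a poly3" where "dx = map_poly (map_poly pderiv)"
definition dy :: "'a::field_char_0 poly3 \<Rightarrow> 'a poly3" where "dy = map_poly pderiv"
definition dz :: "'a::field_char_0 poly3 \<Rightarrow> 'a poly3" where "dz = pderiv"

text \<open>Weight homogeneity of weighted degree \<open>d\<close> for the weights \<open>w1, w2, w3\<close>
  of \<open>x, y, z\<close>, by Euler's formula.\<close>

definition weight_homogeneous :: "nat \<Rightarrow> nat \<Rightarrow> nat \<Rightarrow> nat \<Rightarrow> 'a::field_char_0 poly3 \<Rightarrow> bool" where
  "weight_homogeneous w1 w2 w3 d f \<longleftrightarrow>
     of_nat w1 * Xv * dx f + of_nat w2 * Yv * dy f + of_nat w3 * Zv * dz f = of_nat d * f"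


section \<open>The singularity algebra\<close>

definition jacobian_ideal :: "'a::field_char_0 poly3 \<Rightarrow> 'a poly3 set" where
  "jacobian_ideal \<phi> = {a * dx \<phi> + b * dy \<phi> + c * dz \<phi> | a b c. True}"

text \<open>
  Linear algebra in the quotient \<open>A_sing(\<phi>) = A / jacobian_ideal \<phi>\<close> is expressed on
  representatives: two polynomials have the same image iff their difference lies in the
  ideal. The family considered is \<open>u 0, \<dots>, u (n - 1)\<close>; other values of \<open>u\<close> are irrelevant.
\<close>

definition sing_spanning :: "'a::field_char_0 poly3 \<Rightarrow> nat \<Rightarrow> (nat \<Rightarrow> 'a poly3) \<Rightarrow> bool" where
  "sing_spanning \<phi> n u \<longleftrightarrow>
     (\<forall>f. \<exists>a :: nat \<Rightarrow> 'a. f - (\<Sum>i<n. cst (a i) * u i) \<in> jacobian_ideal \<phi>)"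

definition sing_independent :: "'a::field_char_0 poly3 \<Rightarrow> nat \<Rightarrow> (nat \<Rightarrow> 'a poly3) \<Rightarrow> bool" where
  "sing_independent \<phi> n u \<longleftrightarrow>
     (\<forall>a :: nat \<Rightarrow> 'a. (\<Sum>i<n. cst (a i) * u i) \<in> jacobian_ideal \<phi> \<longrightarrow> (\<forall>i<n. a i = 0))"

definition sing_basis :: "'a::field_char_0 poly3 \<Rightarrow> nat \<Rightarrow> (nat \<Rightarrow> 'a poly3) \<Rightarrow> bool" where
  "sing_basis \<phi> n u \<longleftrightarrow> sing_spanning \<phi> n u \<and> sing_independent \<phi> n u"

definition isolated_singularity :: "'a::field_char_0 poly3 \<Rightarrow> bool" where
  "isolated_singularity \<phi> \<longleftrightarrow> (\<exists>n u. sing_spanning \<phi> n u)"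

text \<open>The dimension \<open>\<mu>\<close> of \<open>A_sing(\<phi>)\<close>, meaningful when the latter is finite-dimensional.\<close>

definition milnor_number :: "'a::field_char_0 poly3 \<Rightarrow> nat" where
  "milnor_number \<phi> = (THE n. \<exists>u. sing_basis \<phi> n u)"

definition E_index :: "nat \<Rightarrow> nat \<Rightarrow> nat \<Rightarrow> nat \<Rightarrow> nat \<Rightarrow> nat set" where
  "E_index w1 w2 w3 d \<mu> = (if d = w1 + w2 + w3 then {0..<\<mu>} else {1..<\<mu>})"


section \<open>Biderivations\<close>

definition derivation :: "('a::field_char_0 poly3 \<Rightarrow> 'a poly3) \<Rightarrow> bool" where
  "derivation D \<longleftrightarrow>
     (\<forall>f g. D (f + g) = D f + D g) \<and>
     (\<forall>a f. D (cst a * f) = cst a * D f) \<and>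
     (\<forall>f g. D (f * g) = f * D g + D f * g)"

definition biderivation :: "('a::field_char_0 poly3 \<Rightarrow> 'a poly3 \<Rightarrow> 'a poly3) \<Rightarrow> bool" where
  "biderivation V \<longleftrightarrow>
     (\<forall>f g. V f g = - V g f) \<and>
     (\<forall>f. derivation (\<lambda>g. V f g)) \<and>
     (\<forall>g. derivation (\<lambda>f. V f g))"

text \<open>\<open>bracket \<psi>\<close> is the biderivation \<open>{\<cdot>,\<cdot>}\<^sub>\<psi>\<close>, identified with the gradient of \<open>\<psi>\<close>;
  \<open>(D \<and> D')(f, g) = D f * D' g - D g * D' f\<close>.\<close>

definition bracket :: "'a::field_char_0 poly3 \<Rightarrow> 'a poly3 \<Rightarrow> 'a poly3 \<Rightarrow> 'a poly3" where
  "bracket \<psi> f g =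
     dx \<psi> * (dy f * dz g - dy g * dz f) +
     dy \<psi> * (dz f * dx g - dz g * dx f) +
     dz \<psi> * (dx f * dy g - dx g * dy f)"


section \<open>Formal deformations\<close>

text \<open>\<open>A[[\<nu>]]\<close> is \<open>'a poly3 fps\<close>, with \<open>\<nu> = fps_X\<close>; \<open>scalar\<close> embeds \<open>F[[\<nu>]]\<close>.\<close>

definition scalar :: "'a::field_char_0 fps \<Rightarrow> 'a poly3 fps" where
  "scalar s = Abs_fps (\<lambda>n. cst (fps_nth s n))"

text \<open>The \<open>F[[\<nu>]]\<close>-bilinear extension of an \<open>F\<close>-bilinear map \<open>V\<close> on \<open>A\<close> to \<open>A[[\<nu>]]\<close>.\<close>

definition bilinear_ext ::
  "('a::field_char_0 poly3 \<Rightarrow> 'a poly3 \<Rightarrow> 'a poly3) \<Rightarrow> 'a poly3 fps \<Rightarrow> 'a poly3 fps \<Rightarrow> 'a poly3 fps" where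
  "bilinear_ext V F G = Abs_fps (\<lambda>n. \<Sum>j\<le>n. V (fps_nth F j) (fps_nth G (n - j)))"

text \<open>The map \<open>\<pi> 0 + \<pi> 1 \<nu> + \<pi> 2 \<nu>\<^sup>2 + \<dots>\<close>, and its partial sum up to \<open>\<nu>\<^sup>m\<close>.\<close>

definition formal_sum ::
  "(nat \<Rightarrow> 'a::field_char_0 poly3 \<Rightarrow> 'a poly3 \<Rightarrow> 'a poly3) \<Rightarrow> 'a poly3 fps \<Rightarrow> 'a poly3 fps \<Rightarrow> 'a poly3 fps" where
  "formal_sum \<pi> F G = Abs_fps (\<lambda>n. \<Sum>i\<le>n. fps_nth (bilinear_ext (\<pi> i) F G) (n - i))"

definition partial_sum ::
  "nat \<Rightarrow> (nat \<Rightarrow> 'a::field_char_0 poly3 \<Rightarrow> 'a poly3 \<Rightarrow> 'a poly3) \<Rightarrow> 'a poly3 fps \<Rightarrow> 'a poly3 fps \<Rightarrow> 'a poly3 fps" where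
  "partial_sum m \<pi> F G = (\<Sum>i\<le>m. bilinear_ext (\<pi> i) F G * fps_X ^ i)"

definition formal_deformation ::
  "('a::field_char_0 poly3 \<Rightarrow> 'a poly3 \<Rightarrow> 'a poly3)
    \<Rightarrow> ('a poly3 fps \<Rightarrow> 'a poly3 fps \<Rightarrow> 'a poly3 fps) \<Rightarrow> bool" where
  "formal_deformation \<pi>0 B \<longleftrightarrow>
     (\<exists>\<pi>. (\<forall>i. biderivation (\<pi> i)) \<and> \<pi> 0 = \<pi>0 \<and> B = formal_sum \<pi>) \<and>
     (\<forall>F G H. B F (B G H) + B G (B H F) + B H (B F G) = 0)"

definition equivalent_deformations ::
  "('a::field_char_0 poly3 fps \<Rightarrow> 'a poly3 fps \<Rightarrow> 'a poly3 fps)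
    \<Rightarrow> ('a poly3 fps \<Rightarrow> 'a poly3 fps \<Rightarrow> 'a poly3 fps) \<Rightarrow> bool" where
  "equivalent_deformations B B' \<longleftrightarrow>
     (\<exists>\<Phi>. (\<forall>F G. \<Phi> (F + G) = \<Phi> F + \<Phi> G) \<and>
          (\<forall>s F. \<Phi> (scalar s * F) = scalar s * \<Phi> F) \<and>
          (\<forall>F G. \<Phi> (F * G) = \<Phi> F * \<Phi> G) \<and>
          \<Phi> 1 = 1 \<and>
          (\<forall>F. fps_X dvd \<Phi> F - F) \<and>
          (\<forall>F G. \<Phi> (B F G) = B' (\<Phi> F) (\<Phi> G)))"


section \<open>Deformations of order \<open>m\<close>\<close>

text \<open>
  Elements of \<open>A[[\<nu>]] / \<langle>\<nu>\<^sup>m\<^sup>+\<^sup>1\<rangle>\<close> are given by representatives in \<open>A[[\<nu>]]\<close>, and maps on the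
  quotient by maps on \<open>A[[\<nu>]]\<close> that respect \<open>nu_cong m\<close>; equality in the quotient is
  \<open>nu_cong m\<close>. Scalars from \<open>F[[\<nu>]]\<close> act through \<open>F[[\<nu>]] / \<langle>\<nu>\<^sup>m\<^sup>+\<^sup>1\<rangle>\<close>.
\<close>

definition nu_cong :: "nat \<Rightarrow> 'a::field_char_0 poly3 fps \<Rightarrow> 'a poly3 fps \<Rightarrow> bool" where
  "nu_cong m F G \<longleftrightarrow> fps_X ^ (m + 1) dvd F - G"

definition order_deformation ::
  "nat \<Rightarrow> ('a::field_char_0 poly3 \<Rightarrow> 'a poly3 \<Rightarrow> 'a poly3)
    \<Rightarrow> ('a poly3 fps \<Rightarrow> 'a poly3 fps \<Rightarrow> 'a poly3 fps) \<Rightarrow> bool" where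
  "order_deformation m \<pi>0 B \<longleftrightarrow>
     (\<exists>\<pi>. (\<forall>i\<le>m. biderivation (\<pi> i)) \<and> \<pi> 0 = \<pi>0 \<and>
          (\<forall>F G. nu_cong m (B F G) (partial_sum m \<pi> F G))) \<and>
     (\<forall>F G H. nu_cong m (B F (B G H) + B G (B H F) + B H (B F G)) 0)"

definition order_equivalent ::
  "nat \<Rightarrow> ('a::field_char_0 poly3 fps \<Rightarrow> 'a poly3 fps \<Rightarrow> 'a poly3 fps)
    \<Rightarrow> ('a poly3 fps \<Rightarrow> 'a poly3 fps \<Rightarrow> 'a poly3 fps) \<Rightarrow> bool" where
  "order_equivalent m B B' \<longleftrightarrow>
     (\<exists>\<Phi>. (\<forall>F G. nu_cong m F G \<longrightarrow> nu_cong m (\<Phi> F) (\<Phi> G)) \<and>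
          (\<forall>F G. nu_cong m (\<Phi> (F + G)) (\<Phi> F + \<Phi> G)) \<and>
          (\<forall>s F. nu_cong m (\<Phi> (scalar s * F)) (scalar s * \<Phi> F)) \<and>
          (\<forall>F G. nu_cong m (\<Phi> (F * G)) (\<Phi> F * \<Phi> G)) \<and>
          nu_cong m (\<Phi> 1) 1 \<and>
          (\<forall>F. fps_X dvd \<Phi> F - F) \<and>
          (\<forall>F G. nu_cong m (\<Phi> (B F G)) (B' (\<Phi> F) (\<Phi> G))))"


section \<open>The family of representatives\<close>

text \<open>
  \<open>c k l i\<close> is the constant \<open>c\<^sup>k\<close> with lower indices \<open>l, i\<close>, and \<open>cb k r\<close> is the barred
  constant with upper index \<open>k\<close> and lower index \<open>r\<close>. Outside the prescribed index sets
  the functions are required to vanish, so that they correspond exactly to the families.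
\<close>

definition admissible ::
  "nat \<Rightarrow> nat set \<Rightarrow> (nat \<Rightarrow> nat \<Rightarrow> nat \<Rightarrow> 'a::field_char_0) \<Rightarrow> (nat \<Rightarrow> nat \<Rightarrow> 'a) \<Rightarrow> bool" where
  "admissible \<mu> E c cb \<longleftrightarrow>
     (\<forall>k l i. \<not> (1 \<le> k \<and> i \<in> E) \<longrightarrow> c k l i = 0) \<and>
     (\<forall>k r. \<not> (1 \<le> k \<and> 1 \<le> r \<and> r < \<mu>) \<longrightarrow> cb k r = 0) \<and>
     (\<forall>k\<ge>1. finite {(l, i). c k l i \<noteq> 0} \<and> finite {r. cb k r \<noteq> 0})"

text \<open>Sums over \<open>(l, i) \<in> \<nat> \<times> E\<close> are restricted to the support of \<open>c\<close>,
  finite for admissible \<open>c\<close>.\<close>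

definition pi_coeff ::
  "nat \<Rightarrow> nat set \<Rightarrow> 'a::field_char_0 poly3 \<Rightarrow> (nat \<Rightarrow> 'a poly3)
    \<Rightarrow> (nat \<Rightarrow> nat \<Rightarrow> nat \<Rightarrow> 'a) \<Rightarrow> (nat \<Rightarrow> nat \<Rightarrow> 'a)
    \<Rightarrow> nat \<Rightarrow> 'a poly3 \<Rightarrow> 'a poly3 \<Rightarrow> 'a poly3" where
  "pi_coeff \<mu> E \<phi> u c cb n f g =
     (if n = 0 then bracket \<phi> f g
      else
        (\<Sum>(a, b) \<in> {(a, b). 1 \<le> a \<and> 1 \<le> b \<and> a + b = n}.
           \<Sum>(l, i) \<in> {(l, i). i \<in> E \<and> c a l i \<noteq> 0}.
             \<Sum>r \<in> {1..<\<mu>}. cst (c a l i * cb b r) * \<phi> ^ l * u i * bracket (u r) f g)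
        + (\<Sum>(m, j) \<in> {(m, j). j \<in> E \<and> c n m j \<noteq> 0}. cst (c n m j) * \<phi> ^ m * u j * bracket \<phi> f g)
        + (\<Sum>s \<in> {1..<\<mu>}. cst (cb n s) * bracket (u s) f g))"

end

theory Submission
  imports Defs
begin

text \<open>
  A biderivation is a vector field \<open>Y \<in> A\<^sup>3\<close>, and it is Poisson iff \<open>Y \<cdot> curl Y = 0\<close>. The family in the
  proposition is \<open>(1 + P) \<nabla>Q\<close> with \<open>P = \<Sum> c\<^sup>n\<^sub>l\<^sub>,\<^sub>i \<phi>\<^sup>l u\<^sub>i \<nu>\<^sup>n\<close> and \<open>Q = \<phi> + \<Sum> cb\<^sup>n\<^sub>r u\<^sub>r \<nu>\<^sup>n\<close>, which has this
  property.

  Since \<open>A_sing\<close> is finite-dimensional and the \<open>u\<^sub>i\<close> are homogeneous, powers of \<open>x, y, z\<close> lie in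
  the Jacobian ideal. Hence the Koszul complex of \<open>\<nabla>\<phi>\<close> is exact, and together with the Poincare
  lemma and Euler's formula this gives the Poisson cohomology by induction on the weighted degree:
  the 2-cocycles (\<open>\<nabla>\<phi> \<cdot> curl Y = 0\<close>) are, modulo the coboundaries \<open>\<nabla>(X \<cdot> \<nabla>\<phi>) - div X \<nabla>\<phi>\<close>,
  spanned by the \<open>\<phi>\<^sup>l u\<^sub>i \<nabla>\<phi>\<close> and the \<open>\<nabla>u\<^sub>r\<close>. If \<open>d \<noteq> w1 + w2 + w3\<close>, these classes are independent,
  and every Poisson derivation is Hamiltonian.

  Two deformations that agree below order \<open>n\<close> differ at order \<open>n\<close> by a 2-cocycle, and
  \<open>exp (\<nu>\<^sup>n X)\<close> changes the coefficient of order \<open>n\<close> by the coboundary of \<open>X\<close>; so all coefficients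
  are normalised successively. For uniqueness, an equivalence which is the identity below order \<open>n\<close>
  starts with a Hamiltonian derivation as soon as the coefficients of order \<open>n\<close> agree, which they do
  by independence; it is moved to order \<open>n + 1\<close> by the flow of the Hamiltonian with respect to
  the deformed bracket.
\<close>

section \<open>Derivations and gradings of \<open>F[x,y,z]\<close>\<close>

text \<open>Let \<epsilon> = (w1 x, w2 y, w3 z) be the Euler field. Since \<open>d\<close> \<phi> =
  \<epsilon> . \<nabla>\<phi>, the polynomial \<phi> itself lies in the Jacobian ideal, and each
  division by \<nabla>\<phi> lowers the degree by \<open>d\<close>: this is the source of the powers
  of \<phi> and of the induction. For a polynomial A in \<phi>, the coboundary of A \<epsilon> is (d
  - w1 - w2 - w3) A \<nabla>\<phi>. If the factor is nonzero, the classes \<phi>^l u_0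
  \<nabla>\<phi> die, which is why \<open>E\<close> then starts at 1. If it is zero, A \<epsilon> is
  a Poisson derivation that is not Hamiltonian (for A nonzero); an equivalence may start with it,
  and the uniqueness argument breaks down. The family is not linear in its constants, but the
  products of \<open>c\<close> and \<open>cb\<close> in order n involve lower orders only. The new
  constants enter as P_n \<nabla>\<phi> + \<nabla>Q_n, so linear statements about classes suffice at
  each order. In the uniqueness proof the flow must be that of the deformed bracket, because
  composing with it then changes the equivalence but neither of the two brackets it
  compares.\<close>

lemma poly_map_poly_add:
  assumes "h 0 = 0" "\<And>a b. h (a + b) = h a + h b"
  shows "poly (map_poly h (p + q)) (s :: 'b::comm_ring_1) = poly (map_poly h p) s + poly (map_poly h q) s"
proof -
  have "map_poly h (p + q) = map_poly h p + map_poly h q"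
    by (rule poly_eqI) (simp add: coeff_map_poly assms)
  then show ?thesis by simp
qed

lemma poly_map_poly_mult:
  fixes h :: "'a::comm_ring_1 \<Rightarrow> 'b::comm_ring_1"
  assumes "h 0 = 0" "\<And>a b. h (a + b) = h a + h b" "\<And>a b. h (a * b) = h a * h b"
  shows "poly (map_poly h (p * q)) s = poly (map_poly h p) s * poly (map_poly h q) s"
proof (induction p)
  case 0
  then show ?case by simp
next
  case (pCons a p)
  have sm: "map_poly h (smult a q) = smult (h a) (map_poly h q)"
    by (rule poly_eqI) (simp add: coeff_map_poly assms)
  have "poly (map_poly h (pCons a p * q)) s = poly (map_poly h (smult a q + pCons 0 (p * q))) s"
    by simp
  also have "\<dots> = h a * poly (map_poly h q) s + s * poly (map_poly h (p * q)) s"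
    by (subst poly_map_poly_add) (simp_all add: assms sm map_poly_pCons)
  also have "\<dots> = poly (map_poly h (pCons a p)) s * poly (map_poly h q) s"
    using pCons by (simp add: map_poly_pCons assms algebra_simps)
  finally show ?case .
qed

text \<open>Used twice in a row for \<open>dx\<close>, once for \<open>dy\<close>, and later for the
  Euler field acting on the coefficients of \<open>wsubst\<close>.\<close>

lemma map_poly_derivation:
  fixes D :: "'a::comm_ring_1 \<Rightarrow> 'a"
  assumes "\<And>a b. D (a + b) = D a + D b" "\<And>a b. D (a * b) = a * D b + D a * b"
  shows "map_poly D (p + q) = map_poly D p + map_poly D q"
    and "map_poly D (p * q) = p * map_poly D q + map_poly D p * q"
proof -
  have D0: "D 0 = 0" using assms(1)[of 0 0] by simp
  show add: "map_poly D (p + q) = map_poly D p + map_poly D q" for p q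
    by (rule poly_eqI) (simp add: coeff_map_poly D0 assms)
  show "map_poly D (p * q) = p * map_poly D q + map_poly D p * q"
  proof (induction p)
    case 0
    then show ?case by simp
  next
    case (pCons a p)
    have sm: "map_poly D (smult a q) = smult a (map_poly D q) + smult (D a) q"
      by (rule poly_eqI) (simp add: coeff_map_poly D0 assms)
    have "map_poly D (pCons a p * q) = map_poly D (smult a q + pCons 0 (p * q))" by simp
    also have "\<dots> = smult a (map_poly D q) + smult (D a) q + pCons 0 (map_poly D (p * q))"
      by (simp add: add sm map_poly_pCons D0)
    finally show ?case using pCons by (simp add: map_poly_pCons D0 algebra_simps)
  qed
qed

lemma pderiv_leibniz: "pderiv (f * g) = f * pderiv g + pderiv f * (g :: 'a::idom poly)"
  by (induction f) (simp_all add: pderiv_add pderiv_smult pderiv_pCons algebra_simps)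

lemma dy_dz_derivation:
  fixes f g :: "'a::field_char_0 poly3"
  shows "dy (f + g) = dy f + dy g" "dy (f * g) = f * dy g + dy f * g"
    "dz (f + g) = dz f + dz g" "dz (f * g) = f * dz g + dz f * g"
  unfolding dy_def dz_def
  by (auto intro!: map_poly_derivation simp: pderiv_add pderiv_leibniz)

lemma dx_derivation:
  fixes f g :: "'a::field_char_0 poly3"
  shows "dx (f + g) = dx f + dx g" "dx (f * g) = f * dx g + dx f * g"
  unfolding dx_def
  by (intro map_poly_derivation; simp add: map_poly_derivation pderiv_add pderiv_leibniz)+

lemmas d_add [simp] = dx_derivation(1) dy_dz_derivation(1,3)
lemmas d_mult [simp] = dx_derivation(2) dy_dz_derivation(2,4)

lemma d_cst [simp]: "dx (cst a) = 0" "dy (cst a) = 0" "dz (cst a) = 0"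
  by (simp_all add: dx_def dy_def dz_def cst_def map_poly_pCons pderiv_pCons)

lemma d_vars [simp]:
  "dx (Xv :: 'a::field_char_0 poly3) = 1" "dx (Yv :: 'a poly3) = 0" "dx (Zv :: 'a poly3) = 0"
  "dy (Xv :: 'a::field_char_0 poly3) = 0" "dy (Yv :: 'a poly3) = 1" "dy (Zv :: 'a poly3) = 0"
  "dz (Xv :: 'a::field_char_0 poly3) = 0" "dz (Yv :: 'a poly3) = 0" "dz (Zv :: 'a poly3) = 1"
  by (simp_all add: dx_def dy_def dz_def Xv_def Yv_def Zv_def map_poly_pCons pderiv_pCons one_pCons)

lemma cst_simps:
  "cst (a + b) = cst a + cst b" "cst (a * b) = cst a * cst b" "cst (- a) = - cst a"
  "cst (a - b) = cst a - cst b"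
  by (simp_all add: cst_def algebra_simps)

lemma cst_0 [simp]: "cst 0 = 0" and cst_1 [simp]: "cst 1 = 1"
  by (simp_all add: cst_def one_pCons)

lemma cst_eq_0_iff [simp]: "cst a = 0 \<longleftrightarrow> a = 0"
  by (simp add: cst_def)

lemma cst_of_nat [simp]: "cst (of_nat n) = of_nat n"
  by (induction n) (simp_all add: cst_simps)

lemma cst_of_int [simp]: "cst (of_int n) = of_int n"
  by (cases n) (simp_all add: cst_simps)

lemma cst_sum: "cst (sum f A) = (\<Sum>i\<in>A. cst (f i))"
  by (induction A rule: infinite_finite_induct) (simp_all add: cst_simps)

text \<open>Derivations and ring homomorphisms are determined by constants and variables, so
  identities between them need no computation with nested coefficients.\<close>

lemma poly3_induct [case_names cst X Y Z add mult]:
  fixes f :: "'a::field_char_0 poly3"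
  assumes c: "\<And>a. P (cst a)" and X: "P Xv" and Y: "P Yv" and Z: "P Zv"
    and add: "\<And>f g. P f \<Longrightarrow> P g \<Longrightarrow> P (f + g)" and mult: "\<And>f g. P f \<Longrightarrow> P g \<Longrightarrow> P (f * g)"
  shows "P f"
proof -
  have P0: "P 0" using c[of 0] by simp
  have 1: "P [:[:p:]:]" for p
  proof (induction p)
    case (pCons a p)
    have "[:[:pCons a p:]:] = cst a + Xv * [:[:p:]:]" by (simp add: cst_def Xv_def)
    then show ?case using pCons c X add mult by metis
  qed (use P0 in simp)
  have 2: "P [:p:]" for p
  proof (induction p)
    case (pCons a p)
    have "[:pCons a p:] = [:[:a:]:] + Yv * [:p:]" by (simp add: Yv_def)
    then show ?case using pCons 1 Y add mult by metis
  qed (use P0 in simp)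
  show ?thesis
  proof (induction f)
    case (pCons a p)
    have "pCons a p = [:a:] + Zv * p" by (simp add: Zv_def)
    then show ?case using pCons 2 Z add mult by metis
  qed (use P0 in simp)
qed

lemma derivation_chain:
  fixes D :: "'a::field_char_0 poly3 \<Rightarrow> 'a poly3"
  assumes "\<And>f g. D (f + g) = D f + D g" "\<And>a. D (cst a) = 0" "\<And>f g. D (f * g) = f * D g + D f * g"
  shows "D f = D Xv * dx f + D Yv * dy f + D Zv * dz f"
  by (induction f rule: poly3_induct) (simp_all add: assms algebra_simps)

lemma derivation_of_const_mult:
  assumes "derivation D"
  shows "D (cst a) = 0"
proof -
  have "D (1 * 1) = D 1 + D 1" using assms unfolding derivation_def by (metis mult_1 mult.right_neutral)
  then have "D 1 = 0" by simp
  moreover have "D (cst a * 1) = cst a * D 1" using assms unfolding derivation_def by blast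
  ultimately show ?thesis by simp
qed

lemma derivation_eq:
  assumes "derivation D"
  shows "D f = D Xv * dx f + D Yv * dy f + D Zv * dz f"
  using assms derivation_of_const_mult[OF assms]
  by (intro derivation_chain) (auto simp: derivation_def)

lemma d_diff [simp]:
  "dx (f - g) = dx f - dx g" "dy (f - g) = dy f - dy g" "dz (f - g) = dz f - dz g"
  by (metis d_add add_diff_cancel diff_add_cancel)+

lemma d_0 [simp]: "dx 0 = 0" "dy 0 = 0" "dz 0 = 0"
  using d_cst[of 0] by simp_all

lemma d_minus [simp]: "dx (- f) = - dx f" "dy (- f) = - dy f" "dz (- f) = - dz f"
  using d_diff[of 0 f] by simp_all

lemma d_1 [simp]: "dx 1 = 0" "dy 1 = 0" "dz 1 = 0"
  using d_cst[of 1] by simp_all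

lemma d_of_nat [simp]: "dx (of_nat n) = 0" "dy (of_nat n) = 0" "dz (of_nat n) = 0"
  using d_cst[of "of_nat n"] by simp_all

lemma d_of_int [simp]: "dx (of_int n) = 0" "dy (of_int n) = 0" "dz (of_int n) = 0"
  using d_cst[of "of_int n"] by simp_all

lemma d_sum: "dx (sum f A) = (\<Sum>i\<in>A. dx (f i))" "dy (sum f A) = (\<Sum>i\<in>A. dy (f i))"
  "dz (sum f A) = (\<Sum>i\<in>A. dz (f i))"
  by (induction A rule: infinite_finite_induct; simp)+

lemma d_power:
  "dx (f ^ n) = of_nat n * f ^ (n - 1) * dx f" "dy (f ^ n) = of_nat n * f ^ (n - 1) * dy f"
  "dz (f ^ n) = of_nat n * f ^ (n - 1) * dz f"
proof -
  have *: "D (f ^ n) = of_nat n * f ^ (n - 1) * D f"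
    if "\<And>f g. D (f * g) = f * D g + D f * g" "D 1 = 0" for D :: "'a poly3 \<Rightarrow> 'a poly3"
  proof (induction n)
    case (Suc n)
    then show ?case by (cases n) (simp_all add: that algebra_simps)
  qed (simp add: that)
  show "dx (f ^ n) = of_nat n * f ^ (n - 1) * dx f" "dy (f ^ n) = of_nat n * f ^ (n - 1) * dy f"
    "dz (f ^ n) = of_nat n * f ^ (n - 1) * dz f"
    by (rule *; simp)+
qed

lemma d_commute: "dy (dx f) = dx (dy f)" "dz (dx f) = dx (dz f)" "dz (dy f) = dy (dz f)"
  by (induction f rule: poly3_induct; simp add: algebra_simps)+

text \<open>In characteristic zero a vanishing derivative forces degree zero; the variables are
  removed from the outermost inwards.\<close>

lemma gradient_zero_imp_const:
  assumes "dx f = 0" "dy f = 0" "dz f = 0"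
  shows "\<exists>a. f = cst a"
proof -
  have "degree f = 0" using assms(3) by (simp add: dz_def pderiv_eq_0_iff)
  then obtain g where g: "f = [:g:]" by (rule degree_eq_zeroE)
  have "pderiv g = 0" using assms(2) g by (simp add: dy_def map_poly_pCons)
  then obtain h where h: "g = [:h:]" by (metis pderiv_eq_0_iff degree_eq_zeroE)
  have "pderiv h = 0" using assms(1) g h by (simp add: dx_def map_poly_pCons)
  then obtain a where "h = [:a:]" by (metis pderiv_eq_0_iff degree_eq_zeroE)
  then show ?thesis using g h by (auto simp: cst_def)
qed

text \<open>The homogeneous components of \<open>f\<close> are the coefficients of \<open>f(t\<^sup>w\<^sup>1 x, t\<^sup>w\<^sup>2 y, t\<^sup>w\<^sup>3 z)\<close> as a
  polynomial in \<open>t\<close>.\<close>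

definition wsubst :: "nat \<Rightarrow> nat \<Rightarrow> nat \<Rightarrow> 'a::field_char_0 poly3 \<Rightarrow> 'a poly3 poly" where
  "wsubst w1 w2 w3 f =
     poly (map_poly (\<lambda>g. poly (map_poly (\<lambda>h. poly (map_poly (\<lambda>a. [:cst a:]) h)
       (monom Xv w1)) g) (monom Yv w2)) f) (monom Zv w3)"

lemma wsubst_add: "wsubst w1 w2 w3 (f + g) = wsubst w1 w2 w3 f + wsubst w1 w2 w3 g"
  unfolding wsubst_def by (simp add: poly_map_poly_add cst_simps)

lemma wsubst_mult: "wsubst w1 w2 w3 (f * g) = wsubst w1 w2 w3 f * wsubst w1 w2 w3 g"
  unfolding wsubst_def by (simp add: poly_map_poly_mult poly_map_poly_add cst_simps)

lemma wsubst_generators: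
  "wsubst w1 w2 w3 (cst a) = [:cst a:]" "wsubst w1 w2 w3 Xv = monom Xv w1"
  "wsubst w1 w2 w3 Yv = monom Yv w2" "wsubst w1 w2 w3 Zv = monom Zv w3"
  unfolding wsubst_def by (simp_all add: cst_def Xv_def Yv_def Zv_def map_poly_pCons flip: one_pCons)

lemmas wsubst_simps = wsubst_add wsubst_mult wsubst_generators

lemma poly_wsubst_1: "poly (wsubst w1 w2 w3 f) 1 = f"
  by (induction f rule: poly3_induct) (simp_all add: wsubst_simps poly_monom)

definition euler :: "nat \<Rightarrow> nat \<Rightarrow> nat \<Rightarrow> 'a::field_char_0 poly3 \<Rightarrow> 'a poly3" where
  "euler w1 w2 w3 f = of_nat w1 * Xv * dx f + of_nat w2 * Yv * dy f + of_nat w3 * Zv * dz f"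

text \<open>Under the substitution the Euler field becomes t d/dt. Both sides are derivations along
  the homomorphism \<open>wsubst\<close>, so generators suffice. Read on coefficients, the component
  of degree k is multiplied by k (\<open>hc_L\<close>).\<close>

lemma wsubst_euler: "wsubst w1 w2 w3 (euler w1 w2 w3 f) = [:0, 1:] * pderiv (wsubst w1 w2 w3 f)"
proof (induction f rule: poly3_induct)
  have n: "wsubst w1 w2 w3 (of_nat n :: 'a poly3) = [:of_nat n:]" for n
    using wsubst_generators(1)[of w1 w2 w3 "of_nat n :: 'a"] by simp
  have m: "[:of_nat n:] * monom a n = [:0, 1:] * pderiv (monom a n)" for n :: nat and a :: "'a poly3"
    by (rule poly_eqI) (auto simp: coeff_pderiv coeff_pCons split: nat.split)
  {
    case (cst a)
    then show ?case using wsubst_generators(1)[of w1 w2 w3 "0::'a"]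
      by (simp add: euler_def wsubst_simps)
  next
    case X
    show ?case using m by (simp add: euler_def wsubst_simps n)
  next
    case Y
    show ?case using m by (simp add: euler_def wsubst_simps n)
  next
    case Z
    show ?case using m by (simp add: euler_def wsubst_simps n)
  next
    case (add f g)
    have "euler w1 w2 w3 (f + g) = euler w1 w2 w3 f + euler w1 w2 w3 g"
      by (simp add: euler_def algebra_simps)
    then show ?case by (simp only: wsubst_simps add pderiv_add distrib_left)
  next
    case (mult f g)
    have "euler w1 w2 w3 (f * g) = f * euler w1 w2 w3 g + euler w1 w2 w3 f * g"
      by (simp add: euler_def algebra_simps)
    then show ?case by (simp only: wsubst_simps mult pderiv_leibniz) (simp only: algebra_simps)
  }
qed

lemma euler_simps:
  "euler w1 w2 w3 (f + g) = euler w1 w2 w3 f + euler w1 w2 w3 g"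
  "euler w1 w2 w3 (f - g) = euler w1 w2 w3 f - euler w1 w2 w3 g"
  "euler w1 w2 w3 (f * g) = f * euler w1 w2 w3 g + euler w1 w2 w3 f * g"
  "euler w1 w2 w3 (cst a) = 0"
  by (simp_all add: euler_def algebra_simps)

lemma euler_sum: "euler w1 w2 w3 (sum f A) = (\<Sum>i\<in>A. euler w1 w2 w3 (f i))"
  by (induction A rule: infinite_finite_induct)
    (simp_all add: euler_simps euler_simps(4)[where a = 0, simplified])

lemma d_euler:
  "dx (euler w1 w2 w3 f) = euler w1 w2 w3 (dx f) + of_nat w1 * dx f"
  "dy (euler w1 w2 w3 f) = euler w1 w2 w3 (dy f) + of_nat w2 * dy f"
  "dz (euler w1 w2 w3 f) = euler w1 w2 w3 (dz f) + of_nat w3 * dz f"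
  by (simp_all add: euler_def d_commute algebra_simps)

text \<open>Here the Euler field acts on the coefficients instead of on \<open>f\<close>, again
  giving t d/dt. Comparison with \<open>wsubst_euler\<close> shows that it commutes with taking
  components, whence these are homogeneous (\<open>hc_in_H\<close>).\<close>

lemma map_poly_euler_wsubst:
  "map_poly (euler w1 w2 w3) (wsubst w1 w2 w3 f) = [:0, 1:] * pderiv (wsubst w1 w2 w3 f)"
proof (induction f rule: poly3_induct)
  have e0: "euler w1 w2 w3 0 = 0" using euler_simps(4)[of w1 w2 w3 0] by simp
  have m: "monom (of_nat n * a) n = [:0, 1:] * pderiv (monom a n)" for n :: nat and a :: "'a poly3"
    by (rule poly_eqI) (auto simp: coeff_pderiv coeff_pCons split: nat.split)
  {
    case (cst a)
    then show ?case by (simp add: euler_simps wsubst_simps map_poly_pCons e0)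
  next
    case X
    show ?case using m[of w1 Xv] by (simp add: wsubst_simps map_poly_monom e0) (simp add: euler_def)
  next
    case Y
    show ?case using m[of w2 Yv] by (simp add: wsubst_simps map_poly_monom e0) (simp add: euler_def)
  next
    case Z
    show ?case using m[of w3 Zv] by (simp add: wsubst_simps map_poly_monom e0) (simp add: euler_def)
  next
    case (add f g)
    then show ?case
      by (simp add: wsubst_simps map_poly_derivation euler_simps pderiv_add)
  next
    case (mult f g)
    have "map_poly (euler w1 w2 w3) (p * q) = p * map_poly (euler w1 w2 w3) q + map_poly (euler w1 w2 w3) p * q" 
      for p q :: "'a poly3 poly" by (rule map_poly_derivation) (simp_all add: euler_simps)
    then show ?case by (simp only: wsubst_simps mult pderiv_leibniz) (simp only: algebra_simps)
  }
qed

definition hcomp :: "nat \<Rightarrow> nat \<Rightarrow> nat \<Rightarrow> int \<Rightarrow> 'a::field_char_0 poly3 \<Rightarrow> 'a poly3" where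
  "hcomp w1 w2 w3 k f = (if k < 0 then 0 else coeff (wsubst w1 w2 w3 f) (nat k))"

section \<open>Homogeneous components for positive weights\<close>

locale weights =
  fixes w1 w2 w3 :: nat and T :: "'a::field_char_0 itself"
  assumes w_pos: "w1 > 0" "w2 > 0" "w3 > 0"
begin

abbreviation L :: "'a poly3 \<Rightarrow> 'a poly3" where "L \<equiv> euler w1 w2 w3"
abbreviation hc :: "int \<Rightarrow> 'a poly3 \<Rightarrow> 'a poly3" where "hc \<equiv> hcomp w1 w2 w3"

lemma hc_add: "hc k (f + g) = hc k f + hc k g"
  by (simp add: hcomp_def wsubst_simps)

lemma hc_cst_mult: "hc k (cst a * f) = cst a * hc k f"
  by (simp add: hcomp_def wsubst_simps)

lemma hc_0 [simp]: "hc k 0 = 0"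
  using hc_cst_mult[of k 0 0] by simp

lemma hc_diff: "hc k (f - g) = hc k f - hc k g"
  using hc_add[of k "f - g" g] by simp

lemma hc_sum: "hc k (sum f A) = (\<Sum>i\<in>A. hc k (f i))"
  by (induction A rule: infinite_finite_induct) (simp_all add: hc_add)

lemma hc_neg [simp]: "k < 0 \<Longrightarrow> hc k f = 0"
  by (simp add: hcomp_def)

text \<open>The expansion is stated for every \<open>m\<close> beyond the bound, so that two
  polynomials can be expanded over a common range.\<close>

lemma hc_decomposition: "\<exists>n. (\<forall>k>int n. hc k f = 0) \<and> (\<forall>m\<ge>n. f = (\<Sum>k\<le>m. hc (int k) f))"
proof (intro exI conjI allI impI)
  let ?p = "wsubst w1 w2 w3 f"
  let ?n = "degree ?p"
  show "hc k f = 0" if "k > int ?n" for k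
    using that by (simp add: hcomp_def coeff_eq_0)
  show "f = (\<Sum>k\<le>m. hc (int k) f)" if "m \<ge> ?n" for m
  proof -
    have "f = poly ?p 1" by (simp add: poly_wsubst_1)
    also have "\<dots> = (\<Sum>k\<le>?n. hc (int k) f)" by (simp add: poly_altdef hcomp_def)
    also have "\<dots> = (\<Sum>k\<le>m. hc (int k) f)"
      by (rule sum.mono_neutral_left) (use that in \<open>auto simp: hcomp_def intro: coeff_eq_0\<close>)
    finally show ?thesis .
  qed
qed

lemma hc_eqI:
  assumes "\<And>k. hc k f = hc k g"
  shows "f = g"
proof -
  obtain n1 where "\<forall>m\<ge>n1. f = (\<Sum>k\<le>m. hc (int k) f)" using hc_decomposition[of f] by auto
  moreover obtain n2 where "\<forall>m\<ge>n2. g = (\<Sum>k\<le>m. hc (int k) g)" using hc_decomposition[of g] by auto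
  ultimately have "f = (\<Sum>k\<le>max n1 n2. hc (int k) f)" "g = (\<Sum>k\<le>max n1 n2. hc (int k) g)"
    by (metis max.cobounded1, metis max.cobounded2)
  then show ?thesis using assms by simp
qed

lemma hc_L: "hc k (L f) = of_int k * hc k f"
  by (auto simp: hcomp_def wsubst_euler coeff_pCons coeff_pderiv split: nat.split)
    (metis (no_types, lifting) Suc_as_int int_nat_eq not_le of_int_of_nat_eq of_nat_Suc)

text \<open>\<open>H m\<close> is the homogeneous part of degree \<open>m\<close>; it is zero for negative \<open>m\<close>, which is why
  degrees are integers.\<close>

definition H :: "int \<Rightarrow> 'a poly3 set" where "H m = {f. L f = of_int m * f}"

text \<open>Taking components in the eigenvalue equation gives (k - m) \<open>hc k f\<close> = 0,
  and k - m is a nonzero constant for k \<noteq> m in characteristic zero.\<close>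

lemma hc_H: "f \<in> H m \<Longrightarrow> hc k f = (if k = m then f else 0)"
proof -
  assume f: "f \<in> H m"
  have ne: "hc k f = 0" if "k \<noteq> m" for k
  proof -
    have "hc k (L f) = hc k (cst (of_int m) * f)" using f by (simp add: H_def)
    then have "(of_int k - of_int m) * hc k f = 0"
      by (simp only: hc_L hc_cst_mult) (simp add: algebra_simps)
    moreover have "(of_int k - of_int m :: 'a poly3) \<noteq> 0" using that by simp
    ultimately show ?thesis by simp
  qed
  have "hc m f = f"
  proof -
    obtain n where n: "\<And>m. m\<ge>n \<Longrightarrow> f = (\<Sum>k\<le>m. hc (int k) f)"
      using hc_decomposition[of f] by auto
    have "f = (\<Sum>k\<le>max n (nat m). hc (int k) f)" by (rule n) simp
    also have "\<dots> = hc m f"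
    proof (cases "m < 0")
      case True
      then have "hc (int k) f = 0" for k by (intro ne) simp
      then show ?thesis using True by simp
    next
      case False
      have "(\<Sum>k\<le>max n (nat m). hc (int k) f) = (\<Sum>k\<in>{nat m}. hc (int k) f)"
        by (rule sum.mono_neutral_right) (use False in \<open>auto intro!: ne\<close>)
      then show ?thesis using False by simp
    qed
    finally show ?thesis by simp
  qed
  then show ?thesis using ne by simp
qed

lemma H_neg: "f \<in> H m \<Longrightarrow> m < 0 \<Longrightarrow> f = 0"
  using hc_H[of f m m] by simp

lemma hc_in_H: "hc k f \<in> H k"
proof (cases "k < 0")
  case False
  have "L 0 = 0" using euler_simps(4)[of w1 w2 w3 "0::'a"] by simp
  then have "L (hc k f) = coeff (map_poly L (wsubst w1 w2 w3 f)) (nat k)"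
    using False by (simp add: hcomp_def coeff_map_poly)
  also have "\<dots> = hc k (L f)"
    using False by (simp add: map_poly_euler_wsubst hcomp_def wsubst_euler)
  finally show ?thesis by (simp add: H_def hc_L)
qed (simp add: H_def euler_def)

lemma hc_hc: "hc j (hc k f) = (if j = k then hc k f else 0)"
  using hc_H[OF hc_in_H] .

lemma H_induct:
  assumes "\<And>k g. g \<in> H k \<Longrightarrow> P g" "P 0" "\<And>f g. P f \<Longrightarrow> P g \<Longrightarrow> P (f + g)"
  shows "P f"
proof -
  obtain n where "f = (\<Sum>k\<le>n. hc (int k) f)" using hc_decomposition[of f] by blast
  moreover have "P (\<Sum>k\<in>A. hc (int k) f)" for A
    by (induction A rule: infinite_finite_induct) (simp_all add: assms(2,3) assms(1)[OF hc_in_H])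
  ultimately show ?thesis by metis
qed

lemma H_mult: "f \<in> H m \<Longrightarrow> g \<in> H n \<Longrightarrow> f * g \<in> H (m + n)"
  by (simp add: H_def euler_simps algebra_simps)

lemma H_d: "f \<in> H m \<Longrightarrow> dx f \<in> H (m - w1)" "f \<in> H m \<Longrightarrow> dy f \<in> H (m - w2)"
  "f \<in> H m \<Longrightarrow> dz f \<in> H (m - w3)"
proof -
  have *: "D f \<in> H (m - int w)"
    if "f \<in> H m" "D (L f) = L (D f) + of_nat w * D f" "D (of_int m * f) = of_int m * D f"
    for D :: "'a poly3 \<Rightarrow> 'a poly3" and w
    using that by (simp add: H_def algebra_simps)
  show "f \<in> H m \<Longrightarrow> dx f \<in> H (m - w1)" "f \<in> H m \<Longrightarrow> dy f \<in> H (m - w2)"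
    "f \<in> H m \<Longrightarrow> dz f \<in> H (m - w3)"
    by (erule *; simp add: d_euler)+
qed

lemma hc_mult_H: 
  assumes "p \<in> H m"
  shows "hc k (p * f) = p * hc (k - m) f"
proof (induction f rule: H_induct)
  case (1 j g)
  then show ?case using hc_H[OF H_mult[OF assms 1], of k] hc_H[OF 1, of "k - m"] by auto
qed (simp_all add: hc_add algebra_simps)

lemma hc_d: "hc k (dx f) = dx (hc (k + w1) f)" "hc k (dy f) = dy (hc (k + w2) f)"
  "hc k (dz f) = dz (hc (k + w3) f)"
proof -
  have *: "hc k (D f) = D (hc (k + w) f)"
    if "\<And>f g. D (f + g) = D f + D g" "\<And>f m. f \<in> H m \<Longrightarrow> D f \<in> H (m - w)"
    for D :: "'a poly3 \<Rightarrow> 'a poly3" and w :: int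
  proof (induction f rule: H_induct)
    have D0: "D 0 = 0" using that(1)[of 0 0] by simp
    {
      case (1 j g)
      then show ?case using hc_H[OF that(2)[OF 1], of k] hc_H[OF 1, of "k + w"] D0 by auto
    next
      case 2
      then show ?case by (simp add: D0)
    }
  qed (simp_all add: hc_add that)
  show "hc k (dx f) = dx (hc (k + w1) f)" "hc k (dy f) = dy (hc (k + w2) f)"
    "hc k (dz f) = dz (hc (k + w3) f)"
    by (rule *; simp add: H_d)+
qed

section \<open>Truncation by weighted degree\<close>

definition tr :: "int \<Rightarrow> 'a poly3 \<Rightarrow> 'a poly3" where
  "tr n f = (\<Sum>k\<in>{0..n}. hc k f)"

lemma hc_tr: "hc k (tr n f) = (if k \<le> n then hc k f else 0)"
proof -
  have "hc k (tr n f) = (\<Sum>j\<in>{0..n}. if k = j then hc k f else 0)"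
    by (auto simp: tr_def hc_sum hc_hc intro!: sum.cong)
  then show ?thesis by (cases "k < 0") (simp_all add: sum.delta')
qed

lemma tr_add: "tr n (f + g) = tr n f + tr n g"
  by (rule hc_eqI) (simp add: hc_tr hc_add)

lemma tr_diff: "tr n (f - g) = tr n f - tr n g"
  by (rule hc_eqI) (simp add: hc_tr hc_diff)

lemma tr_0 [simp]: "tr n 0 = 0"
  by (rule hc_eqI) (simp add: hc_tr)

lemma tr_cst_mult: "tr n (cst a * f) = cst a * tr n f"
  by (rule hc_eqI) (simp add: hc_tr hc_cst_mult)

lemma tr_sum: "tr n (sum f A) = (\<Sum>i\<in>A. tr n (f i))"
  by (induction A rule: infinite_finite_induct) (simp_all add: tr_add)

lemma tr_mult_H: "p \<in> H m \<Longrightarrow> tr n (p * f) = p * tr (n - m) f"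
  by (rule hc_eqI) (simp add: hc_tr hc_mult_H)

lemma tr_H: "p \<in> H m \<Longrightarrow> tr n p = (if m \<le> n then p else 0)"
  by (rule hc_eqI) (auto simp: hc_tr hc_H)

lemma tr_tr: "tr n (tr m f) = tr (min n m) f"
  by (rule hc_eqI) (simp add: hc_tr)

lemma d_tr: "dx (tr n f) = tr (n - w1) (dx f)" "dy (tr n f) = tr (n - w2) (dy f)"
  "dz (tr n f) = tr (n - w3) (dz f)"
  by (rule hc_eqI; simp add: hc_tr hc_d)+

lemma tr_neg [simp]: "n < 0 \<Longrightarrow> tr n f = 0"
  by (simp add: tr_def)

text \<open>The equation \<open>tr n f = f\<close> is the degree bound on which the later inductions
  run. Truncation, unlike a single component, keeps inhomogeneous polynomials whole, and a negative
  bound forces zero, which starts the inductions.\<close>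

lemma tr_exhaust: "\<exists>n. tr n f = f"
proof -
  obtain n where "\<forall>k>int n. hc k f = 0" using hc_decomposition[of f] by blast
  then have "hc k (tr (int n) f) = hc k f" for k by (simp add: hc_tr)
  then have "tr (int n) f = f" by (rule hc_eqI)
  then show ?thesis by blast
qed

lemma tr_mono: "tr n f = f \<Longrightarrow> n \<le> m \<Longrightarrow> tr m f = f"
  by (metis min.absorb2 tr_tr)

text \<open>Since \<open>1 / 0 = 0\<close>, \<open>R 0\<close> inverts \<open>L\<close> on the polynomials without constant term.\<close>

definition R :: "nat \<Rightarrow> 'a poly3 \<Rightarrow> 'a poly3" where
  "R c f = (\<Sum>k\<le>degree (wsubst w1 w2 w3 f). cst (1 / of_nat (k + c)) * hc (int k) f)"

lemma hc_R: "hc k (R c f) = cst (1 / of_int (k + c)) * hc k f"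
proof (cases "k < 0")
  case False
  have "hc k (R c f) = (\<Sum>j\<le>degree (wsubst w1 w2 w3 f).
      if j = nat k then cst (1 / of_int (k + c)) * hc k f else 0)"
    using False by (simp add: R_def hc_sum hc_cst_mult hc_hc nat_eq_iff2) (rule sum.cong, auto)
  also have "\<dots> = cst (1 / of_int (k + c)) * hc k f"
  proof (cases "nat k \<le> degree (wsubst w1 w2 w3 f)")
    case True
    then show ?thesis by simp
  next
    case gt: False
    then have "hc k f = 0" using False by (simp add: hcomp_def coeff_eq_0)
    then show ?thesis by simp
  qed
  finally show ?thesis .
qed simp

lemma L_R: 
  assumes "c > 0 \<or> hc 0 f = 0"
  shows "L (R c f) + of_nat c * R c f = f"
proof (rule hc_eqI)
  fix k
  have "hc k (of_nat c * R c f) = of_nat c * hc k (R c f)"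
    using hc_cst_mult[of k "of_nat c" "R c f"] by simp
  then have *: "hc k (L (R c f) + of_nat c * R c f) = cst (of_int (k + c)) * cst (1 / of_int (k + c)) * hc k f"
    by (simp add: hc_add hc_L hc_R cst_simps algebra_simps)
  show "hc k (L (R c f) + of_nat c * R c f) = hc k f"
  proof (cases "hc k f = 0")
    case False
    then have "k \<ge> 0" using hc_neg[of k f] by (metis not_le)
    moreover have "k \<noteq> 0 \<or> c > 0" using False assms by auto
    ultimately have "(of_int (k + c) :: 'a) \<noteq> 0" by (subst of_int_eq_0_iff) auto
    then have "cst (of_int (k + c)) * cst (1 / of_int (k + c) :: 'a) = 1"
      by (simp only: cst_simps(2)[symmetric]) simp
    then show ?thesis using * by simp
  qed (use * in simp)
qed

lemma tr_R: "tr n f = f \<Longrightarrow> tr n (R c f) = R c f"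
  by (rule hc_eqI) (metis hc_R hc_tr mult_zero_right)

text \<open>The kernel of \<open>L\<close> + c is homogeneous of the negative degree - c, hence
  zero.\<close>

lemma L_inj: 
  assumes "L f + of_nat c * f = L g + of_nat c * g" "c > 0"
  shows "f = g"
proof -
  have "f - g \<in> H (- int c)" using assms(1) by (simp add: H_def euler_simps algebra_simps)
  then have "f - g = 0" by (rule H_neg) (use assms in simp)
  then show ?thesis by simp
qed

section \<open>Poincare lemmas by inversion of the Euler field\<close>

lemma hc_0_vars: "hc 0 (Xv * f) = 0" "hc 0 (Yv * f) = 0" "hc 0 (Zv * f) = 0"
proof -
  have "Xv \<in> H (int w1)" "Yv \<in> H (int w2)" "Zv \<in> H (int w3)" by (simp_all add: H_def euler_def)
  then show "hc 0 (Xv * f) = 0" "hc 0 (Yv * f) = 0" "hc 0 (Zv * f) = 0"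
    using w_pos by (simp_all add: hc_mult_H)
qed

text \<open>By Cartan's formula the gradient of the contraction \<epsilon> . Y of a curl-free Y is
  the Lie derivative of Y, with components \<open>L Y1 + of_nat w1 * Y1\<close> and so on. The
  contraction has no constant term, so \<open>R 0\<close> inverts \<open>L\<close> on it, and
  injectivity of \<open>L\<close> + w_i identifies the gradient of the result with Y.\<close>

lemma poincare_gradient:
  assumes "dy Y3 = dz Y2" "dz Y1 = dx Y3" "dx Y2 = dy (Y1 :: 'a poly3)"
  shows "\<exists>f. dx f = Y1 \<and> dy f = Y2 \<and> dz f = Y3"
proof -
  define s where "s = of_nat w1 * Xv * Y1 + of_nat w2 * Yv * Y2 + of_nat w3 * Zv * Y3"
  have "s = Xv * (of_nat w1 * Y1) + Yv * (of_nat w2 * Y2) + Zv * (of_nat w3 * Y3)"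
    by (simp add: s_def algebra_simps)
  then have "hc 0 s = 0" by (simp only: hc_add hc_0_vars) simp
  then have Lf: "L (R 0 s) = s" using L_R[of 0 s] by simp
  have "dx (R 0 s) = Y1" 
  proof (rule L_inj[OF _ w_pos(1)])
    show "L (dx (R 0 s)) + of_nat w1 * dx (R 0 s) = L Y1 + of_nat w1 * Y1"
      unfolding d_euler[symmetric] Lf using assms
      by (simp add: s_def euler_def algebra_simps)
  qed
  moreover have "dy (R 0 s) = Y2"
  proof (rule L_inj[OF _ w_pos(2)])
    show "L (dy (R 0 s)) + of_nat w2 * dy (R 0 s) = L Y2 + of_nat w2 * Y2"
      unfolding d_euler[symmetric] Lf using assms
      by (simp add: s_def euler_def algebra_simps)
  qed
  moreover have "dz (R 0 s) = Y3"
  proof (rule L_inj[OF _ w_pos(3)])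
    show "L (dz (R 0 s)) + of_nat w3 * dz (R 0 s) = L Y3 + of_nat w3 * Y3"
      unfolding d_euler[symmetric] Lf using assms
      by (simp add: s_def euler_def algebra_simps)
  qed
  ultimately show ?thesis by blast
qed

text \<open>With \<open>e\<close> the Euler field, the potential is obtained componentwise from \<open>X \<times> e\<close>, because
  \<open>curl (X \<times> e)\<close> is the Lie derivative of a divergence-free \<open>X\<close>.\<close>

lemma poincare_curl:
  assumes div: "dx X1 + dy X2 + dz X3 = (0 :: 'a poly3)"
  shows "\<exists>Z1 Z2 Z3. dy Z3 - dz Z2 = X1 \<and> dz Z1 - dx Z3 = X2 \<and> dx Z2 - dy Z1 = X3"
proof -
  define S1 where "S1 = of_nat w3 * Zv * X2 - of_nat w2 * Yv * X3"
  define S2 where "S2 = of_nat w1 * Xv * X3 - of_nat w3 * Zv * X1"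
  define S3 where "S3 = of_nat w2 * Yv * X1 - of_nat w1 * Xv * X2"
  define Z1 Z2 Z3 where "Z1 = R w1 S1" "Z2 = R w2 S2" "Z3 = R w3 S3"
  have L1: "L Z1 + of_nat w1 * Z1 = S1" unfolding Z1_Z2_Z3_def by (rule L_R) (use w_pos in simp)
  have L2: "L Z2 + of_nat w2 * Z2 = S2" unfolding Z1_Z2_Z3_def by (rule L_R) (use w_pos in simp)
  have L3: "L Z3 + of_nat w3 * Z3 = S3" unfolding Z1_Z2_Z3_def by (rule L_R) (use w_pos in simp)
  \<comment> \<open>The Lie derivative of the 2-form dual to X: the coefficient of dy \<and> dz
    carries the weight w2 + w3, and cyclically.\<close>
  have dS: "dy S3 - dz S2 = L X1 + of_nat (w2 + w3) * X1"
    "dz S1 - dx S3 = L X2 + of_nat (w1 + w3) * X2"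
    "dx S2 - dy S1 = L X3 + of_nat (w1 + w2) * X3"
  proof -
    have *: "dx X1 = - dy X2 - dz X3" using div by (simp add: algebra_simps eq_neg_iff_add_eq_0)
    show "dy S3 - dz S2 = L X1 + of_nat (w2 + w3) * X1"
      "dz S1 - dx S3 = L X2 + of_nat (w1 + w3) * X2"
      "dx S2 - dy S1 = L X3 + of_nat (w1 + w2) * X3"
      by (simp_all add: S1_def S2_def S3_def euler_def * algebra_simps)
  qed
  have "dy Z3 - dz Z2 = X1"
    by (rule L_inj[of _ "w2 + w3"], unfold dS[symmetric] L2[symmetric] L3[symmetric])
      (use w_pos in \<open>simp_all add: euler_simps d_euler algebra_simps\<close>)
  moreover have "dz Z1 - dx Z3 = X2"
    by (rule L_inj[of _ "w1 + w3"], unfold dS[symmetric] L1[symmetric] L3[symmetric])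
      (use w_pos in \<open>simp_all add: euler_simps d_euler algebra_simps\<close>)
  moreover have "dx Z2 - dy Z1 = X3"
    by (rule L_inj[of _ "w1 + w2"], unfold dS[symmetric] L1[symmetric] L2[symmetric])
      (use w_pos in \<open>simp_all add: euler_simps d_euler algebra_simps\<close>)
  ultimately show ?thesis by blast
qed

end

section \<open>The Koszul complex of \<open>\<nabla>\<phi>\<close>\<close>

lemma var_power:
  "Xv ^ n = [:[:monom 1 n:]:]" "Yv ^ n = [:monom 1 n:]" "Zv ^ n = monom 1 n"
proof -
  show "Xv ^ n = [:[:monom 1 n:]:]"
    by (induction n) (simp_all add: Xv_def monom_Suc one_pCons flip: one_pCons)
  show "Yv ^ n = [:monom 1 n:]"
    by (induction n) (simp_all add: Yv_def monom_Suc one_pCons flip: one_pCons)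
  show "Zv ^ n = monom 1 n"
    by (induction n) (simp_all add: Zv_def monom_Suc)
qed

text \<open>Multiplication by y^M shifts the exponents of y and leaves those of x alone, so
  divisibility by x^N survives division by y^M. The witness is \<open>s\<close> with its y-exponents
  lowered by \<open>M\<close>.\<close>

lemma Y_power_regular:
  assumes "Yv ^ M * f = Xv ^ N * (s :: 'a::field_char_0 poly3)"
  shows "\<exists>t. f = Xv ^ N * t"
proof
  show "f = Xv ^ N * map_poly (poly_shift M) s"
  proof (intro poly_eqI)
    fix k j i
    have s0: "poly_shift M (0 :: 'a poly poly) = 0" by (rule poly_eqI) (simp add: coeff_poly_shift)
    have "coeff (coeff (Yv ^ M * f) k) (j + M) = coeff (coeff (Xv ^ N * s) k) (j + M)" using assms by simp
    then have "coeff (coeff f k) j = monom 1 N * coeff (coeff s k) (j + M)"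
      by (simp add: var_power coeff_monom_mult)
    then show "coeff (coeff (coeff f k) j) i = coeff (coeff (coeff (Xv ^ N * map_poly (poly_shift M) s) k) j) i"
      by (simp add: var_power coeff_map_poly coeff_poly_shift s0)
  qed
qed

text \<open>The same shift in z. Together with \<open>Y_power_regular\<close> this says that x^N,
  y^M, z^K is a regular sequence.\<close>

lemma Z_power_regular:
  assumes "Zv ^ K * f = Xv ^ N * s + Yv ^ M * (t :: 'a::field_char_0 poly3)"
  shows "\<exists>s t. f = Xv ^ N * s + Yv ^ M * t"
proof (intro exI)
  show "f = Xv ^ N * poly_shift K s + Yv ^ M * poly_shift K t"
  proof (intro poly_eqI)
    fix k j i
    have "coeff (Zv ^ K * f) (k + K) = coeff (Xv ^ N * s + Yv ^ M * t) (k + K)" using assms by simp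
    then have "coeff f k = [:monom 1 N:] * coeff s (k + K) + monom 1 M * coeff t (k + K)"
      by (simp add: var_power coeff_monom_mult)
    then show "coeff (coeff (coeff f k) j) i =
        coeff (coeff (coeff (Xv ^ N * poly_shift K s + Yv ^ M * poly_shift K t) k) j) i"
      by (simp add: var_power coeff_poly_shift)
  qed
qed

lemma Xv_nonzero [simp]: "Xv \<noteq> 0" by (simp add: Xv_def)

text \<open>Depth sensitivity of the Koszul complex: its homology is annihilated by the ideal, which here
  contains a regular sequence of length three.\<close>

locale koszul =
  fixes p1 p2 p3 :: "'a::field_char_0 poly3"
  assumes X_power: "\<exists>N a b c. Xv ^ N = a * p1 + b * p2 + c * p3"
    and Y_power: "\<exists>N a b c. Yv ^ N = a * p1 + b * p2 + c * p3"
    and Z_power: "\<exists>N a b c. Zv ^ N = a * p1 + b * p2 + c * p3"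
begin

text \<open>Choose v with v . p = x^N. Then Y = X \<times> v satisfies p \<times> Y = x^N X because
  X . p = 0. Subtracting a multiple t p from Y does not affect p \<times> Y, so it suffices to find
  t such that Y - t p is divisible by x^N; the powers of y and z in the ideal supply it.\<close>

lemma orthogonal_imp_cross:
  assumes X: "X1 * p1 + X2 * p2 + X3 * p3 = 0"
  shows "\<exists>Z1 Z2 Z3. X1 = p2 * Z3 - p3 * Z2 \<and> X2 = p3 * Z1 - p1 * Z3 \<and> X3 = p1 * Z2 - p2 * Z1"
proof -
  obtain N v1 v2 v3 where v: "Xv ^ N = v1 * p1 + v2 * p2 + v3 * p3" using X_power by blast
  obtain M q1 q2 q3 where q: "Yv ^ M = q1 * p1 + q2 * p2 + q3 * p3" using Y_power by blast
  obtain K r1 r2 r3 where r: "Zv ^ K = r1 * p1 + r2 * p2 + r3 * p3" using Z_power by blast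
  define Y1 Y2 Y3 where Y: "Y1 = X2 * v3 - X3 * v2" "Y2 = X3 * v1 - X1 * v3" "Y3 = X1 * v2 - X2 * v1"
  define g where "g = q1 * Y1 + q2 * Y2 + q3 * Y3"
  have XY: "p2 * Y3 - p3 * Y2 = Xv ^ N * X1" "p3 * Y1 - p1 * Y3 = Xv ^ N * X2" "p1 * Y2 - p2 * Y1 = Xv ^ N * X3"
    using X unfolding Y v by algebra+
  \<comment> \<open>With q . p = y^M, the expansion q \<times> (p \<times> Y) = (q . Y) p - y^M Y is
    compared with its value x^N (q \<times> X).\<close>
  have YM: "Yv ^ M * Y1 = g * p1 - Xv ^ N * (q2 * X3 - q3 * X2)"
    "Yv ^ M * Y2 = g * p2 - Xv ^ N * (q3 * X1 - q1 * X3)"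
    "Yv ^ M * Y3 = g * p3 - Xv ^ N * (q1 * X2 - q2 * X1)"
  proof -
    have *: "a * (b * c - f * h) = b * (a * c) - f * (a * h)" for a b c f h :: "'a poly3"
      by (simp add: algebra_simps)
    show "Yv ^ M * Y1 = g * p1 - Xv ^ N * (q2 * X3 - q3 * X2)"
      "Yv ^ M * Y2 = g * p2 - Xv ^ N * (q3 * X1 - q1 * X3)"
      "Yv ^ M * Y3 = g * p3 - Xv ^ N * (q1 * X2 - q2 * X1)"
      unfolding * XY[symmetric] g_def q by (simp_all add: algebra_simps)
  qed
  have gp: "g * p1 = Xv ^ N * (q2 * X3 - q3 * X2) + Yv ^ M * Y1"
    "g * p2 = Xv ^ N * (q3 * X1 - q1 * X3) + Yv ^ M * Y2"
    "g * p3 = Xv ^ N * (q1 * X2 - q2 * X1) + Yv ^ M * Y3"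
    by (simp_all add: YM)
  \<comment> \<open>Every component of g p lies in (x^N, y^M), hence so does z^K g, and z^K can be
    divided out.\<close>
  have "Zv ^ K * g = r1 * (g * p1) + r2 * (g * p2) + r3 * (g * p3)"
    unfolding r by (simp add: algebra_simps)
  also have "\<dots> = Xv ^ N * (r1 * (q2 * X3 - q3 * X2) + r2 * (q3 * X1 - q1 * X3) + r3 * (q1 * X2 - q2 * X1)) +
      Yv ^ M * (r1 * Y1 + r2 * Y2 + r3 * Y3)"
    unfolding gp by (simp add: algebra_simps)
  finally obtain s t where g: "g = Xv ^ N * s + Yv ^ M * t" using Z_power_regular by blast
  have "Yv ^ M * (Y1 - t * p1) = Xv ^ N * (s * p1 - (q2 * X3 - q3 * X2))"
    "Yv ^ M * (Y2 - t * p2) = Xv ^ N * (s * p2 - (q3 * X1 - q1 * X3))"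
    "Yv ^ M * (Y3 - t * p3) = Xv ^ N * (s * p3 - (q1 * X2 - q2 * X1))"
    unfolding right_diff_distrib YM by (simp_all add: g algebra_simps)
  then obtain Z1 Z2 Z3 where Z: "Y1 - t * p1 = Xv ^ N * Z1" "Y2 - t * p2 = Xv ^ N * Z2" "Y3 - t * p3 = Xv ^ N * Z3"
    using Y_power_regular by metis
  have "Xv ^ N * X1 = Xv ^ N * (p2 * Z3 - p3 * Z2)" "Xv ^ N * X2 = Xv ^ N * (p3 * Z1 - p1 * Z3)"
    "Xv ^ N * X3 = Xv ^ N * (p1 * Z2 - p2 * Z1)"
  proof -
    have *: "Y1 = t * p1 + Xv ^ N * Z1" "Y2 = t * p2 + Xv ^ N * Z2" "Y3 = t * p3 + Xv ^ N * Z3"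
      using Z by (simp_all add: algebra_simps)
    show "Xv ^ N * X1 = Xv ^ N * (p2 * Z3 - p3 * Z2)" "Xv ^ N * X2 = Xv ^ N * (p3 * Z1 - p1 * Z3)"
      "Xv ^ N * X3 = Xv ^ N * (p1 * Z2 - p2 * Z1)"
      unfolding XY[symmetric] * by (simp_all add: algebra_simps)
  qed
  then show ?thesis by (simp only: mult_cancel_left power_eq_0_iff Xv_nonzero) auto
qed

text \<open>For g = v . X one has x^N X = g p, and y^M g = x^N (q . X) forces x^N to divide
  g.\<close>

lemma parallel_imp_multiple:
  assumes "X2 * p3 = X3 * p2" "X3 * p1 = X1 * p3" "X1 * p2 = X2 * p1"
  shows "\<exists>f. X1 = f * p1 \<and> X2 = f * p2 \<and> X3 = f * p3"
proof -
  obtain N v1 v2 v3 where v: "Xv ^ N = v1 * p1 + v2 * p2 + v3 * p3" using X_power by blast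
  obtain M q1 q2 q3 where q: "Yv ^ M = q1 * p1 + q2 * p2 + q3 * p3" using Y_power by blast
  define g where "g = v1 * X1 + v2 * X2 + v3 * X3"
  have X: "Xv ^ N * X1 = g * p1" "Xv ^ N * X2 = g * p2" "Xv ^ N * X3 = g * p3"
    using assms unfolding g_def v by algebra+
  have "Xv ^ N * (q1 * X1 + q2 * X2 + q3 * X3) =
      q1 * (Xv ^ N * X1) + q2 * (Xv ^ N * X2) + q3 * (Xv ^ N * X3)"
    by (simp add: algebra_simps)
  then have "Yv ^ M * g = Xv ^ N * (q1 * X1 + q2 * X2 + q3 * X3)"
    unfolding X q by (simp add: algebra_simps)
  then obtain f where g: "g = Xv ^ N * f" using Y_power_regular by blast
  have "Xv ^ N * X1 = Xv ^ N * (f * p1)" "Xv ^ N * X2 = Xv ^ N * (f * p2)" "Xv ^ N * X3 = Xv ^ N * (f * p3)"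
    using X unfolding g by (simp_all add: algebra_simps)
  then show ?thesis by (simp only: mult_cancel_left power_eq_0_iff Xv_nonzero) auto
qed

lemma gradient_nonzero:
  assumes "f * p1 = 0" "f * p2 = 0" "f * p3 = 0"
  shows "f = 0"
proof -
  obtain N v1 v2 v3 where v: "Xv ^ N = v1 * p1 + v2 * p2 + v3 * p3" using X_power by blast
  have "Xv ^ N * f = v1 * (f * p1) + v2 * (f * p2) + v3 * (f * p3)"
    unfolding v by (simp add: algebra_simps)
  then show ?thesis by (simp add: assms)
qed

end

section \<open>Poisson cohomology of \<open>\<nabla>\<phi>\<close>\<close>

locale singularity = weights w1 w2 w3 T
  for w1 w2 w3 :: nat and T :: "'a::field_char_0 itself" +
  fixes \<phi> :: "'a poly3" and d \<mu> :: nat and u :: "nat \<Rightarrow> 'a poly3" and e :: "nat \<Rightarrow> nat"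
  assumes phi_H: "\<phi> \<in> weights.H w1 w2 w3 (int d)"
    and u_H: "i < \<mu> \<Longrightarrow> u i \<in> weights.H w1 w2 w3 (int (e i))"
    and mu_pos: "\<mu> > 0" and u_0: "u 0 = 1"
    and basis: "sing_basis \<phi> \<mu> u"
begin

abbreviation p1 where "p1 \<equiv> dx \<phi>"
abbreviation p2 where "p2 \<equiv> dy \<phi>"
abbreviation p3 where "p3 \<equiv> dz \<phi>"

lemma p_H: "p1 \<in> H (int d - int w1)" "p2 \<in> H (int d - int w2)" "p3 \<in> H (int d - int w3)"
  using H_d[OF phi_H] by simp_all

lemma euler_phi:
  "of_nat w1 * Xv * p1 + of_nat w2 * Yv * p2 + of_nat w3 * Zv * p3 = of_nat d * \<phi>"
  using phi_H by (simp add: H_def euler_def)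

lemma spanning: "\<exists>a X1 X2 X3. f = (\<Sum>i<\<mu>. cst (a i) * u i) + (X1 * p1 + X2 * p2 + X3 * p3)"
proof -
  obtain a where "f - (\<Sum>i<\<mu>. cst (a i) * u i) \<in> jacobian_ideal \<phi>"
    using basis unfolding sing_basis_def sing_spanning_def by blast
  then show ?thesis unfolding jacobian_ideal_def by (auto simp: algebra_simps)
qed

lemma independent:
  assumes "(\<Sum>i<\<mu>. cst (a i) * u i) = X1 * p1 + X2 * p2 + X3 * p3" "i < \<mu>"
  shows "a i = 0"
  using basis assms unfolding sing_basis_def sing_independent_def jacobian_ideal_def by blast

text \<open>In the component of degree \<open>m\<close> of a spanning decomposition no basis element
  survives.\<close>

lemma high_degree_in_ideal:
  assumes f: "f \<in> H m" and m: "\<And>i. i < \<mu> \<Longrightarrow> int (e i) < m"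
  shows "\<exists>X1 X2 X3. f = X1 * p1 + X2 * p2 + X3 * p3"
proof -
  obtain a X1 X2 X3 where "f = (\<Sum>i<\<mu>. cst (a i) * u i) + (X1 * p1 + X2 * p2 + X3 * p3)"
    using spanning by blast
  then have "hc m f = hc m ((\<Sum>i<\<mu>. cst (a i) * u i) + (p1 * X1 + p2 * X2 + p3 * X3))"
    by (simp add: mult.commute)
  moreover have "hc m (u i) = 0" if "i < \<mu>" for i using hc_H[OF u_H[OF that], of m] m[OF that] by simp
  ultimately have "f = p1 * hc (m - (int d - int w1)) X1 + p2 * hc (m - (int d - int w2)) X2
      + p3 * hc (m - (int d - int w3)) X3"
    by (simp add: hc_add hc_sum hc_cst_mult p_H[THEN hc_mult_H] hc_H[OF f])
  then show ?thesis by (metis mult.commute)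
qed

text \<open>A power v^N of a variable has degree at least \<open>N\<close>, beyond the degrees of
  all basis elements, and therefore lies in the Jacobian ideal.\<close>

sublocale koszul p1 p2 p3
proof -
  define N where "N = Suc (Max (e ` {..<\<mu>}))"
  have e: "e i < N" if "i < \<mu>" for i
    using that unfolding N_def by (simp add: less_Suc_eq_le)
  have *: "\<exists>N a b c. v ^ N = a * p1 + b * p2 + c * p3" if v: "v \<in> H (int w)" and w: "w > 0" for v w
  proof -
    have "v ^ n \<in> H (int (n * w))" for n
    proof (induction n)
      case 0
      then show ?case by (simp add: H_def euler_def)
    next
      case (Suc n)
      show ?case using H_mult[OF v Suc] by (simp add: algebra_simps)
    qed
    moreover have "int (e i) < int (N * w)" if "i < \<mu>" for i
    proof -
      have "e i < N * 1" using e that by simp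
      also have "\<dots> \<le> N * w" using w by (intro mult_left_mono) auto
      finally show ?thesis by (simp only: of_nat_less_iff)
    qed
    ultimately show ?thesis using high_degree_in_ideal by blast
  qed
  show "koszul p1 p2 p3"
    by unfold_locales (rule *[of _ w1] *[of _ w2] *[of _ w3]; use w_pos in \<open>simp add: H_def euler_def\<close>)+
qed

text \<open>For d = 0 the partial derivatives would have negative degree and vanish, but the
  Jacobian ideal contains a power of x. Later arguments cancel the factor \<open>d\<close> of
  Euler's formula.\<close>

lemma d_pos: "d > 0"
proof (rule ccontr)
  assume "\<not> d > 0"
  then have "p1 = 0" "p2 = 0" "p3 = 0" using p_H[THEN H_neg] w_pos by auto
  then show False using gradient_nonzero[of 1] by simp
qed

text \<open>This is \<nabla>\<phi> . curl Z. Its vanishing is the cocycle condition in degree two,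
  and up to sign its values are the divergences of the fields \<nabla>\<phi> \<times> Z
  (\<open>div_cross\<close>).\<close>

definition pcurl :: "'a poly3 \<Rightarrow> 'a poly3 \<Rightarrow> 'a poly3 \<Rightarrow> 'a poly3" where
  "pcurl Z1 Z2 Z3 = p1 * (dy Z3 - dz Z2) + p2 * (dz Z1 - dx Z3) + p3 * (dx Z2 - dy Z1)"

lemma div_cross:
  "dx (p2 * Z3 - p3 * Z2) + dy (p3 * Z1 - p1 * Z3) + dz (p1 * Z2 - p2 * Z1) = - pcurl Z1 Z2 Z3"
  by (simp add: pcurl_def d_commute algebra_simps)

section \<open>Degree three: the classes \<phi>^l u_i modulo the image of
  \<open>pcurl\<close>\<close>

definition comb :: "nat \<Rightarrow> (nat \<Rightarrow> nat \<Rightarrow> 'a) \<Rightarrow> 'a poly3" where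
  "comb n c = (\<Sum>l<n. \<Sum>i<\<mu>. cst (c l i) * \<phi> ^ l * u i)"

lemma comb_Suc:
  "comb (Suc n) c = (\<Sum>i<\<mu>. cst (c 0 i) * u i) + \<phi> * comb n (\<lambda>l. c (Suc l))"
  unfolding comb_def sum.lessThan_Suc_shift by (simp add: sum_distrib_left algebra_simps)

lemma comb_cst_mult: "cst a * comb n c = comb n (\<lambda>l i. a * c l i)"
  by (simp add: comb_def sum_distrib_left cst_simps algebra_simps)

lemma euler_phi_power: "L (\<phi> ^ l) = of_nat (l * d) * \<phi> ^ l"
proof (induction l)
  case 0
  then show ?case by (simp add: euler_def)
next
  case (Suc l)
  then show ?case using phi_H by (simp add: H_def euler_simps algebra_simps)
qed

lemma euler_comb: "L (comb n c) = comb n (\<lambda>l i. of_nat (l * d + e i) * c l i)"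
proof -
  have u: "L (u i) = of_nat (e i) * u i" if "i < \<mu>" for i
    using u_H[OF that] by (simp add: H_def)
  show ?thesis
    unfolding comb_def euler_sum
    by (intro sum.cong refl) (simp add: euler_simps euler_phi_power u cst_simps algebra_simps)
qed

text \<open>Write f as a combination of the u_i plus Y . \<nabla>\<phi>. A multiple h \<epsilon> of
  the Euler field takes up the divergence of Y, and the rest of Y is a curl, so Y . \<nabla>\<phi> =
  d \<phi> h + \<open>pcurl Z1 Z2 Z3\<close>. The degree of h is lower by \<open>d\<close>, so
  induction applies to it, and multiplication by \<phi> preserves the image of
  \<open>pcurl\<close>.\<close>

lemma comb_spanning: "\<exists>n c Z1 Z2 Z3. f = comb n c + pcurl Z1 Z2 Z3"
proof -
  have "\<exists>n c Z1 Z2 Z3. f = comb n c + pcurl Z1 Z2 Z3" if "tr (int k) f = f" for f k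
    using that
  proof (induction k arbitrary: f rule: less_induct)
    case (less k f)
    obtain a X1 X2 X3 where f: "f = (\<Sum>i<\<mu>. cst (a i) * u i) + (p1 * X1 + p2 * X2 + p3 * X3)"
      using spanning[of f] by (auto simp: mult.commute)
    \<comment> \<open>Everything beyond degree \<open>k\<close> is cut off; this does not change
      \<open>f\<close>.\<close>
    define b where "b i = (if e i \<le> k then a i else 0)" for i
    define Y1 Y2 Y3 where "Y1 = tr (int k - (int d - int w1)) X1" "Y2 = tr (int k - (int d - int w2)) X2"
      "Y3 = tr (int k - (int d - int w3)) X3"
    have "cst (a i) * tr (int k) (u i) = cst (b i) * u i" if "i < \<mu>" for i
      using tr_H[OF u_H[OF that], of "int k"] by (simp add: b_def)
    then have f': "f = (\<Sum>i<\<mu>. cst (b i) * u i) + (p1 * Y1 + p2 * Y2 + p3 * Y3)"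
      using less.prems unfolding f
      by (simp add: tr_add tr_sum tr_cst_mult p_H[THEN tr_mult_H] Y1_Y2_Y3_def)
    define g where "g = dx Y1 + dy Y2 + dz Y3"
    \<comment> \<open>Solves div (h \<epsilon>) = div Y, as the divergence of h \<epsilon> is
      \<open>L h + of_nat (w1 + w2 + w3) * h\<close>.\<close>
    define h where "h = R (w1 + w2 + w3) g"
    have "tr (int k - int d) g = g"
      by (simp add: g_def Y1_Y2_Y3_def d_tr tr_add tr_tr algebra_simps)
    then have h: "tr (int k - int d) h = h" unfolding h_def by (rule tr_R)
    have Lh: "L h + of_nat (w1 + w2 + w3) * h = g" unfolding h_def by (rule L_R) (use w_pos in simp)
    have "dx (Y1 - of_nat w1 * Xv * h) + dy (Y2 - of_nat w2 * Yv * h) + dz (Y3 - of_nat w3 * Zv * h) = 0"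
      using Lh unfolding g_def by (simp add: euler_def algebra_simps)
    then obtain Z1 Z2 Z3 where z: "dy Z3 - dz Z2 = Y1 - of_nat w1 * Xv * h"
      "dz Z1 - dx Z3 = Y2 - of_nat w2 * Yv * h" "dx Z2 - dy Z1 = Y3 - of_nat w3 * Zv * h"
      using poincare_curl by blast
    then have Z: "Y1 = of_nat w1 * Xv * h + (dy Z3 - dz Z2)"
      "Y2 = of_nat w2 * Yv * h + (dz Z1 - dx Z3)" "Y3 = of_nat w3 * Zv * h + (dx Z2 - dy Z1)"
      unfolding z by simp_all
    have pY: "p1 * Y1 + p2 * Y2 + p3 * Y3 = of_nat d * \<phi> * h + pcurl Z1 Z2 Z3"
      unfolding Z euler_phi[symmetric] by (simp add: pcurl_def algebra_simps)
    have "\<exists>n c Z1 Z2 Z3. h = comb n c + pcurl Z1 Z2 Z3"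
    proof (cases "d \<le> k")
      case True
      then show ?thesis using h less.IH[of "k - d" h] d_pos by (simp add: of_nat_diff)
    next
      case False
      then have "tr (int k - int d) h = 0" by simp
      then have "h = 0" using h by simp
      then have "h = comb 0 (\<lambda>_ _. 0) + pcurl 0 0 0" by (simp add: comb_def pcurl_def)
      then show ?thesis by blast
    qed
    then obtain n c V1 V2 V3 where V: "h = comb n c + pcurl V1 V2 V3" by blast
    \<comment> \<open>The coefficients of \<open>h\<close> move up by one power of \<phi> and
      acquire the factor of d \<phi> h.\<close>
    define c' where "c' = (\<lambda>l i. case l of 0 \<Rightarrow> b i | Suc l \<Rightarrow> of_nat d * c l i)"
    have "of_nat d * \<phi> * pcurl V1 V2 V3 =
        pcurl (of_nat d * \<phi> * V1) (of_nat d * \<phi> * V2) (of_nat d * \<phi> * V3)"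
      by (simp add: pcurl_def algebra_simps)
    moreover have "comb (Suc n) c' = (\<Sum>i<\<mu>. cst (b i) * u i) + of_nat d * \<phi> * comb n c"
      using comb_cst_mult[of "of_nat d" n c] by (simp add: comb_Suc c'_def algebra_simps)
    ultimately have "f = comb (Suc n) c' + pcurl (Z1 + of_nat d * \<phi> * V1) (Z2 + of_nat d * \<phi> * V2)
        (Z3 + of_nat d * \<phi> * V3)"
      unfolding f' pY V by (simp add: pcurl_def algebra_simps)
    then show ?case by blast
  qed
  moreover obtain n where "tr n f = f" using tr_exhaust by blast
  then have "tr (int (nat n)) f = f" by (rule tr_mono) simp
  ultimately show ?thesis by blast
qed

text \<open>Modulo the Jacobian ideal, which contains d \<phi> = \<epsilon> . \<nabla>\<phi>, only
  the terms with l = 0 remain, and these vanish by independence of the u_i. With \<phi> S denoting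
  the other terms, d curl Z - S \<epsilon> is then orthogonal to \<nabla>\<phi>, hence equal to some
  \<nabla>\<phi> \<times> W, and its divergence yields a relation of the same kind for S.\<close>

lemma comb_independent:
  assumes "comb n c = pcurl Z1 Z2 Z3" "l < n" "i < \<mu>"
  shows "c l i = 0"
  using assms
proof (induction n arbitrary: c Z1 Z2 Z3 l)
  case (Suc n)
  define S where "S = comb n (\<lambda>l. c (Suc l))"
  let ?C1 = "dy Z3 - dz Z2" and ?C2 = "dz Z1 - dx Z3" and ?C3 = "dx Z2 - dy Z1"
  have *: "(\<Sum>i<\<mu>. cst (c 0 i) * u i) + \<phi> * S = ?C1 * p1 + ?C2 * p2 + ?C3 * p3"
    using Suc.prems(1) unfolding comb_Suc S_def pcurl_def by (simp add: mult.commute)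
  have "of_nat d * ((\<Sum>i<\<mu>. cst (c 0 i) * u i) + \<phi> * S) = (\<Sum>i<\<mu>. cst (of_nat d * c 0 i) * u i) + of_nat d * \<phi> * S"
    by (simp add: sum_distrib_left cst_simps algebra_simps)
  then have **: "(\<Sum>i<\<mu>. cst (of_nat d * c 0 i) * u i) =
      (of_nat d * ?C1 - of_nat w1 * Xv * S) * p1 + (of_nat d * ?C2 - of_nat w2 * Yv * S) * p2
      + (of_nat d * ?C3 - of_nat w3 * Zv * S) * p3"
    unfolding * euler_phi[symmetric] by (simp add: algebra_simps)
  have c0: "c 0 i = 0" if "i < \<mu>" for i
    using independent[OF ** that] d_pos by simp
  then have "(of_nat d * ?C1 - of_nat w1 * Xv * S) * p1 + (of_nat d * ?C2 - of_nat w2 * Yv * S) * p2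
      + (of_nat d * ?C3 - of_nat w3 * Zv * S) * p3 = 0"
    using ** by simp
  then obtain W1 W2 W3 where W: "of_nat d * ?C1 - of_nat w1 * Xv * S = p2 * W3 - p3 * W2"
    "of_nat d * ?C2 - of_nat w2 * Yv * S = p3 * W1 - p1 * W3"
    "of_nat d * ?C3 - of_nat w3 * Zv * S = p1 * W2 - p2 * W1"
    using orthogonal_imp_cross by blast
  \<comment> \<open>A curl has no divergence, so only S \<epsilon> contributes.\<close>
  have "L S + of_nat (w1 + w2 + w3) * S = - (dx (of_nat d * ?C1 - of_nat w1 * Xv * S)
      + dy (of_nat d * ?C2 - of_nat w2 * Yv * S) + dz (of_nat d * ?C3 - of_nat w3 * Zv * S))"
    by (simp add: euler_def d_commute algebra_simps)
  also have "\<dots> = pcurl W1 W2 W3" unfolding W div_cross by simp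
  finally have "L S + cst (of_nat (w1 + w2 + w3)) * S = pcurl W1 W2 W3" by (simp only: cst_of_nat)
  moreover have "L S + cst (of_nat (w1 + w2 + w3)) * S =
      comb n (\<lambda>l i. of_nat (l * d + e i + w1 + w2 + w3) * c (Suc l) i)"
    unfolding S_def euler_comb comb_cst_mult
    by (simp add: comb_def cst_simps sum.distrib[symmetric] algebra_simps)
  ultimately have "comb n (\<lambda>l i. of_nat (l * d + e i + w1 + w2 + w3) * c (Suc l) i) = pcurl W1 W2 W3"
    by simp
  \<comment> \<open>\<open>L\<close> + (w1 + w2 + w3) multiplies \<phi>^l u_i by a positive integer,
    so a vanishing coefficient of the image gives one of \<open>S\<close>.\<close>
  from Suc.IH[OF this _ Suc.prems(3)] have "c (Suc k) i = 0" if "k < n" for k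
    using that w_pos by (auto simp del: of_nat_add of_nat_mult)
  then show ?case using c0 Suc.prems by (cases l) auto
qed simp

text \<open>Exactness gives curl Y = \<nabla>\<phi> \<times> Z, and div curl Y = 0 makes Z a cocycle
  of degree lower by \<open>d\<close>. By induction Z = \<nabla>a + b \<nabla>\<phi>, so curl Y =
  \<nabla>\<phi> \<times> \<nabla>a = - curl (a \<nabla>\<phi>), and Y + a \<nabla>\<phi> is a
  gradient.\<close>

lemma cocycle_form:
  assumes "pcurl Y1 Y2 Y3 = 0"
  shows "\<exists>a b. Y1 = dx a + b * p1 \<and> Y2 = dy a + b * p2 \<and> Y3 = dz a + b * p3"
proof -
  \<comment> \<open>The bound on each component is shifted by its weight, as for the gradient of a
    polynomial of degree at most \<open>k\<close>.\<close>
  have claim: "\<exists>a b. Y1 = dx a + b * p1 \<and> Y2 = dy a + b * p2 \<and> Y3 = dz a + b * p3"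
    if "pcurl Y1 Y2 Y3 = 0" "tr (int k - int w1) Y1 = Y1" "tr (int k - int w2) Y2 = Y2"
      "tr (int k - int w3) Y3 = Y3" for Y1 Y2 Y3 k
    using that
  proof (induction k arbitrary: Y1 Y2 Y3 rule: less_induct)
    case (less k Y1 Y2 Y3)
    have "(dy Y3 - dz Y2) * p1 + (dz Y1 - dx Y3) * p2 + (dx Y2 - dy Y1) * p3 = 0"
      using less.prems(1) by (simp add: pcurl_def mult.commute)
    then obtain V1 V2 V3 where V: "dy Y3 - dz Y2 = p2 * V3 - p3 * V2" "dz Y1 - dx Y3 = p3 * V1 - p1 * V3"
      "dx Y2 - dy Y1 = p1 * V2 - p2 * V1"
      using orthogonal_imp_cross by blast
    \<comment> \<open>Exactness does not control degrees. Truncation repairs this, because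
      \<nabla>\<phi> is homogeneous and curl Y is bounded.\<close>
    define Z1 Z2 Z3 where Z: "Z1 = tr (int k - int d - int w1) V1" "Z2 = tr (int k - int d - int w2) V2"
      "Z3 = tr (int k - int d - int w3) V3"
    have t: "dy Y3 - dz Y2 = tr (int k - int w2 - int w3) (p2 * V3 - p3 * V2)"
      "dz Y1 - dx Y3 = tr (int k - int w1 - int w3) (p3 * V1 - p1 * V3)"
      "dx Y2 - dy Y1 = tr (int k - int w1 - int w2) (p1 * V2 - p2 * V1)"
    proof -
      have "dx (tr (int k - int w2) Y2) = dx Y2" "dx (tr (int k - int w3) Y3) = dx Y3"
        "dy (tr (int k - int w1) Y1) = dy Y1" "dy (tr (int k - int w3) Y3) = dy Y3"
        "dz (tr (int k - int w1) Y1) = dz Y1" "dz (tr (int k - int w2) Y2) = dz Y2"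
        using less.prems by simp_all
      then show "dy Y3 - dz Y2 = tr (int k - int w2 - int w3) (p2 * V3 - p3 * V2)"
        "dz Y1 - dx Y3 = tr (int k - int w1 - int w3) (p3 * V1 - p1 * V3)"
        "dx Y2 - dy Y1 = tr (int k - int w1 - int w2) (p1 * V2 - p2 * V1)"
        unfolding d_tr V[symmetric] tr_diff by (simp_all add: algebra_simps)
    qed
    have C: "dy Y3 - dz Y2 = p2 * Z3 - p3 * Z2" "dz Y1 - dx Y3 = p3 * Z1 - p1 * Z3"
      "dx Y2 - dy Y1 = p1 * Z2 - p2 * Z1"
      unfolding t tr_diff p_H[THEN tr_mult_H] Z by (simp_all add: algebra_simps)
    have "pcurl Z1 Z2 Z3 = - (dx (dy Y3 - dz Y2) + dy (dz Y1 - dx Y3) + dz (dx Y2 - dy Y1))"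
      unfolding C div_cross by simp
    then have Z0: "pcurl Z1 Z2 Z3 = 0" by (simp add: d_commute)
    have "\<exists>a b. Z1 = dx a + b * p1 \<and> Z2 = dy a + b * p2 \<and> Z3 = dz a + b * p3"
    proof (cases "d \<le> k")
      case True
      show ?thesis
        using True d_pos by (intro less.IH[of "k - d"] Z0) (simp_all add: Z tr_tr of_nat_diff)
    next
      case False
      then have "Z1 = 0" "Z2 = 0" "Z3 = 0" by (simp_all add: Z)
      then show ?thesis by (intro exI[of _ 0]) simp
    qed
    then obtain a b where Zab: "Z1 = dx a + b * p1" "Z2 = dy a + b * p2" "Z3 = dz a + b * p3" by blast
    have "\<exists>f. dx f = Y1 + a * p1 \<and> dy f = Y2 + a * p2 \<and> dz f = Y3 + a * p3"
      by (rule poincare_gradient)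
        (use C in \<open>simp_all add: Zab d_commute algebra_simps diff_eq_eq eq_diff_eq\<close>)
    then obtain f where "dx f = Y1 + a * p1" "dy f = Y2 + a * p2" "dz f = Y3 + a * p3" by blast
    then have "Y1 = dx f + (- a) * p1 \<and> Y2 = dy f + (- a) * p2 \<and> Y3 = dz f + (- a) * p3" by simp
    then show ?case by blast
  qed
  obtain n1 n2 n3 where n: "tr n1 Y1 = Y1" "tr n2 Y2 = Y2" "tr n3 Y3 = Y3"
    using tr_exhaust[of Y1] tr_exhaust[of Y2] tr_exhaust[of Y3] by blast
  define k where "k = nat (max (n1 + int w1) (max (n2 + int w2) (n3 + int w3)))"
  have "n1 \<le> int k - int w1" "n2 \<le> int k - int w2" "n3 \<le> int k - int w3"
    unfolding k_def by linarith+
  then have "tr (int k - int w1) Y1 = Y1" "tr (int k - int w2) Y2 = Y2" "tr (int k - int w3) Y3 = Y3"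
    using n by (simp_all add: tr_mono)
  then show ?thesis by (rule claim[OF assms])
qed

end

section \<open>Casimirs, coboundaries, and the classes of degrees one and two\<close>

context singularity
begin

lemma d_phi_poly:
  "dx (\<Sum>l<n. cst (a l) * \<phi> ^ Suc l) = (\<Sum>l<n. cst (of_nat (Suc l) * a l) * \<phi> ^ l) * p1"
  "dy (\<Sum>l<n. cst (a l) * \<phi> ^ Suc l) = (\<Sum>l<n. cst (of_nat (Suc l) * a l) * \<phi> ^ l) * p2"
  "dz (\<Sum>l<n. cst (a l) * \<phi> ^ Suc l) = (\<Sum>l<n. cst (of_nat (Suc l) * a l) * \<phi> ^ l) * p3"
  unfolding d_sum sum_distrib_right
  by (intro sum.cong refl, simp only: d_mult d_cst d_power diff_Suc_1 cst_simps cst_of_nat,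
      simp add: algebra_simps)+

text \<open>The curl of \<nabla>a = g \<nabla>\<phi> shows that \<nabla>g is again a multiple of
  \<nabla>\<phi>. The truncated g has degree lower by \<open>d\<close>, so it is a polynomial in
  \<phi> by induction, and a is its integral with respect to \<phi> up to a constant.\<close>

lemma casimir:
  assumes "dx a = g * p1" "dy a = g * p2" "dz a = g * p3"
  shows "\<exists>n \<alpha>. a = (\<Sum>l<Suc n. cst (\<alpha> l) * \<phi> ^ l)"
proof -
  have claim: "\<exists>n \<alpha>. a = (\<Sum>l<Suc n. cst (\<alpha> l) * \<phi> ^ l)"
    if "dx a = g * p1" "dy a = g * p2" "dz a = g * p3" "tr (int k) a = a" for a g k
    using that
  proof (induction k arbitrary: a g rule: less_induct)
    case (less k a g)
    define h where "h = tr (int k - int d) g"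
    have h: "dx a = h * p1" "dy a = h * p2" "dz a = h * p3"
    proof -
      have *: "dx a = tr (int k - int w1) (p1 * g)" "dy a = tr (int k - int w2) (p2 * g)"
        "dz a = tr (int k - int w3) (p3 * g)"
        using less.prems by (metis d_tr(1) mult.commute, metis d_tr(2) mult.commute, metis d_tr(3) mult.commute)
      show "dx a = h * p1" "dy a = h * p2" "dz a = h * p3"
        unfolding * h_def p_H[THEN tr_mult_H] by (simp_all add: algebra_simps)
    qed
    have "\<exists>n \<alpha>. h = (\<Sum>l<n. cst (\<alpha> l) * \<phi> ^ l)"
    proof (cases "d \<le> k")
      case True
      have "dy (dx a) = dx (dy a)" "dz (dx a) = dx (dz a)" "dz (dy a) = dy (dz a)"
        by (simp_all only: d_commute)
      then have "\<exists>f. dx h = f * p1 \<and> dy h = f * p2 \<and> dz h = f * p3"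
        unfolding h by (intro parallel_imp_multiple) (simp_all add: d_commute algebra_simps)
      then obtain f where "dx h = f * p1" "dy h = f * p2" "dz h = f * p3" by blast
      moreover have "tr (int (k - d)) h = h" using True by (simp add: h_def tr_tr of_nat_diff)
      ultimately have "\<exists>n \<alpha>. h = (\<Sum>l<Suc n. cst (\<alpha> l) * \<phi> ^ l)"
        using less.IH[of "k - d" h f] True d_pos by simp
      then show ?thesis by blast
    next
      case False
      then show ?thesis by (intro exI[of _ "0::nat"]) (simp add: h_def)
    qed
    then obtain n \<alpha> where \<alpha>: "h = (\<Sum>l<n. cst (\<alpha> l) * \<phi> ^ l)" by blast
    \<comment> \<open>Termwise integration in \<phi>, possible in characteristic zero.\<close>
    define \<beta> where "\<beta> l = \<alpha> l / of_nat (Suc l)" for l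
    have "of_nat (Suc l) * \<beta> l = \<alpha> l" for l by (simp add: \<beta>_def del: of_nat_Suc)
    then have "dx (a - (\<Sum>l<n. cst (\<beta> l) * \<phi> ^ Suc l)) = 0"
      "dy (a - (\<Sum>l<n. cst (\<beta> l) * \<phi> ^ Suc l)) = 0"
      "dz (a - (\<Sum>l<n. cst (\<beta> l) * \<phi> ^ Suc l)) = 0"
      by (simp_all only: d_diff d_phi_poly h \<alpha>) simp_all
    then obtain c where "a - (\<Sum>l<n. cst (\<beta> l) * \<phi> ^ Suc l) = cst c"
      using gradient_zero_imp_const by blast
    then have "a = (\<Sum>l<Suc n. cst (case l of 0 \<Rightarrow> c | Suc l \<Rightarrow> \<beta> l) * \<phi> ^ l)"
      unfolding sum.lessThan_Suc_shift by (simp add: algebra_simps)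
    then show ?case by blast
  qed
  obtain n where "tr n a = a" using tr_exhaust by blast
  then have "tr (int (nat n)) a = a" by (rule tr_mono) simp
  then show ?thesis using claim assms by blast
qed

text \<open>The Lie derivative of the bracket along X. Contraction with the volume form turns the
  bivector into d\<phi>; the two terms come from the Lie derivatives of d\<phi> and of the volume
  form.\<close>

definition cob_x where "cob_x X1 X2 X3 = dx (X1 * p1 + X2 * p2 + X3 * p3) - (dx X1 + dy X2 + dz X3) * p1"
definition cob_y where "cob_y X1 X2 X3 = dy (X1 * p1 + X2 * p2 + X3 * p3) - (dx X1 + dy X2 + dz X3) * p2"
definition cob_z where "cob_z X1 X2 X3 = dz (X1 * p1 + X2 * p2 + X3 * p3) - (dx X1 + dy X2 + dz X3) * p3"

lemmas cob_defs = cob_x_def cob_y_def cob_z_def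

lemma cob_add:
  "cob_x (X1 + Y1) (X2 + Y2) (X3 + Y3) = cob_x X1 X2 X3 + cob_x Y1 Y2 Y3"
  "cob_y (X1 + Y1) (X2 + Y2) (X3 + Y3) = cob_y X1 X2 X3 + cob_y Y1 Y2 Y3"
  "cob_z (X1 + Y1) (X2 + Y2) (X3 + Y3) = cob_z X1 X2 X3 + cob_z Y1 Y2 Y3"
  by (simp_all add: cob_defs algebra_simps)

text \<open>Such a field is orthogonal to \<nabla>\<phi> and has divergence -
  \<open>pcurl Z1 Z2 Z3\<close>. Thus values of \<open>pcurl\<close>, times \<nabla>\<phi>, are
  coboundaries.\<close>

lemma cob_cross:
  "cob_x (p2 * Z3 - p3 * Z2) (p3 * Z1 - p1 * Z3) (p1 * Z2 - p2 * Z1) = pcurl Z1 Z2 Z3 * p1"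
  "cob_y (p2 * Z3 - p3 * Z2) (p3 * Z1 - p1 * Z3) (p1 * Z2 - p2 * Z1) = pcurl Z1 Z2 Z3 * p2"
  "cob_z (p2 * Z3 - p3 * Z2) (p3 * Z1 - p1 * Z3) (p1 * Z2 - p2 * Z1) = pcurl Z1 Z2 Z3 * p3"
proof -
  have 0: "(p2 * Z3 - p3 * Z2) * p1 + (p3 * Z1 - p1 * Z3) * p2 + (p1 * Z2 - p2 * Z1) * p3 = 0"
    by (simp add: algebra_simps)
  show "cob_x (p2 * Z3 - p3 * Z2) (p3 * Z1 - p1 * Z3) (p1 * Z2 - p2 * Z1) = pcurl Z1 Z2 Z3 * p1"
    "cob_y (p2 * Z3 - p3 * Z2) (p3 * Z1 - p1 * Z3) (p1 * Z2 - p2 * Z1) = pcurl Z1 Z2 Z3 * p2"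
    "cob_z (p2 * Z3 - p3 * Z2) (p3 * Z1 - p1 * Z3) (p1 * Z2 - p2 * Z1) = pcurl Z1 Z2 Z3 * p3"
    unfolding cob_defs div_cross 0 by simp_all
qed

lemma euler_phi_poly:
  "L (\<Sum>l<n. cst (k l) * \<phi> ^ l) = (\<Sum>l<n. cst (of_nat (l * d) * k l) * \<phi> ^ l)"
  by (simp add: euler_sum euler_simps euler_phi_power cst_simps algebra_simps)

text \<open>On \<phi>^l the factor is d (l + 1) - (l d + w1 + w2 + w3) = d - (w1 + w2 + w3), the
  same for every l.\<close>

lemma euler_phi_poly_deficit:
  "of_nat d * (\<Sum>l<n. cst (of_nat (Suc l) * k l) * \<phi> ^ l)
    - (L (\<Sum>l<n. cst (k l) * \<phi> ^ l) + of_nat (w1 + w2 + w3) * (\<Sum>l<n. cst (k l) * \<phi> ^ l))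
    = (\<Sum>l<n. cst ((of_nat d - of_nat (w1 + w2 + w3)) * k l) * \<phi> ^ l)"
  unfolding euler_phi_poly sum_distrib_left sum.distrib[symmetric] sum_subtractf[symmetric]
  by (intro sum.cong refl) (simp add: cst_simps algebra_simps)

lemma euler_field_pairing:
  "of_nat w1 * Xv * A * p1 + of_nat w2 * Yv * A * p2 + of_nat w3 * Zv * A * p3 = of_nat d * (\<phi> * A)"
proof -
  have "of_nat w1 * Xv * A * p1 + of_nat w2 * Yv * A * p2 + of_nat w3 * Zv * A * p3
      = A * (of_nat w1 * Xv * p1 + of_nat w2 * Yv * p2 + of_nat w3 * Zv * p3)"
    by (simp add: algebra_simps)
  then show ?thesis unfolding euler_phi by (simp add: algebra_simps)
qed

lemma euler_field_div:
  "dx (of_nat w1 * Xv * A) + dy (of_nat w2 * Yv * A) + dz (of_nat w3 * Zv * A)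
    = L A + of_nat (w1 + w2 + w3) * A"
  by (simp add: euler_def algebra_simps)

lemma cob_euler_field:
  assumes A: "A = (\<Sum>l<n. cst (k l) * \<phi> ^ l)"
  defines "B \<equiv> (\<Sum>l<n. cst ((of_nat d - of_nat (w1 + w2 + w3)) * k l) * \<phi> ^ l)"
  shows "cob_x (of_nat w1 * Xv * A) (of_nat w2 * Yv * A) (of_nat w3 * Zv * A) = B * p1"
    "cob_y (of_nat w1 * Xv * A) (of_nat w2 * Yv * A) (of_nat w3 * Zv * A) = B * p2"
    "cob_z (of_nat w1 * Xv * A) (of_nat w2 * Yv * A) (of_nat w3 * Zv * A) = B * p3"
proof -
  define D where "D = (\<Sum>l<n. cst (of_nat (Suc l) * k l) * \<phi> ^ l)"
  have "\<phi> * A = (\<Sum>l<n. cst (k l) * \<phi> ^ Suc l)"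
    unfolding A by (simp add: sum_distrib_left algebra_simps)
  then have D: "dx (\<phi> * A) = D * p1" "dy (\<phi> * A) = D * p2" "dz (\<phi> * A) = D * p3"
    unfolding D_def by (simp_all only: d_phi_poly)
  have B: "of_nat d * D - (L A + of_nat (w1 + w2 + w3) * A) = B"
    unfolding A B_def D_def by (rule euler_phi_poly_deficit)
  have dd: "dx (of_nat d * (\<phi> * A)) = of_nat d * D * p1" "dy (of_nat d * (\<phi> * A)) = of_nat d * D * p2"
    "dz (of_nat d * (\<phi> * A)) = of_nat d * D * p3"
    using D by (simp_all del: d_mult add: d_mult[of "of_nat d"])
  show "cob_x (of_nat w1 * Xv * A) (of_nat w2 * Yv * A) (of_nat w3 * Zv * A) = B * p1"
    "cob_y (of_nat w1 * Xv * A) (of_nat w2 * Yv * A) (of_nat w3 * Zv * A) = B * p2"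
    "cob_z (of_nat w1 * Xv * A) (of_nat w2 * Yv * A) (of_nat w3 * Zv * A) = B * p3"
    unfolding cob_defs euler_field_pairing euler_field_div dd B[symmetric] by (simp_all add: algebra_simps)
qed

lemma sum_u_split: "(\<Sum>i<\<mu>. f i * u i) = f 0 + (\<Sum>r\<in>{1..<\<mu>}. f r * u r)"
proof -
  have "{..<\<mu>} = insert 0 {1..<\<mu>}" using mu_pos by auto
  then show ?thesis by (simp add: u_0)
qed

text \<open>Start from Y = \<nabla>a + b \<nabla>\<phi>. Reduction of a modulo the Jacobian ideal
  leaves the u_r and a term X . \<nabla>\<phi>, whose gradient is the coboundary of X plus div X
  \<nabla>\<phi>. So b becomes b + div X, which \<open>comb_spanning\<close> reduces up to a value
  of \<open>pcurl\<close>, again a coboundary by \<open>cob_cross\<close>.\<close>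

theorem second_cohomology_spanning:
  assumes "pcurl Y1 Y2 Y3 = 0"
  shows "\<exists>n c cb X1 X2 X3. (d \<noteq> w1 + w2 + w3 \<longrightarrow> (\<forall>l. c l 0 = 0)) \<and>
    Y1 = comb n c * p1 + (\<Sum>r\<in>{1..<\<mu>}. cst (cb r) * dx (u r)) + cob_x X1 X2 X3 \<and>
    Y2 = comb n c * p2 + (\<Sum>r\<in>{1..<\<mu>}. cst (cb r) * dy (u r)) + cob_y X1 X2 X3 \<and>
    Y3 = comb n c * p3 + (\<Sum>r\<in>{1..<\<mu>}. cst (cb r) * dz (u r)) + cob_z X1 X2 X3"
proof -
  obtain a b where Y: "Y1 = dx a + b * p1" "Y2 = dy a + b * p2" "Y3 = dz a + b * p3"
    using cocycle_form[OF assms] by blast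
  obtain cb X1 X2 X3 where a: "a = (\<Sum>i<\<mu>. cst (cb i) * u i) + (X1 * p1 + X2 * p2 + X3 * p3)"
    using spanning by blast
  obtain n c Z1 Z2 Z3 where c: "b + (dx X1 + dy X2 + dz X3) = comb n c + pcurl Z1 Z2 Z3"
    using comb_spanning by blast
  have da: "dx a = (\<Sum>r\<in>{1..<\<mu>}. cst (cb r) * dx (u r)) + dx (X1 * p1 + X2 * p2 + X3 * p3)"
    "dy a = (\<Sum>r\<in>{1..<\<mu>}. cst (cb r) * dy (u r)) + dy (X1 * p1 + X2 * p2 + X3 * p3)"
    "dz a = (\<Sum>r\<in>{1..<\<mu>}. cst (cb r) * dz (u r)) + dz (X1 * p1 + X2 * p2 + X3 * p3)"
    unfolding a sum_u_split d_add d_sum by simp_all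
  define W1 W2 W3 where W: "W1 = p2 * Z3 - p3 * Z2" "W2 = p3 * Z1 - p1 * Z3" "W3 = p1 * Z2 - p2 * Z1"
  have b: "b = comb n c + pcurl Z1 Z2 Z3 - (dx X1 + dy X2 + dz X3)"
    using c by (simp add: algebra_simps)
  have 1: "Y1 = comb n c * p1 + (\<Sum>r\<in>{1..<\<mu>}. cst (cb r) * dx (u r)) + cob_x (X1 + W1) (X2 + W2) (X3 + W3)"
    "Y2 = comb n c * p2 + (\<Sum>r\<in>{1..<\<mu>}. cst (cb r) * dy (u r)) + cob_y (X1 + W1) (X2 + W2) (X3 + W3)"
    "Y3 = comb n c * p3 + (\<Sum>r\<in>{1..<\<mu>}. cst (cb r) * dz (u r)) + cob_z (X1 + W1) (X2 + W2) (X3 + W3)"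
    unfolding Y b da cob_add W cob_cross by (simp_all add: cob_defs algebra_simps del: d_add d_mult)
  show ?thesis
  proof (cases "d = w1 + w2 + w3")
    case True
    then show ?thesis using 1 by blast
  next
    case False
    define c' where "c' = (\<lambda>l i. if i = 0 then 0 else c l i)"
    define \<delta> :: 'a where "\<delta> = of_nat d - of_nat (w1 + w2 + w3)"
    have \<delta>: "\<delta> \<noteq> 0" using False unfolding \<delta>_def by (simp only: right_minus_eq of_nat_eq_iff) simp
    \<comment> \<open>Chosen such that the coboundary of A \<epsilon> is \<nabla>\<phi> times the
      part of \<open>comb n c\<close> with i = 0.\<close>
    define A where "A = (\<Sum>l<n. cst (c l 0 / \<delta>) * \<phi> ^ l)"
    have *: "comb n c = comb n c' + (\<Sum>l<n. cst (\<delta> * (c l 0 / \<delta>)) * \<phi> ^ l)"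
    proof -
      have "(\<Sum>i<\<mu>. cst (c l i) * \<phi> ^ l * u i) = (\<Sum>i<\<mu>. cst (c' l i) * \<phi> ^ l * u i) + cst (c l 0) * \<phi> ^ l" for l
        unfolding sum_u_split[of "\<lambda>i. cst (c l i) * \<phi> ^ l"] sum_u_split[of "\<lambda>i. cst (c' l i) * \<phi> ^ l"]
        by (simp add: c'_def)
      then show ?thesis using \<delta> by (simp add: comb_def sum.distrib)
    qed
    note E = cob_euler_field[OF A_def, folded \<delta>_def]
    have "Y1 = comb n c' * p1 + (\<Sum>r\<in>{1..<\<mu>}. cst (cb r) * dx (u r)) +
        cob_x (X1 + W1 + of_nat w1 * Xv * A) (X2 + W2 + of_nat w2 * Yv * A) (X3 + W3 + of_nat w3 * Zv * A)"
      "Y2 = comb n c' * p2 + (\<Sum>r\<in>{1..<\<mu>}. cst (cb r) * dy (u r)) +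
        cob_y (X1 + W1 + of_nat w1 * Xv * A) (X2 + W2 + of_nat w2 * Yv * A) (X3 + W3 + of_nat w3 * Zv * A)"
      "Y3 = comb n c' * p3 + (\<Sum>r\<in>{1..<\<mu>}. cst (cb r) * dz (u r)) +
        cob_z (X1 + W1 + of_nat w1 * Xv * A) (X2 + W2 + of_nat w2 * Yv * A) (X3 + W3 + of_nat w3 * Zv * A)"
      unfolding 1 * cob_add(1)[of "X1 + W1"] cob_add(2)[of "X1 + W1"] cob_add(3)[of "X1 + W1"] E
      by (simp_all only: distrib_right) (simp_all only: ac_simps)
    moreover have "\<forall>l. c' l 0 = 0" by (simp add: c'_def)
    ultimately show ?thesis by blast
  qed
qed

lemma comb_cong: "(\<And>l i. l < n \<Longrightarrow> i < \<mu> \<Longrightarrow> c l i = c' l i) \<Longrightarrow> comb n c = comb n c'"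
  by (simp add: comb_def)

lemma comb_extend:
  assumes "n \<le> N"
  shows "comb n c = comb N (\<lambda>l i. if l < n then c l i else 0)"
proof -
  have "comb N (\<lambda>l i. if l < n then c l i else 0) = comb n (\<lambda>l i. if l < n then c l i else 0)"
    unfolding comb_def by (rule sum.mono_neutral_right) (use assms in auto)
  also have "\<dots> = comb n c" by (rule comb_cong) simp
  finally show ?thesis by simp
qed

lemma comb_add: "comb n c + comb n c' = comb n (\<lambda>l i. c l i + c' l i)"
  by (simp add: comb_def sum.distrib[symmetric] cst_simps algebra_simps)

lemma phi_poly_comb: "(\<Sum>l<n. cst (k l) * \<phi> ^ l) = comb n (\<lambda>l i. if i = 0 then k l else 0)"
proof -
  have "(\<Sum>i<\<mu>. cst (if i = 0 then k l else 0) * \<phi> ^ l * u i) = cst (k l) * \<phi> ^ l" for l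
    unfolding sum_u_split[of "\<lambda>i. cst (if i = 0 then k l else 0) * \<phi> ^ l"] by simp
  then show ?thesis by (simp add: comb_def)
qed

text \<open>The gradient of a = \<Sum> cb_r u_r - X . \<nabla>\<phi> is a multiple of
  \<nabla>\<phi>, so a = \<alpha>_0 + \<phi> A with A a polynomial in \<phi>. Reduction modulo the
  Jacobian ideal kills \<open>cb\<close> and \<alpha>_0. A divergence computation then places d
  \<open>comb n c\<close> + (d - w1 - w2 - w3) A in the image of \<open>pcurl\<close>, and
  \<open>comb_independent\<close> applies. The third conclusion prepares
  \<open>first_cohomology_trivial\<close>.\<close>

theorem second_cohomology_independent:
  assumes dw: "d \<noteq> w1 + w2 + w3" and c0: "\<And>l. c l 0 = 0"
    and Y: "comb n c * p1 + (\<Sum>r\<in>{1..<\<mu>}. cst (cb r) * dx (u r)) = cob_x X1 X2 X3"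
      "comb n c * p2 + (\<Sum>r\<in>{1..<\<mu>}. cst (cb r) * dy (u r)) = cob_y X1 X2 X3"
      "comb n c * p3 + (\<Sum>r\<in>{1..<\<mu>}. cst (cb r) * dz (u r)) = cob_z X1 X2 X3"
  shows "\<forall>l<n. \<forall>i<\<mu>. c l i = 0" "\<forall>r\<in>{1..<\<mu>}. cb r = 0" "X1 * p1 + X2 * p2 + X3 * p3 = 0"
proof -
  define S where "S = comb n c"
  define v where "v = dx X1 + dy X2 + dz X3"
  define q where "q = X1 * p1 + X2 * p2 + X3 * p3"
  define a where "a = (\<Sum>r\<in>{1..<\<mu>}. cst (cb r) * u r) - q"
  have da: "dx a = - (v + S) * p1" "dy a = - (v + S) * p2" "dz a = - (v + S) * p3"
  proof -
    have "S * p1 + (\<Sum>r\<in>{1..<\<mu>}. cst (cb r) * dx (u r)) = dx q - v * p1"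
      "S * p2 + (\<Sum>r\<in>{1..<\<mu>}. cst (cb r) * dy (u r)) = dy q - v * p2"
      "S * p3 + (\<Sum>r\<in>{1..<\<mu>}. cst (cb r) * dz (u r)) = dz q - v * p3"
      using Y unfolding S_def q_def v_def cob_defs by simp_all
    then show "dx a = - (v + S) * p1" "dy a = - (v + S) * p2" "dz a = - (v + S) * p3"
      by (simp_all add: a_def d_sum algebra_simps)
  qed
  obtain m \<alpha> where \<alpha>: "a = (\<Sum>l<Suc m. cst (\<alpha> l) * \<phi> ^ l)" using casimir[OF da] by blast
  define A where "A = (\<Sum>l<m. cst (\<alpha> (Suc l)) * \<phi> ^ l)"
  have phiA: "\<phi> * A = (\<Sum>l<m. cst (\<alpha> (Suc l)) * \<phi> ^ Suc l)"
    by (simp add: A_def sum_distrib_left algebra_simps)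
  have a: "a = cst (\<alpha> 0) + \<phi> * A" unfolding \<alpha> sum.lessThan_Suc_shift phiA by simp
  \<comment> \<open>The constant \<alpha>_0 is counted as a coefficient of u_0 = 1.\<close>
  define b where "b i = (if i = 0 then - \<alpha> 0 else cb i)" for i
  have "(\<Sum>i<\<mu>. cst (of_nat d * b i) * u i) = of_nat d * (q + \<phi> * A)"
  proof -
    have "(\<Sum>i<\<mu>. cst (of_nat d * b i) * u i) = of_nat d * (\<Sum>i<\<mu>. cst (b i) * u i)"
      by (simp add: sum_distrib_left cst_simps algebra_simps)
    moreover have "(\<Sum>i<\<mu>. cst (b i) * u i) = q + \<phi> * A"
      using a unfolding sum_u_split by (simp add: b_def a_def cst_simps algebra_simps)
    ultimately show ?thesis by simp
  qed
  also have "\<dots> = (of_nat d * X1 + of_nat w1 * Xv * A) * p1 + (of_nat d * X2 + of_nat w2 * Yv * A) * p2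
      + (of_nat d * X3 + of_nat w3 * Zv * A) * p3"
    using euler_field_pairing[of A] by (simp add: q_def algebra_simps)
  finally have *: "(\<Sum>i<\<mu>. cst (of_nat d * b i) * u i) =
      (of_nat d * X1 + of_nat w1 * Xv * A) * p1 + (of_nat d * X2 + of_nat w2 * Yv * A) * p2
      + (of_nat d * X3 + of_nat w3 * Zv * A) * p3" .
  have b0: "b i = 0" if "i < \<mu>" for i using independent[OF * that] d_pos by simp
  show cb: "\<forall>r\<in>{1..<\<mu>}. cb r = 0"
  proof
    fix r assume "r \<in> {1..<\<mu>}"
    then show "cb r = 0" using b0[of r] by (simp add: b_def)
  qed
  have "\<alpha> 0 = 0" using b0[OF mu_pos] by (simp add: b_def)
  with a have aA: "a = \<phi> * A" by simp
  have qA: "q = - (\<phi> * A)" using cb aA by (simp add: a_def) (metis minus_minus)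
  have "(of_nat d * X1 + of_nat w1 * Xv * A) * p1 + (of_nat d * X2 + of_nat w2 * Yv * A) * p2
      + (of_nat d * X3 + of_nat w3 * Zv * A) * p3 = 0"
    using * b0 by simp
  then obtain W1 W2 W3 where W: "of_nat d * X1 + of_nat w1 * Xv * A = p2 * W3 - p3 * W2"
    "of_nat d * X2 + of_nat w2 * Yv * A = p3 * W1 - p1 * W3"
    "of_nat d * X3 + of_nat w3 * Zv * A = p1 * W2 - p2 * W1"
    using orthogonal_imp_cross by blast
  have "of_nat d * v + (L A + of_nat (w1 + w2 + w3) * A) = dx (of_nat d * X1 + of_nat w1 * Xv * A)
      + dy (of_nat d * X2 + of_nat w2 * Yv * A) + dz (of_nat d * X3 + of_nat w3 * Zv * A)"
    unfolding euler_field_div[symmetric] v_def by (simp add: algebra_simps)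
  also have "\<dots> = - pcurl W1 W2 W3" unfolding W div_cross ..
  finally have v: "of_nat d * v + (L A + of_nat (w1 + w2 + w3) * A) = - pcurl W1 W2 W3" .
  define B where "B = (\<Sum>l<m. cst (of_nat (Suc l) * \<alpha> (Suc l)) * \<phi> ^ l)"
  have dB: "dx a = B * p1" "dy a = B * p2" "dz a = B * p3"
    unfolding aA phiA B_def by (simp_all only: d_phi_poly)
  have *: "(B + v + S) * q = B * q - - (v + S) * q" for q by (simp add: algebra_simps)
  have "(B + v + S) * p1 = 0" "(B + v + S) * p2 = 0" "(B + v + S) * p3 = 0"
    unfolding * dB[symmetric] da[symmetric] by simp_all
  then have BvS: "B + v + S = 0" by (rule gradient_nonzero)
  have "of_nat d * S + (of_nat d * B - Q) - - (of_nat d * v + Q) = of_nat d * (B + v + S)" for Q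
    by (simp add: algebra_simps)
  then have "of_nat d * S + (of_nat d * B - (L A + of_nat (w1 + w2 + w3) * A)) =
      - (of_nat d * v + (L A + of_nat (w1 + w2 + w3) * A))"
    unfolding BvS mult_zero_right right_minus_eq .
  then have eq: "of_nat d * S + (of_nat d * B - (L A + of_nat (w1 + w2 + w3) * A)) = pcurl W1 W2 W3"
    unfolding v by simp
  define \<delta> :: 'a where "\<delta> = of_nat d - of_nat (w1 + w2 + w3)"
  have \<delta>: "\<delta> \<noteq> 0" using dw unfolding \<delta>_def by (simp only: right_minus_eq of_nat_eq_iff) simp
  have "of_nat d * B - (L A + of_nat (w1 + w2 + w3) * A) = (\<Sum>l<m. cst (\<delta> * \<alpha> (Suc l)) * \<phi> ^ l)"
    unfolding A_def B_def \<delta>_def by (rule euler_phi_poly_deficit)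
  moreover have "of_nat d * S = comb n (\<lambda>l i. of_nat d * c l i)"
    unfolding S_def using comb_cst_mult[of "of_nat d" n c] by simp
  ultimately have eq': "comb n (\<lambda>l i. of_nat d * c l i) + comb m (\<lambda>l i. if i = 0 then \<delta> * \<alpha> (Suc l) else 0)
      = pcurl W1 W2 W3"
    using eq by (simp add: phi_poly_comb)
  \<comment> \<open>No cancellation can occur between the two sums: the first has no terms with i =
    0, the second has no others.\<close>
  have 0: "(if l < n then of_nat d * c l i else 0) + (if l < m then if i = 0 then \<delta> * \<alpha> (Suc l) else 0 else 0) = 0"
    if "l < max n m" "i < \<mu>" for l i
  proof (rule comb_independent[OF _ that])
    show "comb (max n m) (\<lambda>l i. (if l < n then of_nat d * c l i else 0)
        + (if l < m then if i = 0 then \<delta> * \<alpha> (Suc l) else 0 else 0)) = pcurl W1 W2 W3"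
      using eq' unfolding comb_add[symmetric]
      by (simp only: comb_extend[of n "max n m"] comb_extend[of m "max n m"] max.cobounded1 max.cobounded2)
  qed
  show "\<forall>l<n. \<forall>i<\<mu>. c l i = 0"
  proof (intro allI impI)
    fix l i assume "l < n" "i < \<mu>"
    moreover have "l < max n m" using \<open>l < n\<close> by simp
    ultimately show "c l i = 0" using 0[of l i] c0[of l] d_pos by (cases "i = 0") (simp_all split: if_splits)
  qed
  have "\<alpha> (Suc l) = 0" if "l < m" for l
  proof -
    have "l < max n m" using that by simp
    then show ?thesis using 0[of l 0] that mu_pos c0[of l] \<delta> by (simp split: if_splits)
  qed
  then have "A = 0" by (simp add: A_def)
  then show "X1 * p1 + X2 * p2 + X3 * p3 = 0" using qA by (simp add: q_def)
qed

text \<open>The preceding theorem with zero coefficients gives X . \<nabla>\<phi> = 0, hence div X =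
  0. So X = \<nabla>\<phi> \<times> W with W a cocycle; by \<open>cocycle_form\<close> W may be
  replaced by a gradient \<nabla>h, and X is the Hamiltonian field of h.\<close>

theorem first_cohomology_trivial:
  assumes dw: "d \<noteq> w1 + w2 + w3"
    and X: "cob_x X1 X2 X3 = 0" "cob_y X1 X2 X3 = 0" "cob_z X1 X2 X3 = 0"
  shows "\<exists>h. X1 = p2 * dz h - p3 * dy h \<and> X2 = p3 * dx h - p1 * dz h \<and> X3 = p1 * dy h - p2 * dx h"
proof -
  have perp: "X1 * p1 + X2 * p2 + X3 * p3 = 0"
    using second_cohomology_independent(3)[of "\<lambda>_ _. 0" 0 "\<lambda>_. 0"] X dw by (simp add: comb_def)
  then have "(dx X1 + dy X2 + dz X3) * p1 = 0" "(dx X1 + dy X2 + dz X3) * p2 = 0" "(dx X1 + dy X2 + dz X3) * p3 = 0"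
    using X unfolding cob_defs perp by simp_all
  then have v: "dx X1 + dy X2 + dz X3 = 0" by (rule gradient_nonzero)
  obtain W1 W2 W3 where W: "X1 = p2 * W3 - p3 * W2" "X2 = p3 * W1 - p1 * W3" "X3 = p1 * W2 - p2 * W1"
    using orthogonal_imp_cross[OF perp] by blast
  have "pcurl W1 W2 W3 = 0" using v unfolding W div_cross by simp
  then obtain h b where "W1 = dx h + b * p1" "W2 = dy h + b * p2" "W3 = dz h + b * p3"
    using cocycle_form by blast
  then have "X1 = p2 * dz h - p3 * dy h \<and> X2 = p3 * dx h - p1 * dz h \<and> X3 = p1 * dy h - p2 * dx h"
    by (simp add: W algebra_simps)
  then show ?thesis by blast
qed

end

unbundle fps_syntax

section \<open>Biderivations of \<open>A[[\<nu>]]\<close>\<close>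

lemma fps_X_power_dvd_iff: "fps_X ^ n dvd (F :: 'b::comm_ring_1 fps) \<longleftrightarrow> (\<forall>k<n. F $ k = 0)"
proof
  assume "\<forall>k<n. F $ k = 0"
  then have "F = fps_X ^ n * fps_shift n F" by (intro fps_ext) (simp add: fps_X_power_mult_nth)
  then show "fps_X ^ n dvd F" by (metis dvd_triv_left)
qed (auto simp: fps_X_power_mult_nth)

lemma nu_cong_iff: "nu_cong m F G \<longleftrightarrow> (\<forall>k\<le>m. F $ k = G $ k)"
  by (simp add: nu_cong_def fps_X_power_dvd_iff less_Suc_eq_le flip: Suc_eq_plus1 power_Suc)

text \<open>Splitting off the constant term n times reaches the coefficient of order n; commutation
  with \<nu> thus replaces continuity.\<close>

lemma nu_linear_zero:
  fixes T :: "'b::comm_ring_1 fps \<Rightarrow> 'b fps"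
  assumes add: "\<And>F G. T (F + G) = T F + T G" and X: "\<And>F. T (fps_X * F) = fps_X * T F"
    and const: "\<And>f. T (fps_const f) = 0"
  shows "T F = 0"
proof (rule fps_ext)
  show "T F $ n = 0 $ n" for n
  proof (induction n arbitrary: F rule: less_induct)
    case (less n F)
    have "F = fps_const (F $ 0) + fps_X * fps_shift 1 F"
      by (intro fps_ext) (simp add: fps_X_mult_nth)
    then have "T F = T (fps_const (F $ 0)) + T (fps_X * fps_shift 1 F)" by (metis add)
    then show ?case using less by (simp add: X const fps_X_mult_nth)
  qed
qed

section \<open>Derivations and brackets over the formal power series\<close>

definition fdx :: "'a::field_char_0 poly3 fps \<Rightarrow> 'a poly3 fps" where "fdx F = Abs_fps (\<lambda>n. dx (F $ n))"
definition fdy :: "'a::field_char_0 poly3 fps \<Rightarrow> 'a poly3 fps" where "fdy F = Abs_fps (\<lambda>n. dy (F $ n))"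
definition fdz :: "'a::field_char_0 poly3 fps \<Rightarrow> 'a poly3 fps" where "fdz F = Abs_fps (\<lambda>n. dz (F $ n))"

lemma fd_nth [simp]: "fdx F $ n = dx (F $ n)" "fdy F $ n = dy (F $ n)" "fdz F $ n = dz (F $ n)"
  by (simp_all add: fdx_def fdy_def fdz_def)

lemma fd_add [simp]: "fdx (F + G) = fdx F + fdx G" "fdy (F + G) = fdy F + fdy G" "fdz (F + G) = fdz F + fdz G"
  by (rule fps_ext; simp)+

lemma fd_diff [simp]: "fdx (F - G) = fdx F - fdx G" "fdy (F - G) = fdy F - fdy G" "fdz (F - G) = fdz F - fdz G"
  by (rule fps_ext; simp)+

lemma fd_minus [simp]: "fdx (- F) = - fdx F" "fdy (- F) = - fdy F" "fdz (- F) = - fdz F"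
  by (rule fps_ext; simp)+

lemma fd_mult [simp]:
  "fdx (F * G) = F * fdx G + fdx F * G" "fdy (F * G) = F * fdy G + fdy F * G"
  "fdz (F * G) = F * fdz G + fdz F * G"
  by (rule fps_ext; simp add: fps_mult_nth d_sum sum.distrib)+

lemma fd_commute: "fdy (fdx F) = fdx (fdy F)" "fdz (fdx F) = fdx (fdz F)" "fdz (fdy F) = fdy (fdz F)"
  by (rule fps_ext; simp add: d_commute)+

lemma fd_const: "fdx (fps_const f) = fps_const (dx f)" "fdy (fps_const f) = fps_const (dy f)"
  "fdz (fps_const f) = fps_const (dz f)"
  by (rule fps_ext; simp)+

lemma fd_vars [simp]:
  "fdx (fps_const Xv) = 1" "fdx (fps_const Yv) = 0" "fdx (fps_const Zv) = 0"
  "fdy (fps_const Xv) = 0" "fdy (fps_const Yv) = 1" "fdy (fps_const Zv) = 0"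
  "fdz (fps_const Xv) = 0" "fdz (fps_const Yv) = 0" "fdz (fps_const Zv) = 1"
  by (simp_all add: fd_const)

lemma fd_scalar [simp]: "fdx (scalar s) = 0" "fdy (scalar s) = 0" "fdz (scalar s) = 0"
  by (rule fps_ext; simp add: scalar_def)+

lemma scalar_fps_X: "scalar fps_X = fps_X"
  by (rule fps_ext) (simp add: scalar_def fps_X_def)

lemma scalar_const: "scalar (fps_const a) = fps_const (cst a)"
  by (rule fps_ext) (simp add: scalar_def)

lemma scalar_mult: "scalar (s * t) = scalar s * scalar t"
  by (rule fps_ext) (simp add: scalar_def fps_mult_nth cst_sum cst_simps)

lemma fd_X_const [simp]: "fdx fps_X = 0" "fdy fps_X = 0" "fdz fps_X = 0"
  "fdx (fps_const (cst a)) = 0" "fdy (fps_const (cst a)) = 0" "fdz (fps_const (cst a)) = 0"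
  by (simp_all add: fd_scalar[of fps_X, unfolded scalar_fps_X] fd_scalar[of "fps_const a", unfolded scalar_const])

text \<open>Linearity over all of F[[\<nu>]] is not built in; it follows from the chain rule
  (\<open>nu_derivation_scalar\<close>).\<close>

definition nu_derivation :: "('a::field_char_0 poly3 fps \<Rightarrow> 'a poly3 fps) \<Rightarrow> bool" where
  "nu_derivation T \<longleftrightarrow> (\<forall>F G. T (F + G) = T F + T G) \<and> (\<forall>F G. T (F * G) = F * T G + T F * G) \<and>
     (\<forall>a. T (fps_const (cst a)) = 0) \<and> T fps_X = 0"

lemma nu_derivation_chain:
  assumes "nu_derivation T"
  shows "T F = T (fps_const Xv) * fdx F + T (fps_const Yv) * fdy F + T (fps_const Zv) * fdz F"
proof -
  define T' where "T' F = T F - (T (fps_const Xv) * fdx F + T (fps_const Yv) * fdy F + T (fps_const Zv) * fdz F)" for F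
  have T_add: "T' (F + G) = T' F + T' G" and T_mult: "T' (F * G) = F * T' G + T' F * G"
    and c: "T' (fps_const (cst a)) = 0" and X: "T' fps_X = 0" for F G a
    using assms by (simp_all add: nu_derivation_def T'_def algebra_simps)
  have "T' F = 0"
  proof (rule nu_linear_zero[of T'])
    show "T' (fps_X * F) = fps_X * T' F" for F by (simp add: T_mult X)
    show "T' (fps_const f) = 0" for f
    proof (induction f rule: poly3_induct)
      case (add f g)
      then show ?case by (simp add: T_add flip: fps_const_add)
    next
      case (mult f g)
      then show ?case by (simp add: T_mult flip: fps_const_mult)
    qed (simp_all add: c, simp_all add: T'_def)
  qed (rule T_add)
  then show ?thesis by (simp add: T'_def)
qed

lemma nu_derivation_scalar:
  assumes "nu_derivation T"
  shows "T (scalar s) = 0"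
  by (subst nu_derivation_chain[OF assms]) simp

lemma fps_eq_neg_self:
  fixes F :: "'a::field_char_0 poly3 fps"
  assumes "F = - F"
  shows "F = 0"
proof -
  have "F + F = 0" using assms by (metis add.right_inverse)
  then have "2 * F = 0" by (simp only: mult_2)
  then show ?thesis by simp
qed

definition nu_bider :: "('a::field_char_0 poly3 fps \<Rightarrow> 'a poly3 fps \<Rightarrow> 'a poly3 fps) \<Rightarrow> bool" where
  "nu_bider B \<longleftrightarrow> (\<forall>F G. B F G = - B G F) \<and> (\<forall>F. nu_derivation (B F))"

definition vb :: "'a::field_char_0 poly3 fps \<Rightarrow> 'a poly3 fps \<Rightarrow> 'a poly3 fps
    \<Rightarrow> 'a poly3 fps \<Rightarrow> 'a poly3 fps \<Rightarrow> 'a poly3 fps" where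
  "vb Y1 Y2 Y3 F G = Y1 * (fdy F * fdz G - fdz F * fdy G) + Y2 * (fdz F * fdx G - fdx F * fdz G)
     + Y3 * (fdx F * fdy G - fdy F * fdx G)"

lemma nu_bider_vb: "nu_bider (vb Y1 Y2 Y3)"
  by (simp add: nu_bider_def nu_derivation_def vb_def algebra_simps)

lemma nu_bider_eq_vb:
  assumes "nu_bider B"
  shows "B = vb (B (fps_const Yv) (fps_const Zv)) (B (fps_const Zv) (fps_const Xv)) (B (fps_const Xv) (fps_const Yv))"
proof (intro ext)
  fix F G
  have skew: "B F G = - B G F" for F G using assms unfolding nu_bider_def by blast
  have diag: "B F F = 0" for F by (rule fps_eq_neg_self[OF skew])
  have der: "nu_derivation (B F)" for F using assms unfolding nu_bider_def by blast
  have chain: "B F G = B F (fps_const Xv) * fdx G + B F (fps_const Yv) * fdy G + B F (fps_const Zv) * fdz G" for F G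
    by (rule nu_derivation_chain[OF der])
  have "B F G = - (B (fps_const Xv) F * fdx G + B (fps_const Yv) F * fdy G + B (fps_const Zv) F * fdz G)"
    unfolding chain[of F G] skew[of F "fps_const _"] by simp
  also have "\<dots> = vb (B (fps_const Yv) (fps_const Zv)) (B (fps_const Zv) (fps_const Xv)) (B (fps_const Xv) (fps_const Yv)) F G"
    unfolding chain[of _ F] vb_def diag skew[of "fps_const Yv" "fps_const Xv"] skew[of "fps_const Zv" "fps_const Yv"]
      skew[of "fps_const Xv" "fps_const Zv"] by (simp add: algebra_simps)
  finally show "B F G = vb (B (fps_const Yv) (fps_const Zv)) (B (fps_const Zv) (fps_const Xv)) (B (fps_const Xv) (fps_const Yv)) F G" .
qed

definition jac where "jac B F G H = B F (B G H) + B G (B H F) + B H (B F G)"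

lemma jac_vb_vars:
  "jac (vb Y1 Y2 Y3) (fps_const Xv) (fps_const Yv) (fps_const Zv) =
    - (Y1 * (fdy Y3 - fdz Y2) + Y2 * (fdz Y1 - fdx Y3) + Y3 * (fdx Y2 - fdy Y1))"
  by (simp add: jac_def vb_def algebra_simps)

text \<open>By skew-symmetry the Jacobiator in its last argument is the commutator of the
  derivations \<open>B F\<close> and \<open>B G\<close> minus the derivation
  \<open>B (B F G)\<close>.\<close>

lemma nu_derivation_jac:
  assumes "nu_bider B"
  shows "nu_derivation (jac B F G)"
proof -
  have skew: "B F G = - B G F" for F G using assms unfolding nu_bider_def by blast
  have der: "nu_derivation (B F)" for F using assms unfolding nu_bider_def by blast
  have "B F (- G) = - B F G" for F G
    using der[of F] nu_derivation_chain[OF der[of F], of "- G"] nu_derivation_chain[OF der[of F], of G] by simp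
  then have "jac B F G H = B F (B G H) - B G (B F H) - B (B F G) H" for H
    unfolding jac_def skew[of H] by simp
  moreover have "nu_derivation (\<lambda>H. B F (B G H) - B G (B F H) - B (B F G) H)"
  proof -
    have z: "B F 0 = 0" for F using nu_derivation_chain[OF der, of F 0] by (simp add: fd_const[of 0, simplified])
    show ?thesis using der z by (simp add: nu_derivation_def algebra_simps)
  qed
  ultimately show ?thesis by presburger
qed

text \<open>The Jacobiator is alternating and a derivation in each argument, so in three variables
  its value on (x, y, z) determines it. This reduces the Jacobi identity to Y . curl Y = 0.\<close>

lemma jacobi_from_generators:
  assumes B: "nu_bider B" and 0: "jac B (fps_const Xv) (fps_const Yv) (fps_const Zv) = 0"
  shows "jac B F G H = 0"
proof -
  have skew: "B F G = - B G F" for F G using assms unfolding nu_bider_def by blast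
  have der: "nu_derivation (B F)" for F using assms unfolding nu_bider_def by blast
  have neg: "B F (- G) = - B F G" for F G
    using der[of F] nu_derivation_chain[OF der[of F], of "- G"] nu_derivation_chain[OF der[of F], of G] by simp
  have cyc: "jac B F G H = jac B G H F" for F G H by (simp add: jac_def)
  have swap: "jac B F G H = - jac B G F H" for F G H
    unfolding jac_def by (simp add: skew[of H] skew[of G F] neg)
  have diag: "jac B F F H = 0" for F H by (rule fps_eq_neg_self[OF swap])
  have ch: "jac B F G H = jac B F G (fps_const Xv) * fdx H + jac B F G (fps_const Yv) * fdy H
      + jac B F G (fps_const Zv) * fdz H" for F G H
    by (rule nu_derivation_chain[OF nu_derivation_jac[OF B]])
  define vars where "vars = {fps_const Xv, fps_const Yv, fps_const Zv :: 'a poly3 fps}"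
  have diag': "jac B F G G = 0" "jac B F G F = 0" for F G
    using diag[of G F] diag[of F G] cyc[of F G G] cyc[of G F F] cyc[of F G F] by simp_all
  let ?x = "fps_const Xv" and ?y = "fps_const Yv" and ?z = "fps_const Zv"
  have p: "jac B ?y ?z ?x = 0" "jac B ?z ?x ?y = 0"
    using 0 cyc[of ?x ?y ?z] cyc[of ?y ?z ?x] by simp_all
  have q: "jac B ?y ?x ?z = 0" "jac B ?z ?y ?x = 0" "jac B ?x ?z ?y = 0"
    using 0 p swap[of ?y ?x ?z] swap[of ?z ?y ?x] swap[of ?x ?z ?y] by simp_all
  have "jac B f g h = 0" if "f \<in> vars" "g \<in> vars" "h \<in> vars" for f g h
    using that unfolding vars_def by (auto simp: 0 p q diag diag')
  then have 1: "jac B f g H = 0" if "f \<in> vars" "g \<in> vars" for f g H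
    using that by (subst ch) (simp add: vars_def)
  have 2: "jac B f G H = 0" if "f \<in> vars" for f G H
  proof -
    have "jac B H f G = 0" by (subst ch) (use 1 that cyc[of H f] in \<open>simp add: vars_def\<close>)
    then show ?thesis by (simp add: cyc[of H f G])
  qed
  have "jac B G H F = 0" by (subst ch) (use 2 cyc[of G H] cyc[of H _ G] in \<open>simp add: vars_def\<close>)
  then show ?thesis by (simp add: cyc[of F G H])
qed

text \<open>Just enough for a map to be determined by its values on constant series; it covers the
  product as well as the brackets.\<close>

definition nu_bilinear :: "('b::comm_ring_1 fps \<Rightarrow> 'b fps \<Rightarrow> 'b fps) \<Rightarrow> bool" where
  "nu_bilinear B \<longleftrightarrow> (\<forall>F F' G. B (F + F') G = B F G + B F' G) \<and> (\<forall>F G G'. B F (G + G') = B F G + B F G')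
    \<and> (\<forall>F G. B (fps_X * F) G = fps_X * B F G) \<and> (\<forall>F G. B F (fps_X * G) = fps_X * B F G)"

lemma nu_bilinear_vb: "nu_bilinear (vb Y1 Y2 Y3)"
  by (simp add: nu_bilinear_def vb_def algebra_simps)

lemma nu_bilinear_mult: "nu_bilinear (*)"
  by (simp add: nu_bilinear_def algebra_simps)

lemma nu_bilinear_eqI:
  assumes "nu_bilinear B" "nu_bilinear B'" "\<And>f g. B (fps_const f) (fps_const g) = B' (fps_const f) (fps_const g)"
  shows "B = B'"
proof (intro ext)
  fix F G
  have 1: "B (fps_const f) G - B' (fps_const f) G = 0" for f G
    by (rule nu_linear_zero[of "\<lambda>G. B (fps_const f) G - B' (fps_const f) G"])
      (use assms in \<open>simp_all add: nu_bilinear_def algebra_simps\<close>)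
  have "B F G - B' F G = 0"
    by (rule nu_linear_zero[of "\<lambda>F. B F G - B' F G"])
      (use assms 1 in \<open>simp_all add: nu_bilinear_def algebra_simps\<close>)
  then show "B F G = B' F G" by simp
qed

lemma formal_sum_nth:
  "formal_sum \<pi> F G $ n = (\<Sum>i\<le>n. \<Sum>j\<le>n - i. \<pi> i (F $ j) (G $ (n - i - j)))"
  by (simp add: formal_sum_def bilinear_ext_def)

lemma nu_bilinear_formal_sum:
  assumes l: "\<And>i f f' g. \<pi> i (f + f') g = \<pi> i f g + \<pi> i f' g"
    and r: "\<And>i f g g'. \<pi> i f (g + g') = \<pi> i f g + \<pi> i f g'"
  shows "nu_bilinear (formal_sum \<pi>)"
proof -
  have l0: "\<pi> i 0 g = 0" for i g using l[of i 0 0 g] by simp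
  have r0: "\<pi> i f 0 = 0" for i f using r[of i f 0 0] by simp
  have "formal_sum \<pi> (fps_X * F) G = fps_X * formal_sum \<pi> F G" for F G
  proof (rule fps_ext)
    show "formal_sum \<pi> (fps_X * F) G $ n = (fps_X * formal_sum \<pi> F G) $ n" for n
    proof (cases n)
      case (Suc n)
      have "(\<Sum>j\<le>Suc n - i. \<pi> i ((fps_X * F) $ j) (G $ (Suc n - i - j))) =
        (\<Sum>j\<le>n - i. \<pi> i (F $ j) (G $ (n - i - j)))" if "i \<le> n" for i
        unfolding Suc_diff_le[OF that] sum.atMost_Suc_shift by (simp add: l0 fps_X_mult_nth)
      then show ?thesis using Suc by (simp add: formal_sum_nth fps_X_mult_nth l0)
    qed (simp add: formal_sum_nth l0)
  qed
  moreover have "formal_sum \<pi> F (fps_X * G) = fps_X * formal_sum \<pi> F G" for F G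
  proof (rule fps_ext)
    show "formal_sum \<pi> F (fps_X * G) $ n = (fps_X * formal_sum \<pi> F G) $ n" for n
    proof (cases n)
      case (Suc n)
      have "(\<Sum>j\<le>Suc n - i. \<pi> i (F $ j) ((fps_X * G) $ (Suc n - i - j))) =
        (\<Sum>j\<le>n - i. \<pi> i (F $ j) (G $ (n - i - j)))" if "i \<le> n" for i
        unfolding Suc_diff_le[OF that] sum.atMost_Suc
        by (auto simp: r0 fps_X_mult_nth Suc_diff_le intro!: sum.cong)
      then show ?thesis using Suc by (simp add: formal_sum_nth fps_X_mult_nth r0)
    qed (simp add: formal_sum_nth r0)
  qed
  moreover have "formal_sum \<pi> (F + F') G = formal_sum \<pi> F G + formal_sum \<pi> F' G" for F F' G
    by (rule fps_ext) (simp add: formal_sum_nth l sum.distrib)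
  moreover have "formal_sum \<pi> F (G + G') = formal_sum \<pi> F G + formal_sum \<pi> F G'" for F G G'
    by (rule fps_ext) (simp add: formal_sum_nth r sum.distrib)
  ultimately show ?thesis by (simp add: nu_bilinear_def)
qed

lemma formal_sum_const:
  assumes "\<And>i f. \<pi> i f 0 = 0" "\<And>i g. \<pi> i 0 g = 0"
  shows "formal_sum \<pi> (fps_const f) (fps_const g) $ n = \<pi> n f g"
proof -
  have "(\<Sum>j\<le>n - i. \<pi> i (fps_const f $ j) (fps_const g $ (n - i - j))) = (if i = n then \<pi> n f g else 0)"
    if "i \<le> n" for i
  proof -
    have "(\<Sum>j\<le>n - i. \<pi> i (fps_const f $ j) (fps_const g $ (n - i - j))) =
      (\<Sum>j\<in>{0}. \<pi> i (fps_const f $ j) (fps_const g $ (n - i - j)))"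
      by (rule sum.mono_neutral_right) (auto simp: assms)
    then show ?thesis using that assms by auto
  qed
  then have "formal_sum \<pi> (fps_const f) (fps_const g) $ n = (\<Sum>i\<le>n. if i = n then \<pi> n f g else 0)"
    by (simp add: formal_sum_nth)
  then show ?thesis by simp
qed

text \<open>Lets a deformation be treated as a single bracket over F[[\<nu>]], whose coefficient
  maps are read off on constant series.\<close>

lemma formal_sum_eq:
  assumes B: "nu_bilinear B" and \<pi>: "\<And>n f g. \<pi> n f g = B (fps_const f) (fps_const g) $ n"
  shows "formal_sum \<pi> = B"
proof (rule nu_bilinear_eqI[OF _ B])
  have add: "B (F + F') G = B F G + B F' G" "B F (G + G') = B F G + B F G'" for F F' G G'
    using B by (auto simp: nu_bilinear_def)
  have l: "\<pi> i (f + f') g = \<pi> i f g + \<pi> i f' g" and r: "\<pi> i f (g + g') = \<pi> i f g + \<pi> i f g'" for i f f' g g'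
    by (simp_all add: \<pi> add flip: fps_const_add)
  show "nu_bilinear (formal_sum \<pi>)" by (rule nu_bilinear_formal_sum[OF l r])
  have "\<pi> i 0 g = 0" "\<pi> i f 0 = 0" for i f g using l[of i 0 0 g] r[of i f 0 0] by simp_all
  then show "formal_sum \<pi> (fps_const f) (fps_const g) = B (fps_const f) (fps_const g)" for f g
    by (intro fps_ext) (simp add: formal_sum_const \<pi>)
qed

lemma nu_bilinear_X_power:
  assumes "nu_bilinear B"
  shows "B (fps_X ^ n * F) G = fps_X ^ n * B F G" "B F (fps_X ^ n * G) = fps_X ^ n * B F G"
  using assms by (induction n) (simp_all add: nu_bilinear_def mult.assoc)

lemma nu_bilinear_diff:
  assumes "nu_bilinear B"
  shows "B (F - F') G = B F G - B F' G" "B F (G - G') = B F G - B F G'"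
  using assms unfolding nu_bilinear_def by (metis add_diff_cancel diff_add_cancel)+

lemma nu_bilinear_sum:
  assumes "nu_bilinear B"
  shows "B (sum f A) G = (\<Sum>i\<in>A. B (f i) G)" "B F (sum g A) = (\<Sum>i\<in>A. B F (g i))"
proof -
  have z: "B 0 G = 0" "B F 0 = 0" for F G
    using nu_bilinear_diff[OF assms, of 0 0 G] nu_bilinear_diff(2)[OF assms, of F 0 0] by simp_all
  show "B (sum f A) G = (\<Sum>i\<in>A. B (f i) G)" "B F (sum g A) = (\<Sum>i\<in>A. B F (g i))"
    using assms by (induction A rule: infinite_finite_induct; simp add: z nu_bilinear_def)+
qed

text \<open>A change of the arguments from order n + 1 on changes the value by a multiple of
  \<nu>^(n + 1).\<close>

lemma nu_bilinear_nth_cong: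
  assumes "nu_bilinear B" "\<And>k. k \<le> n \<Longrightarrow> F $ k = F' $ k" "\<And>k. k \<le> n \<Longrightarrow> G $ k = G' $ k"
  shows "B F G $ n = B F' G' $ n"
proof -
  have "fps_X ^ Suc n dvd F - F'" "fps_X ^ Suc n dvd G - G'"
    using assms unfolding fps_X_power_dvd_iff by auto
  then obtain U V where U: "F - F' = fps_X ^ Suc n * U" and V: "G - G' = fps_X ^ Suc n * V" by (auto elim!: dvdE)
  have "B F G - B F' G' = B (F - F') G + B F' (G - G')"
    by (simp add: nu_bilinear_diff[OF assms(1)])
  also have "\<dots> = fps_X ^ Suc n * (B U G + B F' V)"
    unfolding U V nu_bilinear_X_power[OF assms(1)] by (simp add: algebra_simps)
  finally have "(B F G - B F' G') $ n = 0" by (simp add: fps_X_power_mult_nth del: power_Suc)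
  then show ?thesis by simp
qed

section \<open>Automorphisms of \<open>A[[\<nu>]]\<close>\<close>

lemma nu_cong_refl [simp]: "nu_cong m F F"
  and nu_cong_sym: "nu_cong m F G \<Longrightarrow> nu_cong m G F"
  and nu_cong_trans: "nu_cong m F G \<Longrightarrow> nu_cong m G H \<Longrightarrow> nu_cong m F H"
  and nu_cong_add: "nu_cong m F F' \<Longrightarrow> nu_cong m G G' \<Longrightarrow> nu_cong m (F + G) (F' + G')"
  and nu_cong_mult: "nu_cong m F F' \<Longrightarrow> nu_cong m G G' \<Longrightarrow> nu_cong m (F * G) (F' * G')"
  by (auto simp: nu_cong_iff fps_mult_nth)

lemma nu_cong_bilinear:
  "nu_bilinear B \<Longrightarrow> nu_cong m F F' \<Longrightarrow> nu_cong m G G' \<Longrightarrow> nu_cong m (B F G) (B F' G')"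
  unfolding nu_cong_iff by (auto intro: nu_bilinear_nth_cong)

lemma fps_X_dvd_diff_iff: "fps_X dvd F - (G :: 'b::comm_ring_1 fps) \<longleftrightarrow> F $ 0 = G $ 0"
  using fps_X_power_dvd_iff[of 1 "F - G"] by simp

lemma scalar_X_power: "scalar (fps_X ^ k) = fps_X ^ k"
proof (induction k)
  case 0
  show ?case by (rule fps_ext) (simp add: scalar_def)
qed (simp add: scalar_mult scalar_fps_X)

text \<open>The conditions of \<open>order_equivalent\<close> apart from the brackets, separated so
  that they can be composed and inverted; \<open>nu_auto\<close> does the same for
  \<open>equivalent_deformations\<close>.\<close>

definition nu_morph :: "nat \<Rightarrow> ('a::field_char_0 poly3 fps \<Rightarrow> 'a poly3 fps) \<Rightarrow> bool" where
  "nu_morph m \<Phi> \<longleftrightarrow>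
     (\<forall>F G. nu_cong m F G \<longrightarrow> nu_cong m (\<Phi> F) (\<Phi> G)) \<and>
     (\<forall>F G. nu_cong m (\<Phi> (F + G)) (\<Phi> F + \<Phi> G)) \<and>
     (\<forall>s F. nu_cong m (\<Phi> (scalar s * F)) (scalar s * \<Phi> F)) \<and>
     (\<forall>F G. nu_cong m (\<Phi> (F * G)) (\<Phi> F * \<Phi> G)) \<and>
     nu_cong m (\<Phi> 1) 1 \<and> (\<forall>F. fps_X dvd \<Phi> F - F)"

definition nu_auto :: "('a::field_char_0 poly3 fps \<Rightarrow> 'a poly3 fps) \<Rightarrow> bool" where
  "nu_auto \<Phi> \<longleftrightarrow>
     (\<forall>F G. \<Phi> (F + G) = \<Phi> F + \<Phi> G) \<and> (\<forall>s F. \<Phi> (scalar s * F) = scalar s * \<Phi> F) \<and>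
     (\<forall>F G. \<Phi> (F * G) = \<Phi> F * \<Phi> G) \<and> \<Phi> 1 = 1 \<and> (\<forall>F. fps_X dvd \<Phi> F - F)"

lemma nu_morphD:
  assumes "nu_morph m \<Phi>"
  shows "nu_cong m F G \<Longrightarrow> nu_cong m (\<Phi> F) (\<Phi> G)" "nu_cong m (\<Phi> (F + G)) (\<Phi> F + \<Phi> G)"
    "nu_cong m (\<Phi> (scalar s * F)) (scalar s * \<Phi> F)" "nu_cong m (\<Phi> (F * G)) (\<Phi> F * \<Phi> G)"
    "nu_cong m (\<Phi> 1) 1" "\<Phi> F $ 0 = F $ 0" "nu_cong m (\<Phi> (fps_X ^ k * F)) (fps_X ^ k * \<Phi> F)"
proof -
  show "nu_cong m F G \<Longrightarrow> nu_cong m (\<Phi> F) (\<Phi> G)" "nu_cong m (\<Phi> (F + G)) (\<Phi> F + \<Phi> G)"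
    "nu_cong m (\<Phi> (scalar s * F)) (scalar s * \<Phi> F)" "nu_cong m (\<Phi> (F * G)) (\<Phi> F * \<Phi> G)"
    "nu_cong m (\<Phi> 1) 1" for s
    using assms unfolding nu_morph_def by blast+
  from this(3)[of "fps_X ^ k"] show "nu_cong m (\<Phi> (fps_X ^ k * F)) (fps_X ^ k * \<Phi> F)"
    by (simp add: scalar_X_power)
  show "\<Phi> F $ 0 = F $ 0" using assms by (simp add: nu_morph_def fps_X_dvd_diff_iff)
qed

lemma nu_autoD:
  assumes "nu_auto \<Phi>"
  shows "\<Phi> (F + G) = \<Phi> F + \<Phi> G" "\<Phi> (scalar s * F) = scalar s * \<Phi> F" "\<Phi> (F * G) = \<Phi> F * \<Phi> G"
    "\<Phi> 1 = 1" "\<Phi> F $ 0 = F $ 0" "\<Phi> 0 = 0" "\<Phi> (- F) = - \<Phi> F" "\<Phi> (F - G) = \<Phi> F - \<Phi> G" "\<Phi> (scalar s) = scalar s"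
proof -
  show add: "\<Phi> (F + G) = \<Phi> F + \<Phi> G" and sc: "\<Phi> (scalar s * F) = scalar s * \<Phi> F"
    and "\<Phi> (F * G) = \<Phi> F * \<Phi> G" and 1: "\<Phi> 1 = 1" for F G
    using assms unfolding nu_auto_def by blast+
  show "\<Phi> F $ 0 = F $ 0" using assms by (simp add: nu_auto_def fps_X_dvd_diff_iff)
  show z: "\<Phi> 0 = 0" using add[of 0 0] by simp
  show neg: "\<Phi> (- F) = - \<Phi> F" for F using add[of F "- F"] by (simp add: z eq_neg_iff_add_eq_0 add.commute)
  show "\<Phi> (F - G) = \<Phi> F - \<Phi> G" using add[of F "- G"] by (simp add: neg)
  show "\<Phi> (scalar s) = scalar s" using sc[of 1] by (simp add: 1)
qed

text \<open>Linearity over \<nu> makes \<open>\<Phi>\<close> respect congruences. Formal and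
  truncated uniqueness can therefore share one argument.\<close>

lemma nu_auto_imp_morph:
  assumes "nu_auto \<Phi>"
  shows "nu_morph m \<Phi>"
proof -
  have "nu_cong m (\<Phi> F) (\<Phi> G)" if FG: "nu_cong m F G" for F G
  proof -
    obtain U where "F - G = fps_X ^ (m + 1) * U" using FG unfolding nu_cong_def dvd_def by blast
    then have "F = G + scalar (fps_X ^ (m + 1)) * U"
      unfolding scalar_X_power by (metis add.commute diff_add_cancel)
    then have "\<Phi> F - \<Phi> G = scalar (fps_X ^ (m + 1)) * \<Phi> U"
      by (simp only: nu_autoD(1,2)[OF assms] add_diff_cancel_left')
    then have "\<Phi> F - \<Phi> G = fps_X ^ (m + 1) * \<Phi> U" by (simp only: scalar_X_power)
    then show ?thesis unfolding nu_cong_def by simp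
  qed
  then show ?thesis using assms by (simp add: nu_morph_def nu_autoD[OF assms] nu_auto_def)
qed

text \<open>Being the identity modulo \<nu>, \<open>\<Phi>\<close> keeps the lowest coefficient of F
  - G, so no such coefficient can occur up to order \<open>m\<close>.\<close>

lemma nu_morph_inj:
  assumes \<Phi>: "nu_morph m \<Phi>" and FG: "nu_cong m (\<Phi> F) (\<Phi> G)"
  shows "nu_cong m F G"
proof -
  have "nu_cong m (\<Phi> (G + (F - G))) (\<Phi> G + \<Phi> (F - G))" by (rule nu_morphD(2)[OF \<Phi>])
  then have H: "\<Phi> (F - G) $ k = 0" if "k \<le> m" for k
    using FG that by (simp add: nu_cong_iff)
  have claim: "fps_X ^ k dvd F - G" if "k \<le> Suc m" for k
    using that
  proof (induction k)
    case (Suc k)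
    then obtain U where U: "F - G = fps_X ^ k * U" by (auto elim: dvdE)
    have "nu_cong m (\<Phi> (fps_X ^ k * U)) (fps_X ^ k * \<Phi> U)" by (rule nu_morphD(7)[OF \<Phi>])
    then have "(fps_X ^ k * \<Phi> U) $ k = 0" using H[of k] Suc.prems unfolding U by (simp add: nu_cong_iff)
    then have "U $ 0 = 0" by (simp add: fps_X_power_mult_nth nu_morphD(6)[OF \<Phi>])
    then have "(F - G) $ k = 0" unfolding U by (simp add: fps_X_power_mult_nth)
    moreover have "\<forall>j<k. (F - G) $ j = 0" using Suc by (simp only: fps_X_power_dvd_iff) simp
    ultimately show ?case unfolding fps_X_power_dvd_iff less_Suc_eq by blast
  qed simp
  show ?thesis using claim[of "Suc m"] by (simp add: nu_cong_def)
qed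

text \<open>Adding \<nu>^k c to the argument changes the value by c in order k and not at all
  below.\<close>

lemma nu_morph_surj:
  assumes \<Phi>: "nu_morph m \<Phi>"
  shows "\<exists>F. nu_cong m (\<Phi> F) G"
proof -
  have "\<exists>F. \<forall>j<k. \<Phi> F $ j = G $ j" if "k \<le> Suc m" for k
    using that
  proof (induction k)
    case (Suc k)
    then obtain F where F: "\<forall>j<k. \<Phi> F $ j = G $ j" by auto
    define c where "c = G $ k - \<Phi> F $ k"
    have "nu_cong m (\<Phi> (F + fps_X ^ k * fps_const c)) (\<Phi> F + \<Phi> (fps_X ^ k * fps_const c))"
      by (rule nu_morphD(2)[OF \<Phi>])
    moreover have "nu_cong m (\<Phi> (fps_X ^ k * fps_const c)) (fps_X ^ k * \<Phi> (fps_const c))"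
      by (rule nu_morphD(7)[OF \<Phi>])
    ultimately have "\<Phi> (F + fps_X ^ k * fps_const c) $ j = \<Phi> F $ j + (fps_X ^ k * \<Phi> (fps_const c)) $ j"
      if "j \<le> m" for j using that by (simp add: nu_cong_iff)
    then have "\<Phi> (F + fps_X ^ k * fps_const c) $ j = G $ j" if "j < Suc k" for j
      using that F Suc.prems
      by (cases "j = k") (simp_all add: fps_X_power_mult_nth nu_morphD(6)[OF \<Phi>] c_def)
    then show ?case by blast
  qed simp
  from this[of "Suc m"] show ?thesis by (simp add: nu_cong_iff less_Suc_eq_le)
qed

lemma nu_morph_inverse:
  assumes \<Phi>: "nu_morph m \<Phi>"
  obtains \<Psi> where "nu_morph m \<Psi>" "\<And>F. nu_cong m (\<Phi> (\<Psi> F)) F" "\<And>F. nu_cong m (\<Psi> (\<Phi> F)) F"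
proof -
  obtain \<Psi> where inv: "nu_cong m (\<Phi> (\<Psi> F)) F" for F using nu_morph_surj[OF \<Phi>] by metis
  note inj = nu_morph_inj[OF \<Phi>] and D = nu_morphD[OF \<Phi>] and sym = nu_cong_sym and trans = nu_cong_trans
  have "nu_cong m (\<Psi> (F + G)) (\<Psi> F + \<Psi> G)" for F G
    by (rule inj) (meson inv D(2) sym trans nu_cong_add)
  moreover have "nu_cong m (\<Psi> (F * G)) (\<Psi> F * \<Psi> G)" for F G
    by (rule inj) (meson inv D(4) sym trans nu_cong_mult)
  moreover have "nu_cong m (\<Psi> (scalar s * F)) (scalar s * \<Psi> F)" for s F
    by (rule inj) (meson inv D(3) sym trans nu_cong_mult nu_cong_refl)
  moreover have "nu_cong m (\<Psi> F) (\<Psi> G)" if "nu_cong m F G" for F G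
    by (rule inj) (meson inv that sym trans)
  moreover have "nu_cong m (\<Psi> 1) 1" by (rule inj) (meson inv D(5) sym trans)
  moreover have "\<Psi> F $ 0 = F $ 0" for F
    using inv[of F] D(6)[of "\<Psi> F"] by (simp add: nu_cong_iff)
  ultimately have "nu_morph m \<Psi>" by (simp add: nu_morph_def fps_X_dvd_diff_iff)
  moreover have "nu_cong m (\<Psi> (\<Phi> F)) F" for F by (rule inj) (rule inv)
  ultimately show ?thesis using that inv by blast
qed

lemma nu_morph_comp:
  assumes "nu_morph m \<Phi>" "nu_morph m \<Psi>"
  shows "nu_morph m (\<Phi> \<circ> \<Psi>)"
proof -
  note P = nu_morphD[OF assms(1)] and Q = nu_morphD[OF assms(2)]
  have "nu_cong m (\<Phi> (\<Psi> (F + G))) (\<Phi> (\<Psi> F) + \<Phi> (\<Psi> G))" for F G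
    using P(1)[OF Q(2)] P(2) nu_cong_trans by blast
  moreover have "nu_cong m (\<Phi> (\<Psi> (F * G))) (\<Phi> (\<Psi> F) * \<Phi> (\<Psi> G))" for F G
    using P(1)[OF Q(4)] P(4) nu_cong_trans by blast
  moreover have "nu_cong m (\<Phi> (\<Psi> (scalar s * G))) (scalar s * \<Phi> (\<Psi> G))" for s G
    using P(1)[OF Q(3)] P(3) nu_cong_trans by blast
  moreover have "nu_cong m (\<Phi> (\<Psi> 1)) 1" using P(1)[OF Q(5)] P(5) nu_cong_trans by blast
  ultimately show ?thesis by (simp add: nu_morph_def fps_X_dvd_diff_iff P Q)
qed

lemma nu_auto_comp: "nu_auto \<Phi> \<Longrightarrow> nu_auto \<Psi> \<Longrightarrow> nu_auto (\<Phi> \<circ> \<Psi>)"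
  unfolding nu_auto_def fps_X_dvd_diff_iff o_apply by (elim conjE, intro conjI allI) metis+

lemma nu_auto_inverse:
  assumes \<Phi>: "nu_auto \<Phi>"
  obtains \<Psi> where "nu_auto \<Psi>" "\<And>F. \<Phi> (\<Psi> F) = F" "\<And>F. \<Psi> (\<Phi> F) = F"
proof -
  note M = nu_auto_imp_morph[OF \<Phi>] and D = nu_autoD[OF \<Phi>]
  have inj: "F = G" if "\<Phi> F = \<Phi> G" for F G
  proof (rule fps_ext)
    show "F $ n = G $ n" for n using nu_morph_inj[OF M, of n F G] that by (simp add: nu_cong_iff)
  qed
  have "\<exists>F. \<Phi> F = G" for G
  proof -
    have "\<forall>m. \<exists>F. nu_cong m (\<Phi> F) G" using nu_morph_surj[OF M] by blast
    then obtain S where S: "nu_cong m (\<Phi> (S m)) G" for m by metis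
    \<comment> \<open>By injectivity the solutions modulo successive powers of \<nu> are compatible,
      so the diagonal collects them into one series.\<close>
    define F where "F = Abs_fps (\<lambda>k. S k $ k)"
    have "nu_cong m F (S m)" for m
      unfolding nu_cong_iff
    proof (intro allI impI)
      fix j assume j: "j \<le> m"
      have "nu_cong j (\<Phi> (S m)) G" using S[of m] j by (auto simp: nu_cong_iff)
      then have "nu_cong j (S m) (S j)"
        using nu_morph_inj[OF M] S[of j] nu_cong_sym nu_cong_trans by blast
      then show "F $ j = S m $ j" by (simp add: F_def nu_cong_iff)
    qed
    then have "nu_cong m (\<Phi> F) G" for m using nu_morphD(1)[OF M] S nu_cong_trans by blast
    then have "\<Phi> F = G" by (intro fps_ext) (auto simp: nu_cong_iff)
    then show ?thesis ..
  qed
  then obtain \<Psi> where inv: "\<Phi> (\<Psi> F) = F" for F by metis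
  have "\<Psi> F $ 0 = F $ 0" for F using D(5)[of "\<Psi> F"] inv by simp
  moreover have "\<Psi> (F + G) = \<Psi> F + \<Psi> G" for F G by (rule inj) (simp add: D(1) inv)
  moreover have "\<Psi> (scalar s * F) = scalar s * \<Psi> F" for s F by (rule inj) (simp only: D(2) inv)
  moreover have "\<Psi> (F * G) = \<Psi> F * \<Psi> G" for F G by (rule inj) (simp add: D(3) inv)
  moreover have "\<Psi> 1 = 1" by (rule inj) (simp add: D(4) inv)
  ultimately have "nu_auto \<Psi>"
    unfolding nu_auto_def fps_X_dvd_diff_iff by blast
  moreover have "\<Psi> (\<Phi> F) = F" for F by (rule inj) (rule inv)
  ultimately show ?thesis using that inv by blast
qed

text \<open>A gauge transform of a biderivation is a biderivation, hence again some
  \<open>vb\<close> by \<open>nu_bider_eq_vb\<close>, so normalisation never leaves the vector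
  fields.\<close>

lemma nu_bider_transport:
  assumes \<Phi>: "nu_auto \<Phi>" and B: "nu_bider B"
  obtains B' where "nu_bider B'" "\<And>F G. \<Phi> (B F G) = B' (\<Phi> F) (\<Phi> G)"
proof -
  obtain \<Psi> where \<Psi>: "nu_auto \<Psi>" and inv: "\<And>F. \<Phi> (\<Psi> F) = F" "\<And>F. \<Psi> (\<Phi> F) = F"
    using nu_auto_inverse[OF \<Phi>] by blast
  have skew: "B F G = - B G F" for F G using B unfolding nu_bider_def by blast
  have der: "nu_derivation (B F)" for F using B unfolding nu_bider_def by blast
  define B' where "B' F G = \<Phi> (B (\<Psi> F) (\<Psi> G))" for F G
  have "B' F G = - B' G F" for F G
    unfolding B'_def by (subst skew) (rule nu_autoD(7)[OF \<Phi>])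
  moreover have "nu_derivation (B' F)" for F
  proof -
    have s: "B' F (scalar s) = 0" for s
      unfolding B'_def nu_autoD(9)[OF \<Psi>] nu_derivation_scalar[OF der] by (rule nu_autoD(6)[OF \<Phi>])
    show ?thesis
      using s[of fps_X] s[of "fps_const _"] der[of "\<Psi> F"]
      by (simp add: scalar_fps_X scalar_const nu_derivation_def B'_def nu_autoD[OF \<Phi>] nu_autoD[OF \<Psi>] inv)
  qed
  ultimately have "nu_bider B'" unfolding nu_bider_def by blast
  then show ?thesis using that[of B'] by (simp add: B'_def inv)
qed

section \<open>Exponentials of derivations divisible by \<nu>\<close>

definition dpow :: "('a::field_char_0 poly3 fps \<Rightarrow> 'a poly3 fps) \<Rightarrow> nat \<Rightarrow> 'a poly3 fps \<Rightarrow> 'a poly3 fps" where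
  "dpow D j F = fps_const (cst (1 / fact j)) * (D ^^ j) F"

text \<open>The cut at j \<le> k is exact for derivations divisible by \<nu>, since D^j then starts
  in order j.\<close>

definition nu_exp :: "('a::field_char_0 poly3 fps \<Rightarrow> 'a poly3 fps) \<Rightarrow> 'a poly3 fps \<Rightarrow> 'a poly3 fps" where
  "nu_exp D F = Abs_fps (\<lambda>k. \<Sum>j\<le>k. dpow D j F $ k)"

locale nilpotent_derivation =
  fixes D :: "'a::field_char_0 poly3 fps \<Rightarrow> 'a poly3 fps"
  assumes D: "nu_derivation D" and D_dvd: "\<And>F. fps_X dvd D F"
begin

lemma D_simps: "D (F + G) = D F + D G" "D (F * G) = F * D G + D F * G" "D (scalar s) = 0"
  using D nu_derivation_scalar[OF D] by (auto simp: nu_derivation_def)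

lemma D_scalar: "D (scalar s * F) = scalar s * D F"
  by (simp add: D_simps)

lemma D_sum: "D (sum f A) = (\<Sum>i\<in>A. D (f i))"
proof -
  have "D 0 = 0" using D_simps(1)[of 0 0] by simp
  then show ?thesis by (induction A rule: infinite_finite_induct) (simp_all add: D_simps)
qed

text \<open>The first factor contributes n + 1 orders and every further one at least one. In
  particular D^2 starts in order n + 2, so the coefficient of order n + 1 of the exponential is
  linear in D.\<close>

lemma D_power_dvd: 
  assumes "\<And>F. fps_X ^ Suc n dvd D F"
  shows "fps_X ^ (n + Suc j) dvd (D ^^ Suc j) F"
proof (induction j)
  case 0
  then show ?case using assms by simp
next
  case (Suc j)
  then obtain U where "(D ^^ Suc j) F = fps_X ^ (n + Suc j) * U" by (elim dvdE)
  then have "(D ^^ Suc (Suc j)) F = D (scalar (fps_X ^ (n + Suc j)) * U)"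
    by (simp only: funpow.simps o_apply scalar_X_power)
  also have "\<dots> = fps_X ^ (n + Suc j) * D U" by (subst D_scalar) (simp only: scalar_X_power)
  also have "fps_X ^ (n + Suc (Suc j)) dvd \<dots>"
    using mult_dvd_mono[OF dvd_refl D_dvd, of "fps_X ^ (n + Suc j)" U] by (simp add: mult.commute)
  finally show ?case .
qed

lemma dpow_nth_0: "k < j \<Longrightarrow> dpow D j F $ k = 0"
proof (cases j)
  case (Suc i)
  assume "k < j"
  moreover have "fps_X ^ (0 + Suc i) dvd (D ^^ Suc i) F" by (rule D_power_dvd) (simp add: D_dvd)
  ultimately show ?thesis using Suc by (simp add: dpow_def fps_X_power_dvd_iff del: funpow.simps power_Suc)
qed simp

lemma dpow_0: "dpow D 0 F = F"
  by (simp add: dpow_def)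

lemma dpow_Suc: "of_nat (Suc j) * dpow D (Suc j) F = D (dpow D j F)"
proof -
  have "D (dpow D j F) = fps_const (cst (1 / fact j)) * (D ^^ Suc j) F"
    unfolding dpow_def scalar_const[symmetric] D_scalar by simp
  moreover have "of_nat (Suc j) * fps_const (cst (1 / fact (Suc j))) = fps_const (cst (1 / fact j :: 'a))"
  proof -
    have "cst (1 / fact j :: 'a) = cst (of_nat (Suc j) * (1 / fact (Suc j)))"
      by (simp add: field_simps del: of_nat_Suc)
    also have "\<dots> = of_nat (Suc j) * cst (1 / fact (Suc j))" by (simp only: cst_simps cst_of_nat)
    finally show ?thesis by (simp add: fps_of_nat[symmetric] del: of_nat_Suc fps_of_nat)
  qed
  ultimately show ?thesis unfolding dpow_def mult.assoc[symmetric] by simp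
qed

lemma dpow_add: "dpow D j (F + G) = dpow D j F + dpow D j G"
proof -
  have "(D ^^ j) (F + G) = (D ^^ j) F + (D ^^ j) G" by (induction j) (simp_all add: D_simps)
  then show ?thesis by (simp add: dpow_def algebra_simps)
qed

lemma dpow_scalar: "dpow D j (scalar s * F) = scalar s * dpow D j F"
proof -
  have "(D ^^ j) (scalar s * F) = scalar s * (D ^^ j) F" by (induction j) (simp_all add: D_scalar)
  then show ?thesis by (simp add: dpow_def algebra_simps)
qed

text \<open>Divided powers make the Leibniz rule free of binomial coefficients. The induction
  compares both sides after multiplication by n + 1.\<close>

lemma dpow_leibniz:
  assumes B: "nu_bilinear B" and DB: "\<And>F G. D (B F G) = B (D F) G + B F (D G)"
  shows "dpow D n (B F G) = (\<Sum>i\<le>n. B (dpow D i F) (dpow D (n - i) G))"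
proof (induction n)
  case (Suc n)
  have nat: "B (of_nat k * F) G = of_nat k * B F G" "B F (of_nat k * G) = of_nat k * B F G" for k F G
  proof -
    have z: "B 0 G = 0" "B F 0 = 0" for F G
      using nu_bilinear_diff[OF B, of 0 0 G] nu_bilinear_diff(2)[OF B, of F 0 0] by simp_all
    show "B (of_nat k * F) G = of_nat k * B F G" "B F (of_nat k * G) = of_nat k * B F G"
      using B by (induction k; simp add: nu_bilinear_def z algebra_simps)+
  qed
  define t where "t i = B (dpow D i F) (dpow D (Suc n - i) G)" for i
  have "of_nat (Suc n) * dpow D (Suc n) (B F G) = D (\<Sum>i\<le>n. B (dpow D i F) (dpow D (n - i) G))"
    by (simp only: dpow_Suc Suc)
  also have "\<dots> = (\<Sum>i\<le>n. of_nat (Suc i) * t (Suc i)) + (\<Sum>i\<le>n. of_nat (Suc n - i) * t i)"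
  proof -
    have "D (B (dpow D i F) (dpow D (n - i) G)) = of_nat (Suc i) * t (Suc i) + of_nat (Suc n - i) * t i"
      if "i \<le> n" for i
      unfolding DB dpow_Suc[symmetric] nat t_def using that by (simp add: Suc_diff_le)
    then show ?thesis unfolding D_sum sum.distrib[symmetric] by (intro sum.cong) auto
  qed
  also have "(\<Sum>i\<le>n. of_nat (Suc i) * t (Suc i)) = (\<Sum>i\<le>Suc n. of_nat i * t i)"
    by (simp add: sum.atMost_Suc_shift del: sum.atMost_Suc)
  also have "(\<Sum>i\<le>n. of_nat (Suc n - i) * t i) = (\<Sum>i\<le>Suc n. of_nat (Suc n - i) * t i)"
    by simp
  also have "(\<Sum>i\<le>Suc n. of_nat i * t i) + (\<Sum>i\<le>Suc n. of_nat (Suc n - i) * t i) = (\<Sum>i\<le>Suc n. of_nat (Suc n) * t i)"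
    unfolding sum.distrib[symmetric]
  proof (intro sum.cong refl)
    fix i assume "i \<in> {..Suc n}"
    then have "Suc n = i + (Suc n - i)" by simp
    then show "of_nat i * t i + of_nat (Suc n - i) * t i = of_nat (Suc n) * t i"
      by (metis distrib_right of_nat_add)
  qed
  finally have "of_nat (Suc n) * dpow D (Suc n) (B F G) = of_nat (Suc n) * (\<Sum>i\<le>Suc n. t i)"
    by (simp only: sum_distrib_left)
  then show ?case by (simp only: mult_cancel_left of_nat_eq_0_iff t_def) simp
qed (simp add: dpow_0)

lemma nu_exp_nth:
  assumes "k \<le> N"
  shows "nu_exp D F $ k = (\<Sum>j\<le>N. dpow D j F) $ k"
proof -
  have "(\<Sum>j\<le>N. dpow D j F $ k) = (\<Sum>j\<le>k. dpow D j F $ k)"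
    by (rule sum.mono_neutral_right) (use assms dpow_nth_0 in auto)
  then show ?thesis by (simp add: nu_exp_def fps_sum_nth)
qed

text \<open>The exponential preserves every operation of which D is a derivation: for the product
  this gives an automorphism of algebras, for a bracket a symmetry of that bracket.\<close>

lemma nu_exp_bilinear:
  assumes B: "nu_bilinear B" and DB: "\<And>F G. D (B F G) = B (D F) G + B F (D G)"
  shows "nu_exp D (B F G) = B (nu_exp D F) (nu_exp D G)"
proof (rule fps_ext)
  fix k
  define t where "t i j = B (dpow D i F) (dpow D j G)" for i j
  have t0: "t i j $ k = 0" if "k < i + j" for i j
  proof -
    have dv: "fps_X ^ j dvd dpow D j F" for j F
      unfolding fps_X_power_dvd_iff using dpow_nth_0 by blast
    then obtain U V where "dpow D i F = fps_X ^ i * U" "dpow D j G = fps_X ^ j * V" by (metis dvdE)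
    then have "t i j = fps_X ^ (i + j) * B U V"
      by (simp add: t_def nu_bilinear_X_power[OF B] power_add mult.assoc)
    then show ?thesis using that by (simp add: fps_X_power_mult_nth)
  qed
  have "B (nu_exp D F) (nu_exp D G) $ k = B (\<Sum>i\<le>k. dpow D i F) (\<Sum>j\<le>k. dpow D j G) $ k"
    by (rule nu_bilinear_nth_cong[OF B]) (simp_all add: nu_exp_nth)
  also have "\<dots> = (\<Sum>i\<le>k. \<Sum>j\<le>k. t i j $ k)"
    by (simp add: nu_bilinear_sum[OF B] fps_sum_nth t_def) (rule sum.swap)
  also have "\<dots> = (\<Sum>(i, j)\<in>{..k} \<times> {..k}. t i j $ k)" by (rule sum.cartesian_product)
  \<comment> \<open>Terms with i + j > k start beyond order k, so the square may be replaced by the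
    triangle.\<close>
  also have "\<dots> = (\<Sum>(i, j)\<in>{(i, j). i + j \<le> k}. t i j $ k)"
    by (rule sum.mono_neutral_right) (auto, metis t0 not_le)
  also have "\<dots> = (\<Sum>n\<le>k. \<Sum>i\<le>n. t i (n - i) $ k)" by (rule sum.triangle_reindex_eq)
  also have "\<dots> = nu_exp D (B F G) $ k"
    by (simp add: nu_exp_nth[OF order_refl] dpow_leibniz[OF B DB] fps_sum_nth t_def)
  finally show "nu_exp D (B F G) $ k = B (nu_exp D F) (nu_exp D G) $ k" ..
qed

lemma nu_exp_leading:
  assumes "\<And>F. fps_X ^ Suc n dvd D F" "k \<le> Suc n"
  shows "nu_exp D F $ k = F $ k + D F $ k"
proof -
  have "dpow D j F $ k = 0" if j: "j \<notin> {0, 1}" for j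
  proof -
    obtain i where i: "j = Suc (Suc i)" using j by (metis insertCI not0_implies_Suc One_nat_def)
    have "fps_X ^ (n + Suc (Suc i)) dvd (D ^^ Suc (Suc i)) F" by (rule D_power_dvd[OF assms(1)])
    then show ?thesis using assms(2) by (simp add: i dpow_def fps_X_power_dvd_iff del: funpow.simps power_Suc)
  qed
  then have "(\<Sum>j\<le>Suc n. dpow D j F $ k) = (\<Sum>j\<in>{0, 1}. dpow D j F $ k)"
    by (intro sum.mono_neutral_right) auto
  then show ?thesis using assms(2) by (simp add: nu_exp_nth[OF assms(2)] fps_sum_nth dpow_def)
qed

lemma nu_auto_exp: "nu_auto (nu_exp D)"
proof -
  have one: "nu_exp D 1 = 1"
  proof (rule fps_ext)
    fix k
    have D1: "D 1 = 0" using D_simps(2)[of 1 1] by simp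
    have D0: "D 0 = 0" using D_simps(1)[of 0 0] by simp
    have "dpow D (Suc j) 1 = 0" for j
    proof -
      have "(D ^^ j) (D 1) = 0" unfolding D1 by (induction j) (simp_all add: D0)
      then show ?thesis by (simp add: dpow_def funpow_swap1)
    qed
    then have "dpow D j 1 = 0" if "j \<noteq> 0" for j using that by (cases j) auto
    then have "(\<Sum>j\<le>k. dpow D j 1 $ k) = (\<Sum>j\<in>{0}. dpow D j 1 $ k)"
      by (intro sum.mono_neutral_right) auto
    then show "nu_exp D 1 $ k = 1 $ k" by (simp add: nu_exp_def dpow_0)
  qed
  have "nu_exp D (F + G) = nu_exp D F + nu_exp D G" for F G
    by (rule fps_ext) (simp add: nu_exp_def dpow_add sum.distrib)
  moreover have "nu_exp D (scalar s * F) = scalar s * nu_exp D F" for s F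
  proof (rule fps_ext)
    fix k
    have "(scalar s * nu_exp D F) $ k = (scalar s * (\<Sum>j\<le>k. dpow D j F)) $ k"
      by (rule nu_bilinear_nth_cong[OF nu_bilinear_mult]) (simp_all add: nu_exp_nth)
    also have "\<dots> = nu_exp D (scalar s * F) $ k"
      by (simp add: nu_exp_nth[OF order_refl] dpow_scalar sum_distrib_left)
    finally show "nu_exp D (scalar s * F) $ k = (scalar s * nu_exp D F) $ k" ..
  qed
  moreover have "nu_exp D (F * G) = nu_exp D F * nu_exp D G" for F G
    by (rule nu_exp_bilinear[OF nu_bilinear_mult]) (simp add: D_simps algebra_simps)
  moreover have "nu_exp D F $ 0 = F $ 0" for F
    by (simp add: nu_exp_def dpow_0)
  ultimately show ?thesis using one by (simp add: nu_auto_def fps_X_dvd_diff_iff)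
qed

end

section \<open>The family of representatives\<close>

lemma vb_const_nth:
  "vb Y1 Y2 Y3 (fps_const f) (fps_const g) $ n = Y1 $ n * (dy f * dz g - dz f * dy g)
    + Y2 $ n * (dz f * dx g - dx f * dz g) + Y3 $ n * (dx f * dy g - dy f * dx g)"
  by (simp add: vb_def fd_const)

lemma vb_vars:
  "vb Y1 Y2 Y3 (fps_const Yv) (fps_const Zv) = Y1" "vb Y1 Y2 Y3 (fps_const Zv) (fps_const Xv) = Y2"
  "vb Y1 Y2 Y3 (fps_const Xv) (fps_const Yv) = Y3"
  by (simp_all add: vb_def)

lemma biderivation_vb_nth: "biderivation (\<lambda>f g. vb Y1 Y2 Y3 (fps_const f) (fps_const g) $ n)"
  unfolding vb_const_nth biderivation_def derivation_def by (simp add: algebra_simps)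

lemma biderivation_eq:
  assumes "biderivation V"
  shows "V f g = V Yv Zv * (dy f * dz g - dz f * dy g) + V Zv Xv * (dz f * dx g - dx f * dz g)
    + V Xv Yv * (dx f * dy g - dy f * dx g)"
proof -
  have skew: "V f g = - V g f" for f g using assms unfolding biderivation_def by blast
  have der: "derivation (V f)" for f using assms unfolding biderivation_def by blast
  have diag: "V f f = 0" for f
  proof -
    have "V f f + V f f = 0" using skew[of f f] by (metis add.right_inverse)
    then have "2 * V f f = 0" by (simp only: mult_2)
    then show ?thesis by simp
  qed
  have chain: "V f g = V f Xv * dx g + V f Yv * dy g + V f Zv * dz g" for f g
    by (rule derivation_eq[OF der])
  have "V f g = - (V Xv f * dx g + V Yv f * dy g + V Zv f * dz g)"
    unfolding chain[of f g] skew[of f Xv] skew[of f Yv] skew[of f Zv] by simp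
  also have "\<dots> = V Yv Zv * (dy f * dz g - dz f * dy g) + V Zv Xv * (dz f * dx g - dx f * dz g)
    + V Xv Yv * (dx f * dy g - dy f * dx g)"
    unfolding chain[of _ f] diag skew[of Yv Xv] skew[of Zv Yv] skew[of Xv Zv] by (simp add: algebra_simps)
  finally show ?thesis .
qed

lemma formal_sum_biderivations:
  assumes "\<And>i. biderivation (\<pi> i)"
  shows "formal_sum \<pi> = vb (Abs_fps (\<lambda>n. \<pi> n Yv Zv)) (Abs_fps (\<lambda>n. \<pi> n Zv Xv)) (Abs_fps (\<lambda>n. \<pi> n Xv Yv))"
  by (rule formal_sum_eq[OF nu_bilinear_vb], subst biderivation_eq[OF assms]) (simp add: vb_const_nth)

lemma fd_X_power_mult:
  "fdx (fps_X ^ n * F) = fps_X ^ n * fdx F" "fdy (fps_X ^ n * F) = fps_X ^ n * fdy F"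
  "fdz (fps_X ^ n * F) = fps_X ^ n * fdz F"
  by (simp_all add: scalar_X_power[symmetric])

lemma fps_agree_below:
  assumes "\<And>k. k < n \<Longrightarrow> F $ k = (G $ k :: 'b::comm_ring_1)"
  obtains U where "F = G + fps_X ^ n * U" "U $ 0 = F $ n - G $ n"
proof -
  have "fps_X ^ n dvd F - G" using assms by (simp add: fps_X_power_dvd_iff)
  then obtain U where "F - G = fps_X ^ n * U" by (elim dvdE)
  then have F: "F = G + fps_X ^ n * U" by (metis add.commute diff_add_cancel)
  then have "U $ 0 = F $ n - G $ n" by (simp add: fps_X_power_mult_nth)
  then show ?thesis using that F by blast
qed

context singularity
begin

abbreviation E where "E \<equiv> E_index w1 w2 w3 d \<mu>"

definition famP :: "(nat \<Rightarrow> nat \<Rightarrow> nat \<Rightarrow> 'a) \<Rightarrow> 'a poly3 fps" where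
  "famP c = Abs_fps (\<lambda>n. \<Sum>(l, i)\<in>{(l, i). i \<in> E \<and> c n l i \<noteq> 0}. cst (c n l i) * \<phi> ^ l * u i)"

definition famQ :: "(nat \<Rightarrow> nat \<Rightarrow> 'a) \<Rightarrow> 'a poly3 fps" where
  "famQ cb = Abs_fps (\<lambda>n. if n = 0 then \<phi> else \<Sum>r\<in>{1..<\<mu>}. cst (cb n r) * u r)"

definition fam1 where "fam1 c cb = (1 + famP c) * fdx (famQ cb)"
definition fam2 where "fam2 c cb = (1 + famP c) * fdy (famQ cb)"
definition fam3 where "fam3 c cb = (1 + famP c) * fdz (famQ cb)"

lemmas fam_defs = fam1_def fam2_def fam3_def

abbreviation famB where "famB c cb \<equiv> vb (fam1 c cb) (fam2 c cb) (fam3 c cb)"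

lemma famP_0: "admissible \<mu> E c cb \<Longrightarrow> famP c $ 0 = 0"
  by (simp add: famP_def admissible_def)

lemma famQ_0: "famQ cb $ 0 = \<phi>"
  by (simp add: famQ_def)

lemma fam_0:
  assumes "admissible \<mu> E c cb"
  shows "fam1 c cb $ 0 = p1" "fam2 c cb $ 0 = p2" "fam3 c cb $ 0 = p3"
  by (simp_all add: fam_defs famP_0[OF assms] famQ_0)

text \<open>Expand (1 + P) \<nabla>Q at order n. Since P_0 = 0 and Q_0 = \<phi>, the factor 1 and
  the last term of the convolution give the two linear sums of \<open>pi_coeff\<close>, and the
  inner terms give the sum over a, b \<ge> 1.\<close>

lemma pi_coeff_eq_famB:
  assumes adm: "admissible \<mu> E c cb"
  shows "pi_coeff \<mu> E \<phi> u c cb n f g = famB c cb (fps_const f) (fps_const g) $ n"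
proof -
  define G where "G = vb (fdx (famQ cb)) (fdy (famQ cb)) (fdz (famQ cb)) (fps_const f) (fps_const g)"
  have br: "G $ b = bracket (famQ cb $ b) f g" for b
    by (simp add: G_def vb_const_nth bracket_def algebra_simps)
  have brQ: "bracket (famQ cb $ b) f g = (\<Sum>r\<in>{1..<\<mu>}. cst (cb b r) * bracket (u r) f g)" if "b > 0" for b
    using that
    by (simp add: famQ_def bracket_def d_sum sum_distrib_right sum.distrib[symmetric])
      (intro sum.cong refl, simp add: algebra_simps)
  have "famB c cb (fps_const f) (fps_const g) = (1 + famP c) * G"
    by (simp add: vb_def G_def fam_defs algebra_simps)
  then have *: "famB c cb (fps_const f) (fps_const g) $ n = G $ n + (\<Sum>i=0..n. famP c $ i * G $ (n - i))"
    by (simp add: distrib_right fps_mult_nth)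
  show ?thesis
  proof (cases "n = 0")
    case True
    then show ?thesis unfolding * by (simp add: pi_coeff_def famP_0[OF adm] br famQ_0)
  next
    case False
    have "{0..n} = insert 0 (insert n {1..<n})" using False by auto
    then have "(\<Sum>i=0..n. famP c $ i * G $ (n - i)) = famP c $ n * G $ 0 + (\<Sum>a\<in>{1..<n}. famP c $ a * G $ (n - a))"
      using False by (simp add: famP_0[OF adm])
    moreover have "(\<Sum>a\<in>{1..<n}. famP c $ a * G $ (n - a)) =
      (\<Sum>(a, b) \<in> {(a, b). 1 \<le> a \<and> 1 \<le> b \<and> a + b = n}. famP c $ a * G $ b)"
      by (rule sum.reindex_bij_witness[of _ fst "\<lambda>a. (a, n - a)"]) auto
    moreover have "\<dots> = (\<Sum>(a, b) \<in> {(a, b). 1 \<le> a \<and> 1 \<le> b \<and> a + b = n}.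
           \<Sum>(l, i) \<in> {(l, i). i \<in> E \<and> c a l i \<noteq> 0}.
             \<Sum>r \<in> {1..<\<mu>}. cst (c a l i * cb b r) * \<phi> ^ l * u i * bracket (u r) f g)"
    proof (intro sum.cong refl, clarify)
      fix a b :: nat assume "1 \<le> a" "1 \<le> b"
      then have "famP c $ a * G $ b = (\<Sum>(l, i) \<in> {(l, i). i \<in> E \<and> c a l i \<noteq> 0}. cst (c a l i) * \<phi> ^ l * u i)
          * (\<Sum>r\<in>{1..<\<mu>}. cst (cb b r) * bracket (u r) f g)"
        by (simp add: br brQ famP_def)
      also have "\<dots> = (\<Sum>(l, i) \<in> {(l, i). i \<in> E \<and> c a l i \<noteq> 0}.
             \<Sum>r \<in> {1..<\<mu>}. cst (c a l i * cb b r) * \<phi> ^ l * u i * bracket (u r) f g)"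
        unfolding sum_product
        by (intro sum.cong refl) (simp add: case_prod_unfold cst_simps algebra_simps)
      finally show "famP c $ a * G $ b = \<dots>" .
    qed
    moreover have "famP c $ n * G $ 0 = (\<Sum>(m, j) \<in> {(m, j). j \<in> E \<and> c n m j \<noteq> 0}. cst (c n m j) * \<phi> ^ m * u j * bracket \<phi> f g)"
      by (simp add: br famQ_0 famP_def sum_distrib_right case_prod_unfold)
    ultimately show ?thesis using False by (simp add: * pi_coeff_def br brQ)
  qed
qed

lemma formal_sum_pi_coeff: "admissible \<mu> E c cb \<Longrightarrow> formal_sum (pi_coeff \<mu> E \<phi> u c cb) = famB c cb"
  by (rule formal_sum_eq[OF nu_bilinear_vb pi_coeff_eq_famB])

lemma biderivation_pi_coeff:
  assumes "admissible \<mu> E c cb"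
  shows "biderivation (pi_coeff \<mu> E \<phi> u c cb n)"
proof -
  have "pi_coeff \<mu> E \<phi> u c cb n = (\<lambda>f g. famB c cb (fps_const f) (fps_const g) $ n)"
    by (intro ext pi_coeff_eq_famB assms)
  then show ?thesis by (simp only: biderivation_vb_nth)
qed

text \<open>The curl of (1 + P) \<nabla>Q is \<nabla>P \<times> \<nabla>Q, which is orthogonal to
  \<nabla>Q.\<close>

lemma famB_jacobi: "jac (famB c cb) F G K = 0"
  by (rule jacobi_from_generators[OF nu_bider_vb])
    (simp add: jac_vb_vars fam_defs fd_commute algebra_simps)

text \<open>If P and Q change only from order n on, the products of their changes with
  positive-order terms appear beyond order n. There remain the change of P times \<nabla>Q_0 =
  \<nabla>\<phi> and the gradient of the change of Q.\<close>

lemma fam_difference: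
  assumes adm: "admissible \<mu> E c cb" and eq: "\<And>k. k < n \<Longrightarrow> c' k = c k" "\<And>k. k < n \<Longrightarrow> cb' k = cb k"
    and n: "n > 0"
  shows "fam1 c' cb' $ n = fam1 c cb $ n + (famP c' $ n - famP c $ n) * p1 + dx (famQ cb' $ n - famQ cb $ n)"
    "fam2 c' cb' $ n = fam2 c cb $ n + (famP c' $ n - famP c $ n) * p2 + dy (famQ cb' $ n - famQ cb $ n)"
    "fam3 c' cb' $ n = fam3 c cb $ n + (famP c' $ n - famP c $ n) * p3 + dz (famQ cb' $ n - famQ cb $ n)"
proof -
  have "famP c' $ k = famP c $ k" "famQ cb' $ k = famQ cb $ k" if "k < n" for k
    using that eq by (simp_all add: famP_def famQ_def)
  then obtain U V where U: "famP c' = famP c + fps_X ^ n * U" "U $ 0 = famP c' $ n - famP c $ n"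
    and V: "famQ cb' = famQ cb + fps_X ^ n * V" "V $ 0 = famQ cb' $ n - famQ cb $ n"
    by (metis fps_agree_below)
  have "(1 + famP c') * fd (famQ cb') = (1 + famP c) * fd (famQ cb) + fps_X ^ n * ((1 + famP c) * fd V + U * fd (famQ cb'))"
    if "\<And>F G. fd (F + G) = fd F + fd G" "fd (fps_X ^ n * V) = fps_X ^ n * fd V" for fd
    unfolding U(1) V(1) that by (simp add: algebra_simps)
  from this[of fdx] this[of fdy] this[of fdz]
  show "fam1 c' cb' $ n = fam1 c cb $ n + (famP c' $ n - famP c $ n) * p1 + dx (famQ cb' $ n - famQ cb $ n)"
    "fam2 c' cb' $ n = fam2 c cb $ n + (famP c' $ n - famP c $ n) * p2 + dy (famQ cb' $ n - famQ cb $ n)"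
    "fam3 c' cb' $ n = fam3 c cb $ n + (famP c' $ n - famP c $ n) * p3 + dz (famQ cb' $ n - famQ cb $ n)"
    using famP_0[OF adm] unfolding U(2)[symmetric] V(2)[symmetric] fam_defs
    by (simp_all add: fd_X_power_mult fps_X_power_mult_nth famQ_0 del: fd_mult)
qed

lemma famP_nth:
  assumes "\<And>i. i \<notin> E \<Longrightarrow> \<forall>l. c n l i = 0" "\<And>l i. N \<le> l \<Longrightarrow> c n l i = 0"
  shows "famP c $ n = comb N (c n)"
proof -
  have "comb N (c n) = (\<Sum>(l, i)\<in>{..<N} \<times> {..<\<mu>}. cst (c n l i) * \<phi> ^ l * u i)"
    by (simp add: comb_def sum.cartesian_product)
  also have "\<dots> = (\<Sum>(l, i)\<in>{(l, i). i \<in> E \<and> c n l i \<noteq> 0}. cst (c n l i) * \<phi> ^ l * u i)"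
  proof (rule sum.mono_neutral_right)
    show "{(l, i). i \<in> E \<and> c n l i \<noteq> 0} \<subseteq> {..<N} \<times> {..<\<mu>}"
    proof
      fix x assume "x \<in> {(l, i). i \<in> E \<and> c n l i \<noteq> 0}"
      then obtain l i where x: "x = (l, i)" "i \<in> E" "c n l i \<noteq> 0" by blast
      then have "i < \<mu>" by (auto simp: E_index_def split: if_splits)
      moreover have "l < N" using assms(2)[of l i] x by (metis not_le)
      ultimately show "x \<in> {..<N} \<times> {..<\<mu>}" using x by simp
    qed
    have "i \<in> E \<or> c n l i = 0" for l i using assms(1) by blast
    then show "\<forall>x\<in>{..<N} \<times> {..<\<mu>} - {(l, i). i \<in> E \<and> c n l i \<noteq> 0}.
        (case x of (l, i) \<Rightarrow> cst (c n l i) * \<phi> ^ l * u i) = 0"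
      by (auto; blast)
  qed simp
  finally show ?thesis by (simp add: famP_def)
qed

lemma admissible_famP:
  assumes "admissible \<mu> E c cb"
  obtains N where "famP c $ n = comb N (c n)" "\<And>l i. N \<le> l \<Longrightarrow> c n l i = 0"
proof -
  have fin: "finite {(l, i). c n l i \<noteq> 0}"
  proof (cases "n = 0")
    case True
    then show ?thesis using assms by (simp add: admissible_def)
  next
    case False
    then show ?thesis using assms unfolding admissible_def by (metis One_nat_def Suc_leI neq0_conv)
  qed
  define N where "N = Suc (Max (fst ` {(l, i). c n l i \<noteq> 0}))"
  have "c n l i = 0" if "N \<le> l" for l i
  proof (rule ccontr)
    assume "c n l i \<noteq> 0"
    then have "l \<in> fst ` {(l, i). c n l i \<noteq> 0}" by force
    then have "l \<le> Max (fst ` {(l, i). c n l i \<noteq> 0})" using fin by simp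
    then show False using that by (simp add: N_def)
  qed
  moreover from this have "famP c $ n = comb N (c n)"
    by (intro famP_nth) (use assms in \<open>auto simp: admissible_def\<close>)
  ultimately show ?thesis using that by blast
qed

section \<open>Gauge transformations\<close>

text \<open>Let T be the coefficient of order n of \<open>\<Phi>\<close> on polynomials.
  Multiplicativity in order n makes T a derivation, given by the field X, and compatibility with the
  brackets in order n says that they differ there by the Lie derivative of \<nabla>\<phi> along
  X.\<close>

lemma gauge_coefficient:
  assumes \<Phi>: "nu_morph m \<Phi>" and n: "0 < n" "n \<le> m" and id: "\<And>F k. k < n \<Longrightarrow> \<Phi> F $ k = F $ k"
    and Y: "Y1 $ 0 = p1" "Y2 $ 0 = p2" "Y3 $ 0 = p3" and Z: "Z1 $ 0 = p1" "Z2 $ 0 = p2" "Z3 $ 0 = p3"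
    and eq: "\<And>F G. nu_cong m (\<Phi> (vb Y1 Y2 Y3 F G)) (vb Z1 Z2 Z3 (\<Phi> F) (\<Phi> G))"
  defines "X1 \<equiv> \<Phi> (fps_const Xv) $ n" and "X2 \<equiv> \<Phi> (fps_const Yv) $ n" and "X3 \<equiv> \<Phi> (fps_const Zv) $ n"
  shows "\<Phi> F $ n = F $ n + (X1 * dx (F $ 0) + X2 * dy (F $ 0) + X3 * dz (F $ 0))"
    and "Z1 $ n = Y1 $ n + cob_x X1 X2 X3" "Z2 $ n = Y2 $ n + cob_y X1 X2 X3" "Z3 $ n = Y3 $ n + cob_z X1 X2 X3"
    and "k < n \<Longrightarrow> Z1 $ k = Y1 $ k" "k < n \<Longrightarrow> Z2 $ k = Y2 $ k" "k < n \<Longrightarrow> Z3 $ k = Y3 $ k"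
proof -
  note M = nu_morphD[OF \<Phi>]
  define T where "T f = \<Phi> (fps_const f) $ n" for f
  \<comment> \<open>On \<nu> F' only the coefficient of order n - 1 of \<open>\<Phi>\<close>
    matters, and there it is the identity.\<close>
  have lead: "\<Phi> F $ n = F $ n + T (F $ 0)" for F
  proof -
    have F: "F = fps_const (F $ 0) + fps_X ^ 1 * fps_shift 1 F"
      by (intro fps_ext) (simp add: fps_X_mult_nth)
    have "nu_cong m (\<Phi> F) (\<Phi> (fps_const (F $ 0)) + \<Phi> (fps_X ^ 1 * fps_shift 1 F))"
      using M(2)[of "fps_const (F $ 0)" "fps_X ^ 1 * fps_shift 1 F"] F by simp
    then have "\<Phi> F $ n = \<Phi> (fps_const (F $ 0)) $ n + \<Phi> (fps_X ^ 1 * fps_shift 1 F) $ n"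
      using n by (simp add: nu_cong_iff)
    also have "\<Phi> (fps_X ^ 1 * fps_shift 1 F) $ n = (fps_X ^ 1 * \<Phi> (fps_shift 1 F)) $ n"
      using M(7)[of 1 "fps_shift 1 F"] n by (simp only: nu_cong_iff) 
    also have "\<dots> = F $ n" using n id[of "n - 1" "fps_shift 1 F"] by (simp add: fps_X_mult_nth)
    finally show ?thesis by (simp add: T_def)
  qed
  have nth: "\<Phi> (fps_const f) $ k = (fps_const f + fps_X ^ n * fps_const (T f)) $ k" if "k \<le> n" for f k
    using that id[of k] n by (cases "k = n") (auto simp: T_def fps_X_power_mult_nth)
  have T_add: "T (f + g) = T f + T g" for f g
    using M(2)[of "fps_const f" "fps_const g"] n by (simp add: T_def nu_cong_iff)
  have T_mult: "T (f * g) = f * T g + T f * g" for f g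
  proof -
    have "T (f * g) = (\<Phi> (fps_const f) * \<Phi> (fps_const g)) $ n"
      using M(4)[of "fps_const f" "fps_const g"] n by (simp add: T_def nu_cong_iff)
    also have "\<dots> = ((fps_const f + fps_X ^ n * fps_const (T f)) * (fps_const g + fps_X ^ n * fps_const (T g))) $ n"
      by (rule nu_bilinear_nth_cong[OF nu_bilinear_mult]) (simp_all add: nth)
    also have "(fps_const f + fps_X ^ n * fps_const (T f)) * (fps_const g + fps_X ^ n * fps_const (T g))
        = fps_const (f * g) + fps_X ^ n * (fps_const (f * T g + T f * g) + fps_X ^ n * fps_const (T f * T g))"
      by (simp add: algebra_simps flip: fps_const_add fps_const_mult)
    also have "\<dots> $ n = f * T g + T f * g" using n by (simp add: fps_X_power_mult_nth)
    finally show ?thesis .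
  qed
  have T_cst: "T (cst a) = 0" for a
  proof -
    have "nu_cong m (\<Phi> (fps_const (cst a) * 1)) (fps_const (cst a) * \<Phi> 1)"
      using M(3)[of "fps_const a" 1] by (simp only: scalar_const)
    then have "T (cst a) = cst a * \<Phi> 1 $ n" using n by (simp add: T_def nu_cong_iff)
    moreover have "\<Phi> 1 $ n = 0" using M(5) n by (simp add: nu_cong_iff)
    ultimately show ?thesis by simp
  qed
  have T: "T f = X1 * dx f + X2 * dy f + X3 * dz f" for f
    using derivation_chain[of T f, OF T_add T_cst T_mult] by (simp add: T_def X1_def X2_def X3_def)
  show "\<Phi> F $ n = F $ n + (X1 * dx (F $ 0) + X2 * dy (F $ 0) + X3 * dz (F $ 0))"
    using lead T by simp
  have vbn: "\<Phi> (vb Y1 Y2 Y3 (fps_const f) (fps_const g)) $ n = vb Z1 Z2 Z3 (fps_const f) (fps_const g) $ n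
      + vb Z1 Z2 Z3 (fps_const (T f)) (fps_const g) $ 0 + vb Z1 Z2 Z3 (fps_const f) (fps_const (T g)) $ 0" for f g
  proof -
    note bil = nu_bilinear_vb[of Z1 Z2 Z3]
    have "\<Phi> (vb Y1 Y2 Y3 (fps_const f) (fps_const g)) $ n = vb Z1 Z2 Z3 (\<Phi> (fps_const f)) (\<Phi> (fps_const g)) $ n"
      using eq n by (simp add: nu_cong_iff)
    also have "\<dots> = vb Z1 Z2 Z3 (fps_const f + fps_X ^ n * fps_const (T f)) (fps_const g + fps_X ^ n * fps_const (T g)) $ n"
      by (rule nu_bilinear_nth_cong[OF bil]) (simp_all only: nth)
    also have "vb Z1 Z2 Z3 (fps_const f + fps_X ^ n * fps_const (T f)) (fps_const g + fps_X ^ n * fps_const (T g))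
      = vb Z1 Z2 Z3 (fps_const f) (fps_const g) + fps_X ^ n * (vb Z1 Z2 Z3 (fps_const (T f)) (fps_const g)
        + vb Z1 Z2 Z3 (fps_const f) (fps_const (T g)) + fps_X ^ n * vb Z1 Z2 Z3 (fps_const (T f)) (fps_const (T g)))"
    proof -
      have add: "vb Z1 Z2 Z3 (F + F') G = vb Z1 Z2 Z3 F G + vb Z1 Z2 Z3 F' G"
        "vb Z1 Z2 Z3 F (G + G') = vb Z1 Z2 Z3 F G + vb Z1 Z2 Z3 F G'" for F F' G G'
        using bil by (auto simp: nu_bilinear_def)
      show ?thesis unfolding add nu_bilinear_X_power[OF bil] by (simp add: algebra_simps)
    qed
    also have "\<dots> $ n = vb Z1 Z2 Z3 (fps_const f) (fps_const g) $ n
      + vb Z1 Z2 Z3 (fps_const (T f)) (fps_const g) $ 0 + vb Z1 Z2 Z3 (fps_const f) (fps_const (T g)) $ 0"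
      using n by (simp add: fps_X_power_mult_nth)
    finally show ?thesis .
  qed
  have X: "T Xv = X1" "T Yv = X2" "T Zv = X3" by (simp_all add: T)
  have "Y1 $ n + T p1 = Z1 $ n + (p1 * dy X2 - p2 * dx X2) + (p1 * dz X3 - p3 * dx X3)"
    using vbn[of Yv Zv] unfolding vb_vars lead X vb_const_nth Y Z by (simp add: algebra_simps)
  then show "Z1 $ n = Y1 $ n + cob_x X1 X2 X3"
    by (simp add: T cob_x_def d_commute algebra_simps)
  have "Y2 $ n + T p2 = Z2 $ n + (p2 * dz X3 - p3 * dy X3) + (p2 * dx X1 - p1 * dy X1)"
    using vbn[of Zv Xv] unfolding vb_vars lead X vb_const_nth Y Z by (simp add: algebra_simps)
  then show "Z2 $ n = Y2 $ n + cob_y X1 X2 X3"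
    by (simp add: T cob_y_def d_commute algebra_simps)
  have "Y3 $ n + T p3 = Z3 $ n + (p3 * dx X1 - p1 * dz X1) + (p3 * dy X2 - p2 * dz X2)"
    using vbn[of Xv Yv] unfolding vb_vars lead X vb_const_nth Y Z by (simp add: algebra_simps)
  then show "Z3 $ n = Y3 $ n + cob_z X1 X2 X3"
    by (simp add: T cob_z_def d_commute algebra_simps)
  have "vb Y1 Y2 Y3 F G $ k = vb Z1 Z2 Z3 F G $ k" if "k < n" for F G k
  proof -
    have "k \<le> m" using n that by simp
    then have "vb Y1 Y2 Y3 F G $ k = vb Z1 Z2 Z3 (\<Phi> F) (\<Phi> G) $ k"
      using eq[of F G] id[OF that, of "vb Y1 Y2 Y3 F G"] unfolding nu_cong_iff by metis
    also have "\<dots> = vb Z1 Z2 Z3 F G $ k"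
      by (rule nu_bilinear_nth_cong[OF nu_bilinear_vb]) (use that id in auto)
    finally show ?thesis .
  qed
  from this[of _ "fps_const Yv" "fps_const Zv"] this[of _ "fps_const Zv" "fps_const Xv"] this[of _ "fps_const Xv" "fps_const Yv"]
  show "k < n \<Longrightarrow> Z1 $ k = Y1 $ k" "k < n \<Longrightarrow> Z2 $ k = Y2 $ k" "k < n \<Longrightarrow> Z3 $ k = Y3 $ k"
    unfolding vb_vars by simp_all
qed

text \<open>With Y = Z + \<nu>^n U, the part of Y . curl Y of order n that is linear in U is U .
  curl \<nabla>\<phi> + \<nabla>\<phi> . curl U at \<nu> = 0. The first summand vanishes and the
  second is the cocycle condition.\<close>

lemma difference_cocycle:
  assumes Y: "jac (vb Y1 Y2 Y3) (fps_const Xv) (fps_const Yv) (fps_const Zv) $ n = 0"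
    and Z: "jac (vb Z1 Z2 Z3) (fps_const Xv) (fps_const Yv) (fps_const Zv) $ n = 0"
    and Z0: "Z1 $ 0 = p1" "Z2 $ 0 = p2" "Z3 $ 0 = p3"
    and eq: "\<And>k. k < n \<Longrightarrow> Y1 $ k = Z1 $ k" "\<And>k. k < n \<Longrightarrow> Y2 $ k = Z2 $ k" "\<And>k. k < n \<Longrightarrow> Y3 $ k = Z3 $ k"
    and n: "n > 0"
  shows "pcurl (Y1 $ n - Z1 $ n) (Y2 $ n - Z2 $ n) (Y3 $ n - Z3 $ n) = 0"
proof -
  obtain U1 where U1: "Y1 = Z1 + fps_X ^ n * U1" "U1 $ 0 = Y1 $ n - Z1 $ n" using fps_agree_below[OF eq(1)] by blast
  obtain U2 where U2: "Y2 = Z2 + fps_X ^ n * U2" "U2 $ 0 = Y2 $ n - Z2 $ n" using fps_agree_below[OF eq(2)] by blast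
  obtain U3 where U3: "Y3 = Z3 + fps_X ^ n * U3" "U3 $ 0 = Y3 $ n - Z3 $ n" using fps_agree_below[OF eq(3)] by blast
  define q where "q Y1 Y2 Y3 = Y1 * (fdy Y3 - fdz Y2) + Y2 * (fdz Y1 - fdx Y3) + Y3 * (fdx Y2 - fdy Y1)"
    for Y1 Y2 Y3 :: "'a poly3 fps"
  have "q Y1 Y2 Y3 = q Z1 Z2 Z3 + fps_X ^ n * ((U1 * (fdy Z3 - fdz Z2) + U2 * (fdz Z1 - fdx Z3) + U3 * (fdx Z2 - fdy Z1))
     + (Z1 * (fdy U3 - fdz U2) + Z2 * (fdz U1 - fdx U3) + Z3 * (fdx U2 - fdy U1)) + fps_X ^ n * q U1 U2 U3)"
    unfolding U1(1) U2(1) U3(1) q_def fd_add fd_X_power_mult by (simp add: algebra_simps)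
  moreover have "(- q Y1 Y2 Y3) $ n = 0" "(- q Z1 Z2 Z3) $ n = 0"
    using Y Z unfolding jac_vb_vars q_def .
  then have "q Y1 Y2 Y3 $ n = 0" "q Z1 Z2 Z3 $ n = 0" by simp_all
  ultimately have "(fps_X ^ n * ((U1 * (fdy Z3 - fdz Z2) + U2 * (fdz Z1 - fdx Z3) + U3 * (fdx Z2 - fdy Z1))
     + (Z1 * (fdy U3 - fdz U2) + Z2 * (fdz U1 - fdx U3) + Z3 * (fdx U2 - fdy U1)) + fps_X ^ n * q U1 U2 U3)) $ n = 0"
    by (metis add_0 fps_add_nth)
  then have "p1 * (dy (U3 $ 0) - dz (U2 $ 0)) + p2 * (dz (U1 $ 0) - dx (U3 $ 0)) + p3 * (dx (U2 $ 0) - dy (U1 $ 0)) = 0"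
    using n by (simp add: fps_X_power_mult_nth Z0 d_commute)
  then show ?thesis by (simp add: pcurl_def U1(2) U2(2) U3(2))
qed

end

lemma nilpotent_derivation_X_power:
  assumes T: "nu_derivation T"
  shows "nilpotent_derivation (\<lambda>F. fps_X ^ Suc n * T F)"
proof
  show "nu_derivation (\<lambda>F. fps_X ^ Suc n * T F)"
    using T by (simp add: nu_derivation_def algebra_simps)
qed simp

lemma nu_exp_X_power:
  assumes T: "nu_derivation T"
  shows "nu_auto (nu_exp (\<lambda>F. fps_X ^ Suc n * T F))"
    and "k < Suc n \<Longrightarrow> nu_exp (\<lambda>F. fps_X ^ Suc n * T F) F $ k = F $ k"
    and "nu_exp (\<lambda>F. fps_X ^ Suc n * T F) F $ Suc n = F $ Suc n + T F $ 0"
proof -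
  interpret nilpotent_derivation "\<lambda>F. fps_X ^ Suc n * T F" by (rule nilpotent_derivation_X_power[OF T])
  show "nu_auto (nu_exp (\<lambda>F. fps_X ^ Suc n * T F))" by (rule nu_auto_exp)
  note * = nu_exp_leading[of n, OF dvd_triv_left]
  show "k < Suc n \<Longrightarrow> nu_exp (\<lambda>F. fps_X ^ Suc n * T F) F $ k = F $ k"
    using *[of k F] by (simp add: fps_X_power_mult_nth del: power_Suc)
  show "nu_exp (\<lambda>F. fps_X ^ Suc n * T F) F $ Suc n = F $ Suc n + T F $ 0"
    using *[of "Suc n" F] by (simp add: fps_X_power_mult_nth del: power_Suc)
qed

lemma nu_bider_eq_vb_ex: "nu_bider B \<Longrightarrow> \<exists>Y1 Y2 Y3. B = vb Y1 Y2 Y3"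
  using nu_bider_eq_vb by blast

section \<open>Existence of representatives, one order at a time\<close>

context singularity
begin

text \<open>The first deviation from the family is a cocycle. The coefficients of its class become
  the constants of order n + 1, and the remaining coboundary is removed by an exponential.\<close>

lemma gauge_step:
  assumes adm: "admissible \<mu> E c cb" and c0: "\<And>k. k > n \<Longrightarrow> c k = (\<lambda>_ _. 0)" "\<And>k. k > n \<Longrightarrow> cb k = (\<lambda>_. 0)"
    and Y: "\<And>k. k \<le> n \<Longrightarrow> Y1 $ k = fam1 c cb $ k" "\<And>k. k \<le> n \<Longrightarrow> Y2 $ k = fam2 c cb $ k"
      "\<And>k. k \<le> n \<Longrightarrow> Y3 $ k = fam3 c cb $ k"
    and J: "jac (vb Y1 Y2 Y3) (fps_const Xv) (fps_const Yv) (fps_const Zv) $ Suc n = 0"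
  shows "\<exists>c' cb' \<Psi> Z1 Z2 Z3. admissible \<mu> E c' cb' \<and> (\<forall>k\<le>n. c' k = c k \<and> cb' k = cb k)
    \<and> (\<forall>k>Suc n. c' k = (\<lambda>_ _. 0) \<and> cb' k = (\<lambda>_. 0)) \<and> nu_auto \<Psi> \<and> (\<forall>F. \<forall>k\<le>n. \<Psi> F $ k = F $ k)
    \<and> (\<forall>F G. \<Psi> (vb Y1 Y2 Y3 F G) = vb Z1 Z2 Z3 (\<Psi> F) (\<Psi> G))
    \<and> (\<forall>k\<le>Suc n. Z1 $ k = fam1 c' cb' $ k \<and> Z2 $ k = fam2 c' cb' $ k \<and> Z3 $ k = fam3 c' cb' $ k)"
proof -
  note F0 = fam_0[OF adm]
  have Y0: "Y1 $ 0 = p1" "Y2 $ 0 = p2" "Y3 $ 0 = p3" using Y[of 0] F0 by simp_all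
  have pc: "pcurl (Y1 $ Suc n - fam1 c cb $ Suc n) (Y2 $ Suc n - fam2 c cb $ Suc n) (Y3 $ Suc n - fam3 c cb $ Suc n) = 0"
    by (rule difference_cocycle[OF J _ F0]) (simp_all add: famB_jacobi Y)
  obtain N a b X1 X2 X3 where a0: "d \<noteq> w1 + w2 + w3 \<longrightarrow> (\<forall>l. a l 0 = 0)"
    and W: "Y1 $ Suc n - fam1 c cb $ Suc n = comb N a * p1 + (\<Sum>r\<in>{1..<\<mu>}. cst (b r) * dx (u r)) + cob_x X1 X2 X3"
    "Y2 $ Suc n - fam2 c cb $ Suc n = comb N a * p2 + (\<Sum>r\<in>{1..<\<mu>}. cst (b r) * dy (u r)) + cob_y X1 X2 X3"
    "Y3 $ Suc n - fam3 c cb $ Suc n = comb N a * p3 + (\<Sum>r\<in>{1..<\<mu>}. cst (b r) * dz (u r)) + cob_z X1 X2 X3"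
    using second_cohomology_spanning[OF pc] by blast
  \<comment> \<open>The restrictions lose nothing: \<open>comb N a\<close> uses only l < N, and a l
    0 = 0 whenever 0 lies outside \<open>E\<close>.\<close>
  define c' where "c' = c(Suc n := (\<lambda>l i. if l < N \<and> i \<in> E then a l i else 0))"
  define cb' where "cb' = cb(Suc n := (\<lambda>r. if 1 \<le> r \<and> r < \<mu> then b r else 0))"
  have E_mu: "i < \<mu>" if "i \<in> E" for i using that by (auto simp: E_index_def split: if_splits)
  have adm': "admissible \<mu> E c' cb'"
  proof -
    have 1: "finite {(l, i). c' (Suc n) l i \<noteq> 0}"
      by (rule finite_subset[of _ "{..<N} \<times> {..<\<mu>}"]) (auto simp: c'_def E_mu split: if_splits)
    have 2: "finite {r. cb' (Suc n) r \<noteq> 0}"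
      by (rule finite_subset[of _ "{..<\<mu>}"]) (auto simp: cb'_def split: if_splits)
    have "finite {(l, i). c' k l i \<noteq> 0} \<and> finite {r. cb' k r \<noteq> 0}" if "k \<ge> 1" for k
    proof (cases "k = Suc n")
      case True
      then show ?thesis using 1 2 by simp
    next
      case False
      then show ?thesis using adm that unfolding admissible_def c'_def cb'_def by simp
    qed
    then show ?thesis using adm unfolding admissible_def c'_def cb'_def by simp
  qed
  have P: "famP c' $ Suc n - famP c $ Suc n = comb N a"
  proof -
    have "famP c' $ Suc n = comb N (c' (Suc n))" by (rule famP_nth) (simp_all add: c'_def)
    also have "\<dots> = comb N a"
    proof (rule comb_cong)
      fix l i assume "l < N" "i < \<mu>"
      then show "c' (Suc n) l i = a l i" using a0 by (cases "i = 0") (auto simp: c'_def E_index_def)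
    qed
    also have "famP c $ Suc n = 0" using c0(1)[of "Suc n"] by (simp add: famP_def)
    ultimately show ?thesis by simp
  qed
  have Q: "famQ cb' $ Suc n - famQ cb $ Suc n = (\<Sum>r\<in>{1..<\<mu>}. cst (b r) * u r)"
    using c0(2)[of "Suc n"] by (simp add: famQ_def cb'_def)
  have diff: "fam1 c' cb' $ Suc n = Y1 $ Suc n - cob_x X1 X2 X3"
    "fam2 c' cb' $ Suc n = Y2 $ Suc n - cob_y X1 X2 X3" "fam3 c' cb' $ Suc n = Y3 $ Suc n - cob_z X1 X2 X3"
    using fam_difference[OF adm, of "Suc n" c' cb'] W unfolding P Q
    by (simp_all add: c'_def cb'_def d_sum algebra_simps)
  have low: "fam1 c' cb' $ k = fam1 c cb $ k" "fam2 c' cb' $ k = fam2 c cb $ k" "fam3 c' cb' $ k = fam3 c cb $ k"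
    if "k \<le> n" for k
  proof -
    have "famP c' $ j = famP c $ j" "famQ cb' $ j = famQ cb $ j" if "j \<le> k" for j
      using that \<open>k \<le> n\<close> by (simp_all add: famP_def famQ_def c'_def cb'_def)
    then show "fam1 c' cb' $ k = fam1 c cb $ k" "fam2 c' cb' $ k = fam2 c cb $ k" "fam3 c' cb' $ k = fam3 c cb $ k"
      unfolding fam_defs by (auto intro!: nu_bilinear_nth_cong[OF nu_bilinear_mult])
  qed
  \<comment> \<open>The sign is chosen to subtract the coboundary of X, since an automorphism
    starting with \<nu>^(n + 1) T adds the coboundary of T.\<close>
  define T where "T F = - (fps_const X1 * fdx F + fps_const X2 * fdy F + fps_const X3 * fdz F)" for F
  have T: "nu_derivation T" by (simp add: nu_derivation_def T_def algebra_simps)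
  define \<Psi> where "\<Psi> = nu_exp (\<lambda>F. fps_X ^ Suc n * T F)"
  have \<Psi>_auto: "nu_auto \<Psi>" unfolding \<Psi>_def by (rule nu_exp_X_power(1)[OF T])
  have \<Psi>_low: "\<Psi> F $ k = F $ k" if "k < Suc n" for F k
    unfolding \<Psi>_def by (rule nu_exp_X_power(2)[OF T that])
  obtain B where B: "nu_bider B" "\<And>F G. \<Psi> (vb Y1 Y2 Y3 F G) = B (\<Psi> F) (\<Psi> G)"
    using nu_bider_transport[OF \<Psi>_auto nu_bider_vb[of Y1 Y2 Y3]] by blast
  then obtain Z1 Z2 Z3 where Z: "B = vb Z1 Z2 Z3" using nu_bider_eq_vb_ex by blast
  have T_vars: "\<Psi> (fps_const Xv) $ Suc n = - X1" "\<Psi> (fps_const Yv) $ Suc n = - X2" "\<Psi> (fps_const Zv) $ Suc n = - X3"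
    using nu_exp_X_power(3)[OF T, of n, folded \<Psi>_def] by (simp_all add: T_def)
  have Z0: "Z1 $ 0 = p1" "Z2 $ 0 = p2" "Z3 $ 0 = p3"
  proof -
    have "vb Z1 Z2 Z3 F G $ 0 = vb Y1 Y2 Y3 F G $ 0" for F G
    proof -
      have "vb Z1 Z2 Z3 F G $ 0 = vb Z1 Z2 Z3 (\<Psi> F) (\<Psi> G) $ 0"
        by (rule nu_bilinear_nth_cong[OF nu_bilinear_vb]) (simp_all add: \<Psi>_low)
      also have "\<dots> = \<Psi> (vb Y1 Y2 Y3 F G) $ 0" by (simp add: B Z)
      finally show ?thesis by (simp add: \<Psi>_low)
    qed
    from this[of "fps_const Yv" "fps_const Zv"] this[of "fps_const Zv" "fps_const Xv"]
      this[of "fps_const Xv" "fps_const Yv"]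
    show "Z1 $ 0 = p1" "Z2 $ 0 = p2" "Z3 $ 0 = p3" by (simp_all add: vb_vars Y0)
  qed
  have "nu_cong (Suc n) (\<Psi> (vb Y1 Y2 Y3 F G)) (vb Z1 Z2 Z3 (\<Psi> F) (\<Psi> G))" for F G
    by (simp add: B Z)
  note gc = gauge_coefficient[OF nu_auto_imp_morph[OF \<Psi>_auto] zero_less_Suc order_refl \<Psi>_low Y0 Z0 this, unfolded T_vars]
  have cob_neg: "cob_x (- X1) (- X2) (- X3) = - cob_x X1 X2 X3" "cob_y (- X1) (- X2) (- X3) = - cob_y X1 X2 X3"
    "cob_z (- X1) (- X2) (- X3) = - cob_z X1 X2 X3"
    by (simp_all add: cob_defs algebra_simps)
  have fam: "Z1 $ k = fam1 c' cb' $ k \<and> Z2 $ k = fam2 c' cb' $ k \<and> Z3 $ k = fam3 c' cb' $ k" if "k \<le> Suc n" for k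
  proof (cases "k = Suc n")
    case True
    then show ?thesis using gc(2-4) by (simp add: cob_neg diff)
  next
    case False
    then have "k < Suc n" using that by simp
    then show ?thesis using gc(5-7)[of k] Y[of k] low[of k] by simp
  qed
  have low': "\<forall>k\<le>n. c' k = c k \<and> cb' k = cb k" "\<forall>k>Suc n. c' k = (\<lambda>_ _. 0) \<and> cb' k = (\<lambda>_. 0)"
    using c0 by (simp_all add: c'_def cb'_def)
  show ?thesis
  proof (intro exI conjI)
    show "admissible \<mu> E c' cb'" by (rule adm')
    show "\<forall>k\<le>n. c' k = c k \<and> cb' k = cb k" "\<forall>k>Suc n. c' k = (\<lambda>_ _. 0) \<and> cb' k = (\<lambda>_. 0)"
      by (rule low')+
    show "nu_auto \<Psi>" by (rule \<Psi>_auto)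
    show "\<forall>F. \<forall>k\<le>n. \<Psi> F $ k = F $ k" using \<Psi>_low by simp
    show "\<forall>F G. \<Psi> (vb Y1 Y2 Y3 F G) = vb Z1 Z2 Z3 (\<Psi> F) (\<Psi> G)" by (simp add: B Z)
    show "\<forall>k\<le>Suc n. Z1 $ k = fam1 c' cb' $ k \<and> Z2 $ k = fam2 c' cb' $ k \<and> Z3 $ k = fam3 c' cb' $ k"
      using fam by simp
  qed
qed

text \<open>\<open>S\<close> is the set of orders in which the Jacobi identity is available: all
  orders for formal deformations, those up to m for truncated ones. The data form one triple so that
  a sequence of stages can be chosen.\<close>

definition stage where
  "stage Y1 Y2 Y3 S n s \<longleftrightarrow> (case s of (\<Phi>, c, cb) \<Rightarrow>
    nu_auto \<Phi> \<and> admissible \<mu> E c cb \<and> (\<forall>k. k > n \<or> k \<notin> S \<longrightarrow> c k = (\<lambda>_ _. 0) \<and> cb k = (\<lambda>_. 0)) \<and>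
    (\<exists>Z1 Z2 Z3. (\<forall>F G. \<Phi> (vb Y1 Y2 Y3 F G) = vb Z1 Z2 Z3 (\<Phi> F) (\<Phi> G)) \<and>
      (\<forall>k\<in>S. k \<le> n \<longrightarrow> Z1 $ k = fam1 c cb $ k \<and> Z2 $ k = fam2 c cb $ k \<and> Z3 $ k = fam3 c cb $ k)))"

lemma stageI:
  assumes "nu_auto \<Phi>" "admissible \<mu> E c cb" "\<And>k. k > n \<or> k \<notin> S \<Longrightarrow> c k = (\<lambda>_ _. 0) \<and> cb k = (\<lambda>_. 0)"
    "\<And>F G. \<Phi> (vb Y1 Y2 Y3 F G) = vb Z1 Z2 Z3 (\<Phi> F) (\<Phi> G)"
    "\<And>k. k \<in> S \<Longrightarrow> k \<le> n \<Longrightarrow> Z1 $ k = fam1 c cb $ k \<and> Z2 $ k = fam2 c cb $ k \<and> Z3 $ k = fam3 c cb $ k"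
  shows "stage Y1 Y2 Y3 S n (\<Phi>, c, cb)"
proof -
  have "\<exists>Z1 Z2 Z3. (\<forall>F G. \<Phi> (vb Y1 Y2 Y3 F G) = vb Z1 Z2 Z3 (\<Phi> F) (\<Phi> G)) \<and>
      (\<forall>k\<in>S. k \<le> n \<longrightarrow> Z1 $ k = fam1 c cb $ k \<and> Z2 $ k = fam2 c cb $ k \<and> Z3 $ k = fam3 c cb $ k)"
  proof (intro exI conjI)
    show "\<forall>F G. \<Phi> (vb Y1 Y2 Y3 F G) = vb Z1 Z2 Z3 (\<Phi> F) (\<Phi> G)" using assms(4) by blast
    show "\<forall>k\<in>S. k \<le> n \<longrightarrow> Z1 $ k = fam1 c cb $ k \<and> Z2 $ k = fam2 c cb $ k \<and> Z3 $ k = fam3 c cb $ k"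
      using assms(5) by blast
  qed
  then show ?thesis unfolding stage_def prod.case using assms(1-3) by blast
qed

lemma stage_step:
  assumes st: "stage Y1 Y2 Y3 S n (\<Phi>, c, cb)" and S: "\<And>k j. k \<in> S \<Longrightarrow> j \<le> k \<Longrightarrow> j \<in> S"
    and J: "\<And>k F G K. k \<in> S \<Longrightarrow> jac (vb Y1 Y2 Y3) F G K $ k = 0"
  shows "\<exists>\<Phi>' c' cb'. stage Y1 Y2 Y3 S (Suc n) (\<Phi>', c', cb') \<and> (\<forall>k\<le>n. c' k = c k \<and> cb' k = cb k)
    \<and> (\<forall>F. \<forall>k\<le>n. \<Phi>' F $ k = \<Phi> F $ k)"
proof -
  have \<Phi>: "nu_auto \<Phi>" and adm: "admissible \<mu> E c cb"
    and c0: "\<And>k. k > n \<or> k \<notin> S \<Longrightarrow> c k = (\<lambda>_ _. 0) \<and> cb k = (\<lambda>_. 0)"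
    using st by (auto simp: stage_def)
  obtain Z1 Z2 Z3 where Z: "\<And>F G. \<Phi> (vb Y1 Y2 Y3 F G) = vb Z1 Z2 Z3 (\<Phi> F) (\<Phi> G)"
    and Zf: "\<forall>k\<in>S. k \<le> n \<longrightarrow> Z1 $ k = fam1 c cb $ k \<and> Z2 $ k = fam2 c cb $ k \<and> Z3 $ k = fam3 c cb $ k"
    using st by (auto simp: stage_def)
  show ?thesis
  proof (cases "Suc n \<in> S")
    case False
    have "k \<le> n" if "k \<in> S" "k \<le> Suc n" for k using that False by (metis le_Suc_eq)
    then have "stage Y1 Y2 Y3 S (Suc n) (\<Phi>, c, cb)"
      using Zf c0 by (intro stageI[OF \<Phi> adm _ Z]) auto
    then show ?thesis by blast
  next
    case True
    \<comment> \<open>\<open>\<Phi>\<close> does not act on a single coefficient, but it preserves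
      vanishing in all orders up to n + 1; hence \<open>S\<close> must be closed downwards.\<close>
    have JZ: "jac (vb Z1 Z2 Z3) F G K $ Suc n = 0" for F G K
    proof -
      obtain \<Psi> where inv: "\<And>F. \<Phi> (\<Psi> F) = F" using nu_auto_inverse[OF \<Phi>] by blast
      have "jac (vb Z1 Z2 Z3) (\<Phi> F) (\<Phi> G) (\<Phi> K) = \<Phi> (jac (vb Y1 Y2 Y3) F G K)" for F G K
        by (simp add: jac_def Z nu_autoD(1)[OF \<Phi>])
      from this[of "\<Psi> F" "\<Psi> G" "\<Psi> K"]
      have *: "jac (vb Z1 Z2 Z3) F G K = \<Phi> (jac (vb Y1 Y2 Y3) (\<Psi> F) (\<Psi> G) (\<Psi> K))" by (simp add: inv)
      have "nu_cong (Suc n) (jac (vb Y1 Y2 Y3) (\<Psi> F) (\<Psi> G) (\<Psi> K)) 0"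
        using J S[OF True] by (simp add: nu_cong_iff)
      then have "nu_cong (Suc n) (\<Phi> (jac (vb Y1 Y2 Y3) (\<Psi> F) (\<Psi> G) (\<Psi> K))) (\<Phi> 0)"
        by (rule nu_morphD(1)[OF nu_auto_imp_morph[OF \<Phi>]])
      then show ?thesis unfolding * nu_autoD(6)[OF \<Phi>] nu_cong_iff by simp
    qed
    have Zk: "Z1 $ k = fam1 c cb $ k" "Z2 $ k = fam2 c cb $ k" "Z3 $ k = fam3 c cb $ k" if "k \<le> n" for k
      using Zf S[OF True, of k] that by auto
    have ck: "c k = (\<lambda>_ _. 0)" "cb k = (\<lambda>_. 0)" if "k > n" for k using c0 that by auto
    obtain c' cb' \<Psi> V1 V2 V3 where n: "admissible \<mu> E c' cb'" "\<forall>k\<le>n. c' k = c k \<and> cb' k = cb k"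
      "\<forall>k>Suc n. c' k = (\<lambda>_ _. 0) \<and> cb' k = (\<lambda>_. 0)" "nu_auto \<Psi>" "\<forall>F. \<forall>k\<le>n. \<Psi> F $ k = F $ k"
      "\<forall>F G. \<Psi> (vb Z1 Z2 Z3 F G) = vb V1 V2 V3 (\<Psi> F) (\<Psi> G)"
      "\<forall>k\<le>Suc n. V1 $ k = fam1 c' cb' $ k \<and> V2 $ k = fam2 c' cb' $ k \<and> V3 $ k = fam3 c' cb' $ k"
      by (rule exE[OF gauge_step[OF adm ck Zk JZ]]; (assumption | (elim exE conjE, rule that; assumption)))
    have "stage Y1 Y2 Y3 S (Suc n) (\<Psi> \<circ> \<Phi>, c', cb')"
    proof (rule stageI)
      show "nu_auto (\<Psi> \<circ> \<Phi>)" by (rule nu_auto_comp[OF n(4) \<Phi>])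
      show "admissible \<mu> E c' cb'" by (rule n(1))
      show "c' k = (\<lambda>_ _. 0) \<and> cb' k = (\<lambda>_. 0)" if k: "k > Suc n \<or> k \<notin> S" for k
      proof (cases "Suc n < k")
        case False
        then have "k \<notin> S" using k by simp
        then have "k \<noteq> Suc n" using True by auto
        then have "k \<le> n" using False by simp
        then show ?thesis using n(2) c0[of k] \<open>k \<notin> S\<close> by simp
      qed (use n(3) in simp)
      show "(\<Psi> \<circ> \<Phi>) (vb Y1 Y2 Y3 F G) = vb V1 V2 V3 ((\<Psi> \<circ> \<Phi>) F) ((\<Psi> \<circ> \<Phi>) G)" for F G
        using n(6) by (simp add: Z)
      show "V1 $ k = fam1 c' cb' $ k \<and> V2 $ k = fam2 c' cb' $ k \<and> V3 $ k = fam3 c' cb' $ k" if "k \<le> Suc n" for k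
        using n(7) that by blast
    qed
    then show ?thesis using n(2,5) by (intro exI[of _ "\<Psi> \<circ> \<Phi>"] exI[of _ c'] exI[of _ cb']) simp
  qed
qed

text \<open>Stage n + 1 leaves constants and automorphism unchanged up to order n, so the diagonals
  of the chosen sequence are the limits, and every identity in order k can be checked at stage
  k.\<close>

theorem representatives_exist:
  assumes Y0: "Y1 $ 0 = p1" "Y2 $ 0 = p2" "Y3 $ 0 = p3"
    and S: "\<And>k j. k \<in> S \<Longrightarrow> j \<le> k \<Longrightarrow> j \<in> S"
    and J: "\<And>k F G K. k \<in> S \<Longrightarrow> jac (vb Y1 Y2 Y3) F G K $ k = 0"
  shows "\<exists>c cb \<Phi>. admissible \<mu> E c cb \<and> (\<forall>k. k \<notin> S \<longrightarrow> c k = (\<lambda>_ _. 0) \<and> cb k = (\<lambda>_. 0)) \<and> nu_auto \<Phi>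
    \<and> (\<forall>F G. \<forall>k\<in>S. \<Phi> (vb Y1 Y2 Y3 F G) $ k = famB c cb (\<Phi> F) (\<Phi> G) $ k)"
proof -
  let ?Q = "\<lambda>n s t. (\<forall>k\<le>n. fst (snd t) k = fst (snd s) k \<and> snd (snd t) k = snd (snd s) k)
    \<and> (\<forall>F. \<forall>k\<le>n. fst t F $ k = fst s F $ k)"
  have adm0: "admissible \<mu> E (\<lambda>_ _ _. 0) (\<lambda>_ _. 0)" by (simp add: admissible_def)
  have st0: "stage Y1 Y2 Y3 S 0 (\<lambda>F. F, \<lambda>_ _ _. 0, \<lambda>_ _. 0)"
  proof -
    have "\<forall>k\<in>S. k \<le> 0 \<longrightarrow> Y1 $ k = fam1 (\<lambda>_ _ _. 0) (\<lambda>_ _. 0) $ k \<and>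
        Y2 $ k = fam2 (\<lambda>_ _ _. 0) (\<lambda>_ _. 0) $ k \<and> Y3 $ k = fam3 (\<lambda>_ _ _. 0) (\<lambda>_ _. 0) $ k"
      using Y0 fam_0[OF adm0] by simp
    moreover have "nu_auto (\<lambda>F :: 'a poly3 fps. F)" by (simp add: nu_auto_def)
    ultimately show ?thesis using adm0 by (intro stageI[of _ _ _ _ _ _ _ _ Y1 Y2 Y3]) auto
  qed
  have step: "\<exists>t. stage Y1 Y2 Y3 S (Suc n) t \<and> ?Q n s t" if "stage Y1 Y2 Y3 S n s" for n s
  proof -
    obtain \<Phi> c cb where s: "s = (\<Phi>, c, cb)" by (metis prod.exhaust)
    have "\<exists>\<Phi>' c' cb'. stage Y1 Y2 Y3 S (Suc n) (\<Phi>', c', cb') \<and> (\<forall>k\<le>n. c' k = c k \<and> cb' k = cb k)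
      \<and> (\<forall>F. \<forall>k\<le>n. \<Phi>' F $ k = \<Phi> F $ k)"
      by (rule stage_step[OF that[unfolded s]], erule (1) S, erule J)
    then obtain \<Phi>' c' cb' where "stage Y1 Y2 Y3 S (Suc n) (\<Phi>', c', cb')" "\<forall>k\<le>n. c' k = c k \<and> cb' k = cb k"
      "\<forall>F. \<forall>k\<le>n. \<Phi>' F $ k = \<Phi> F $ k" by (elim exE conjE)
    then show ?thesis by (intro exI[of _ "(\<Phi>', c', cb')"]) (simp add: s)
  qed
  have "\<exists>s. \<forall>n. stage Y1 Y2 Y3 S n (s n) \<and> ?Q n (s n) (s (Suc n))"
    by (rule dependent_nat_choice) (rule exI, rule st0, rule step)
  then obtain s where "\<forall>n. stage Y1 Y2 Y3 S n (s n) \<and> ?Q n (s n) (s (Suc n))" ..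
  then have s: "stage Y1 Y2 Y3 S n (s n)" and Q: "?Q n (s n) (s (Suc n))" for n by simp_all
  define \<Phi> c cb where "\<Phi> = (\<lambda>n. fst (s n))" and "c = (\<lambda>n. fst (snd (s n)))" and "cb = (\<lambda>n. snd (snd (s n)))"
  have st: "stage Y1 Y2 Y3 S n (\<Phi> n, c n, cb n)" for n using s[of n] by (simp add: \<Phi>_def c_def cb_def)
  have stable: "c (k + n) k = c k k \<and> cb (k + n) k = cb k k \<and> (\<forall>F. \<Phi> (k + n) F $ k = \<Phi> k F $ k)" for k n
  proof (induction n)
    case (Suc n)
    then show ?case using Q[of "k + n"] by (simp add: \<Phi>_def c_def cb_def)
  qed simp
  have stable: "c n k = c k k" "cb n k = cb k k" "\<Phi> n F $ k = \<Phi> k F $ k" if "k \<le> n" for n k F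
    using stable[of k "n - k"] that by simp_all
  define c' where "c' = (\<lambda>k. c k k)"
  define cb' where "cb' = (\<lambda>k. cb k k)"
  define \<Psi> where "\<Psi> F = Abs_fps (\<lambda>k. \<Phi> k F $ k)" for F
  have \<Psi>: "\<Psi> F $ k = \<Phi> n F $ k" if "k \<le> n" for F k n
    using stable(3)[OF that] by (simp add: \<Psi>_def)
  have auto: "nu_auto (\<Phi> n)" and adm: "admissible \<mu> E (c n) (cb n)" for n
    using st[of n] by (simp_all add: stage_def)
  have adm': "admissible \<mu> E c' cb'"
    using adm unfolding admissible_def c'_def cb'_def by blast
  have zero: "c' k = (\<lambda>_ _. 0) \<and> cb' k = (\<lambda>_. 0)" if "k \<notin> S" for k
    using st[of k] that unfolding stage_def c'_def cb'_def by blast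
  have fam: "fam1 c' cb' $ k = fam1 (c n) (cb n) $ k" "fam2 c' cb' $ k = fam2 (c n) (cb n) $ k"
    "fam3 c' cb' $ k = fam3 (c n) (cb n) $ k" if "k \<le> n" for k n
  proof -
    have "famP c' $ j = famP (c n) $ j" "famQ cb' $ j = famQ (cb n) $ j" if "j \<le> k" for j
      using that \<open>k \<le> n\<close> stable(1,2)[of j n] by (simp_all add: famP_def famQ_def c'_def cb'_def)
    then show "fam1 c' cb' $ k = fam1 (c n) (cb n) $ k" "fam2 c' cb' $ k = fam2 (c n) (cb n) $ k"
      "fam3 c' cb' $ k = fam3 (c n) (cb n) $ k"
      unfolding fam_defs by (auto intro!: nu_bilinear_nth_cong[OF nu_bilinear_mult])
  qed
  have "nu_auto \<Psi>"
    unfolding nu_auto_def fps_X_dvd_diff_iff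
  proof (intro conjI allI)
    fix F G s
    show "\<Psi> (F + G) = \<Psi> F + \<Psi> G"
      by (rule fps_ext) (simp add: \<Psi>_def nu_autoD(1)[OF auto])
    show "\<Psi> (scalar s * F) = scalar s * \<Psi> F"
    proof (rule fps_ext)
      fix k
      have "(scalar s * \<Psi> F) $ k = (scalar s * \<Phi> k F) $ k"
        by (rule nu_bilinear_nth_cong[OF nu_bilinear_mult]) (simp_all add: \<Psi>)
      then show "\<Psi> (scalar s * F) $ k = (scalar s * \<Psi> F) $ k"
        using \<Psi>[of k k "scalar s * F"] by (simp only: order_refl nu_autoD(2)[OF auto])
    qed
    show "\<Psi> (F * G) = \<Psi> F * \<Psi> G"
    proof (rule fps_ext)
      fix k
      have "(\<Psi> F * \<Psi> G) $ k = (\<Phi> k F * \<Phi> k G) $ k"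
        by (rule nu_bilinear_nth_cong[OF nu_bilinear_mult]) (simp_all add: \<Psi>)
      then show "\<Psi> (F * G) $ k = (\<Psi> F * \<Psi> G) $ k"
        using \<Psi>[of k k "F * G"] by (simp only: order_refl nu_autoD(3)[OF auto])
    qed
    show "\<Psi> 1 = 1" by (rule fps_ext) (simp add: \<Psi>_def nu_autoD(4)[OF auto])
    show "\<Psi> F $ 0 = F $ 0" by (simp add: \<Psi>_def nu_autoD(5)[OF auto])
  qed
  moreover have "\<Psi> (vb Y1 Y2 Y3 F G) $ k = famB c' cb' (\<Psi> F) (\<Psi> G) $ k" if k: "k \<in> S" for F G k
  proof -
    obtain Z1 Z2 Z3 where Z: "\<And>F G. \<Phi> k (vb Y1 Y2 Y3 F G) = vb Z1 Z2 Z3 (\<Phi> k F) (\<Phi> k G)"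
      and Zf: "\<forall>j\<in>S. j \<le> k \<longrightarrow> Z1 $ j = fam1 (c k) (cb k) $ j \<and> Z2 $ j = fam2 (c k) (cb k) $ j
        \<and> Z3 $ j = fam3 (c k) (cb k) $ j"
      using st[of k] by (auto simp: stage_def)
    have Zk: "Z1 $ j = fam1 c' cb' $ j" "Z2 $ j = fam2 c' cb' $ j" "Z3 $ j = fam3 c' cb' $ j" if "j \<le> k" for j
      using Zf S[OF k that] that fam[OF that] by auto
    have "\<Psi> (vb Y1 Y2 Y3 F G) $ k = vb Z1 Z2 Z3 (\<Phi> k F) (\<Phi> k G) $ k"
      using \<Psi>[of k k] by (simp add: Z)
    also have "\<dots> = vb Z1 Z2 Z3 (\<Psi> F) (\<Psi> G) $ k"
      by (rule nu_bilinear_nth_cong[OF nu_bilinear_vb]) (simp_all add: \<Psi>)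
    also have "\<dots> = famB c' cb' (\<Psi> F) (\<Psi> G) $ k"
      unfolding vb_def fps_add_nth
      by (intro arg_cong2[of _ _ _ _ "(+)"] nu_bilinear_nth_cong[OF nu_bilinear_mult]) (simp_all add: Zk)
    finally show ?thesis .
  qed
  ultimately show ?thesis
    using adm' zero by (intro exI[of _ c'] exI[of _ cb'] exI[of _ \<Psi>]) simp
qed

text \<open>In the induction the equivalence varies while the two families stay fixed. It is
  replaced by its composition with a symmetry of the first family, so that it becomes the identity
  in one more order.\<close>

theorem representatives_unique:
  assumes dw: "d \<noteq> w1 + w2 + w3" and adm: "admissible \<mu> E c cb" and adm': "admissible \<mu> E c' cb'"
    and \<Phi>: "nu_morph m \<Phi>"
    and eq: "\<And>F G. nu_cong m (\<Phi> (famB c cb F G)) (famB c' cb' (\<Phi> F) (\<Phi> G))"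
    and k: "k \<le> m"
  shows "c k = c' k \<and> cb k = cb' k"
proof -
  have "\<exists>\<Phi>. nu_morph m \<Phi> \<and> (\<forall>F G. nu_cong m (\<Phi> (famB c cb F G)) (famB c' cb' (\<Phi> F) (\<Phi> G)))
    \<and> (\<forall>F. \<forall>k\<le>n. \<Phi> F $ k = F $ k) \<and> (\<forall>k\<le>n. c k = c' k \<and> cb k = cb' k)" if "n \<le> m" for n
    using that
  proof (induction n)
    case 0
    \<comment> \<open>Admissibility makes all constants of order 0 vanish.\<close>
    have "c 0 = c' 0" "cb 0 = cb' 0"
      using adm adm' by (auto simp: admissible_def fun_eq_iff)
    then show ?case using \<Phi> eq nu_morphD(6)[OF \<Phi>] by (intro exI[of _ \<Phi>]) simp
  next
    case (Suc n)
    then obtain \<Phi> where \<Phi>: "nu_morph m \<Phi>" and eq: "\<And>F G. nu_cong m (\<Phi> (famB c cb F G)) (famB c' cb' (\<Phi> F) (\<Phi> G))"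
      and id: "\<And>F k. k < Suc n \<Longrightarrow> \<Phi> F $ k = F $ k" and cc: "\<And>k. k \<le> n \<Longrightarrow> c k = c' k" "\<And>k. k \<le> n \<Longrightarrow> cb k = cb' k"
      by (auto simp: less_Suc_eq_le)
    define X1 X2 X3 where X: "X1 = \<Phi> (fps_const Xv) $ Suc n" "X2 = \<Phi> (fps_const Yv) $ Suc n" "X3 = \<Phi> (fps_const Zv) $ Suc n"
    note gc = gauge_coefficient[OF \<Phi> zero_less_Suc Suc.prems id fam_0[OF adm] fam_0[OF adm'] eq, folded X]
    obtain N where N: "famP c $ Suc n = comb N (c (Suc n))" "\<And>l i. N \<le> l \<Longrightarrow> c (Suc n) l i = 0"
      using admissible_famP[OF adm] by blast
    obtain N' where N': "famP c' $ Suc n = comb N' (c' (Suc n))" "\<And>l i. N' \<le> l \<Longrightarrow> c' (Suc n) l i = 0"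
      using admissible_famP[OF adm'] by blast
    define M where "M = max N N'"
    define a where "a l i = c' (Suc n) l i - c (Suc n) l i" for l i
    define b where "b r = cb' (Suc n) r - cb (Suc n) r" for r
    have P: "famP c' $ Suc n - famP c $ Suc n = comb M a"
    proof -
      have *: "famP c' $ Suc n = comb M (c' (Suc n))" "famP c $ Suc n = comb M (c (Suc n))"
        by (rule famP_nth; use adm adm' N(2) N'(2) in \<open>simp add: admissible_def M_def\<close>)+
      show ?thesis unfolding * by (simp add: comb_def a_def cst_simps sum_subtractf left_diff_distrib)
    qed
    have Q: "famQ cb' $ Suc n - famQ cb $ Suc n = (\<Sum>r\<in>{1..<\<mu>}. cst (b r) * u r)"
      by (simp add: famQ_def b_def cst_simps sum_subtractf left_diff_distrib)
    have fd: "fam1 c' cb' $ Suc n = fam1 c cb $ Suc n + comb M a * p1 + dx (\<Sum>r\<in>{1..<\<mu>}. cst (b r) * u r)"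
      "fam2 c' cb' $ Suc n = fam2 c cb $ Suc n + comb M a * p2 + dy (\<Sum>r\<in>{1..<\<mu>}. cst (b r) * u r)"
      "fam3 c' cb' $ Suc n = fam3 c cb $ Suc n + comb M a * p3 + dz (\<Sum>r\<in>{1..<\<mu>}. cst (b r) * u r)"
      using fam_difference[OF adm, of "Suc n" c' cb'] cc unfolding P Q by (simp_all add: less_Suc_eq_le)
    have "0 \<notin> E" using dw by (simp add: E_index_def)
    then have a0: "a l 0 = 0" for l using adm adm' by (simp add: admissible_def a_def)
    \<comment> \<open>The equivalence changes order n + 1 by the coboundary of X, while the families
      differ there by the class with coefficients \<open>a\<close> and \<open>b\<close>.\<close>
    have rel: "comb M a * p1 + (\<Sum>r\<in>{1..<\<mu>}. cst (b r) * dx (u r)) = cob_x X1 X2 X3"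
      "comb M a * p2 + (\<Sum>r\<in>{1..<\<mu>}. cst (b r) * dy (u r)) = cob_y X1 X2 X3"
      "comb M a * p3 + (\<Sum>r\<in>{1..<\<mu>}. cst (b r) * dz (u r)) = cob_z X1 X2 X3"
      using fd gc(2-4) by (simp_all add: d_sum add.assoc)
    note ind = second_cohomology_independent[OF dw a0 rel]
    have "a l i = 0" for l i
    proof (cases "l < M \<and> i < \<mu>")
      case False
      moreover have "c (Suc n) l i = 0 \<and> c' (Suc n) l i = 0" if "\<not> i < \<mu>"
      proof -
        have "i \<notin> E" using that by (auto simp: E_index_def)
        then show ?thesis using adm adm' by (simp add: admissible_def)
      qed
      ultimately show ?thesis using N(2)[of l i] N'(2)[of l i] by (auto simp: a_def M_def)
    qed (use ind(1) in blast)
    then have c_eq: "c (Suc n) = c' (Suc n)" and a: "a = (\<lambda>_ _. 0)" by (auto simp: a_def fun_eq_iff)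
    have "b r = 0" for r
    proof (cases "r \<in> {1..<\<mu>}")
      case False
      then show ?thesis using adm adm' by (auto simp: admissible_def b_def)
    qed (use ind(2) in blast)
    then have cb_eq: "cb (Suc n) = cb' (Suc n)" and b: "b = (\<lambda>_. 0)" by (auto simp: b_def fun_eq_iff)
    have "cob_x X1 X2 X3 = 0" "cob_y X1 X2 X3 = 0" "cob_z X1 X2 X3 = 0"
      using rel by (simp_all add: a b comb_def)
    then obtain h where h: "X1 = p2 * dz h - p3 * dy h" "X2 = p3 * dx h - p1 * dz h" "X3 = p1 * dy h - p2 * dx h"
      using first_cohomology_trivial[OF dw] by blast
    \<comment> \<open>Minus the Hamiltonian field of \<open>h\<close> for the deformed bracket: at
      \<nu> = 0 it equals - X and cancels the first term of \<open>\<Phi>\<close>.\<close>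
    define T where "T F = - famB c cb (fps_const h) F" for F
    have "nu_derivation (famB c cb (fps_const h))" using nu_bider_vb unfolding nu_bider_def by blast
    then have T: "nu_derivation T" by (simp add: nu_derivation_def T_def algebra_simps)
    define \<Theta> where "\<Theta> = nu_exp (\<lambda>F. fps_X ^ Suc n * T F)"
    note th = nu_exp_X_power[OF T, where n = n, folded \<Theta>_def]
    interpret nilpotent_derivation "\<lambda>F. fps_X ^ Suc n * T F" by (rule nilpotent_derivation_X_power[OF T])
    \<comment> \<open>By the Jacobi identity a Hamiltonian field is a derivation of its bracket, so
      its exponential preserves the bracket in all orders.\<close>
    have th_B: "\<Theta> (famB c cb F G) = famB c cb (\<Theta> F) (\<Theta> G)" for F G
      unfolding \<Theta>_def
    proof (rule nu_exp_bilinear[OF nu_bilinear_vb])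
      fix F G
      have neg: "famB c cb F (- G) = - famB c cb F G" "famB c cb (- F) G = - famB c cb F G"
        "famB c cb F G = - famB c cb G F" for F G
        by (simp_all add: vb_def algebra_simps)
      have "T (famB c cb F G) = famB c cb (T F) G + famB c cb F (T G)"
      proof -
        have "famB c cb (fps_const h) (famB c cb F G) + famB c cb F (famB c cb G (fps_const h))
          + famB c cb G (famB c cb (fps_const h) F) = 0"
          using famB_jacobi[of c cb "fps_const h" F G] unfolding jac_def .
        moreover have "famB c cb G (famB c cb (fps_const h) F) = - famB c cb (famB c cb (fps_const h) F) G"
          by (rule neg(3))
        moreover have "famB c cb F (famB c cb G (fps_const h)) = - famB c cb F (famB c cb (fps_const h) G)"
          unfolding neg(3)[of G] by (rule neg(1))
        ultimately show ?thesis unfolding T_def neg(1,2) by (simp add: algebra_simps add_eq_0_iff)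
      qed
      then show "fps_X ^ Suc n * T (famB c cb F G) = famB c cb (fps_X ^ Suc n * T F) G + famB c cb F (fps_X ^ Suc n * T G)"
        by (simp only: nu_bilinear_X_power[OF nu_bilinear_vb] distrib_left)
    qed
    have "nu_morph m (\<Phi> \<circ> \<Theta>)" by (rule nu_morph_comp[OF \<Phi> nu_auto_imp_morph[OF th(1)]])
    moreover have "nu_cong m ((\<Phi> \<circ> \<Theta>) (famB c cb F G)) (famB c' cb' ((\<Phi> \<circ> \<Theta>) F) ((\<Phi> \<circ> \<Theta>) G))" for F G
      using eq by (simp add: th_B)
    moreover have "(\<Phi> \<circ> \<Theta>) F $ k = F $ k" if "k \<le> Suc n" for F k
    proof (cases "k = Suc n")
      case True
      have "\<Theta> F $ 0 = F $ 0" by (rule th(2)) simp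
      then have "(\<Phi> \<circ> \<Theta>) F $ Suc n = F $ Suc n + T F $ 0 + (X1 * dx (F $ 0) + X2 * dy (F $ 0) + X3 * dz (F $ 0))"
        using gc(1)[of "\<Theta> F"] th(3)[of F] by simp
      moreover have "T F $ 0 = - (X1 * dx (F $ 0) + X2 * dy (F $ 0) + X3 * dz (F $ 0))"
        by (simp add: T_def vb_def fam_0[OF adm] h algebra_simps)
      ultimately show ?thesis using True by simp
    next
      case False
      then show ?thesis using that id[of k "\<Theta> F"] th(2)[of k F] by simp
    qed
    moreover have "\<forall>k\<le>Suc n. c k = c' k \<and> cb k = cb' k" using cc c_eq cb_eq by (simp add: le_Suc_eq)
    ultimately show ?case by blast
  qed
  from this[OF k] show ?thesis by blast
qed

end

section \<open>Passage to deformations and equivalences as defined\<close>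

lemma order_equivalent_iff:
  "order_equivalent m B B' \<longleftrightarrow> (\<exists>\<Phi>. nu_morph m \<Phi> \<and> (\<forall>F G. nu_cong m (\<Phi> (B F G)) (B' (\<Phi> F) (\<Phi> G))))"
  unfolding order_equivalent_def nu_morph_def by (simp only: conj_assoc)

lemma equivalent_deformations_iff:
  "equivalent_deformations B B' \<longleftrightarrow> (\<exists>\<Phi>. nu_auto \<Phi> \<and> (\<forall>F G. \<Phi> (B F G) = B' (\<Phi> F) (\<Phi> G)))"
  unfolding equivalent_deformations_def nu_auto_def by (simp only: conj_assoc)

lemma partial_sum_cong: "nu_cong m (partial_sum m \<pi> F G) (formal_sum \<pi> F G)"
  unfolding nu_cong_iff
proof (intro allI impI)
  fix k assume k: "k \<le> m"
  have "partial_sum m \<pi> F G $ k = (\<Sum>i\<le>m. if k < i then 0 else bilinear_ext (\<pi> i) F G $ (k - i))"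
    by (simp add: partial_sum_def fps_sum_nth fps_X_power_mult_right_nth)
  also have "\<dots> = (\<Sum>i\<le>k. if k < i then 0 else bilinear_ext (\<pi> i) F G $ (k - i))"
    by (rule sum.mono_neutral_right) (use k in auto)
  finally show "partial_sum m \<pi> F G $ k = formal_sum \<pi> F G $ k"
    by (simp add: formal_sum_def)
qed

context singularity
begin

lemma formal_deformation_vb:
  assumes "formal_deformation (bracket \<phi>) B"
  obtains Y1 Y2 Y3 where "B = vb Y1 Y2 Y3" "Y1 $ 0 = p1" "Y2 $ 0 = p2" "Y3 $ 0 = p3"
    "\<And>F G K. jac (vb Y1 Y2 Y3) F G K = 0"
proof -
  obtain \<pi> where \<pi>: "\<And>i. biderivation (\<pi> i)" "\<pi> 0 = bracket \<phi>" "B = formal_sum \<pi>"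
    using assms unfolding formal_deformation_def by blast
  note B = \<pi>(3)[unfolded formal_sum_biderivations[OF \<pi>(1)]]
  have "jac B F G K = 0" for F G K
    using assms unfolding formal_deformation_def jac_def by blast
  then show ?thesis by (intro that[OF B]) (simp_all add: \<pi>(2) bracket_def B)
qed

lemma order_deformation_vb:
  assumes "order_deformation m (bracket \<phi>) B"
  obtains Y1 Y2 Y3 where "\<And>F G. nu_cong m (B F G) (vb Y1 Y2 Y3 F G)" "Y1 $ 0 = p1" "Y2 $ 0 = p2" "Y3 $ 0 = p3"
    "\<And>k F G K. k \<le> m \<Longrightarrow> jac (vb Y1 Y2 Y3) F G K $ k = 0"
proof -
  obtain \<pi> where \<pi>: "\<And>i. i \<le> m \<Longrightarrow> biderivation (\<pi> i)" "\<pi> 0 = bracket \<phi>"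
    "\<And>F G. nu_cong m (B F G) (partial_sum m \<pi> F G)"
    using assms unfolding order_deformation_def by blast
  have J: "nu_cong m (B F (B G K) + B G (B K F) + B K (B F G)) 0" for F G K
    using assms unfolding order_deformation_def by blast
  \<comment> \<open>Padding by zero gives a full series of biderivations without effect modulo
    \<nu>^(m + 1).\<close>
  define \<pi>' where "\<pi>' i = (if i \<le> m then \<pi> i else (\<lambda>_ _. 0))" for i
  have bd: "biderivation (\<pi>' i)" for i
  proof (cases "i \<le> m")
    case True
    then show ?thesis using \<pi>(1) by (simp add: \<pi>'_def)
  next
    case False
    then show ?thesis by (simp add: \<pi>'_def biderivation_def derivation_def)
  qed
  have ps: "partial_sum m \<pi> = partial_sum m \<pi>'"
    by (intro ext) (simp add: partial_sum_def \<pi>'_def)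
  define Y1 Y2 Y3 where Y: "Y1 = Abs_fps (\<lambda>n. \<pi>' n Yv Zv)" "Y2 = Abs_fps (\<lambda>n. \<pi>' n Zv Xv)" "Y3 = Abs_fps (\<lambda>n. \<pi>' n Xv Yv)"
  have fs: "formal_sum \<pi>' = vb Y1 Y2 Y3" unfolding Y by (rule formal_sum_biderivations[OF bd])
  have B: "nu_cong m (B F G) (vb Y1 Y2 Y3 F G)" for F G
    using \<pi>(3)[of F G] partial_sum_cong[of m \<pi>' F G] unfolding ps fs by (rule nu_cong_trans)
  have BB: "nu_cong m (B F (B G K)) (vb Y1 Y2 Y3 F (vb Y1 Y2 Y3 G K))" for F G K
    using B nu_cong_bilinear[OF nu_bilinear_vb nu_cong_refl B] by (rule nu_cong_trans)
  have "nu_cong m (jac (vb Y1 Y2 Y3) F G K) 0" for F G K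
    unfolding jac_def
    by (rule nu_cong_trans[OF nu_cong_sym J[of F G K]]) (intro nu_cong_add BB)
  then have "jac (vb Y1 Y2 Y3) F G K $ k = 0" if "k \<le> m" for F G K k
    using that by (simp add: nu_cong_iff)
  then show ?thesis by (intro that[OF B]) (simp_all add: Y \<pi>'_def \<pi>(2) bracket_def)
qed

lemma family_formal_deformation:
  assumes "admissible \<mu> E c cb"
  shows "formal_deformation (bracket \<phi>) (formal_sum (pi_coeff \<mu> E \<phi> u c cb))"
proof -
  have "pi_coeff \<mu> E \<phi> u c cb 0 = bracket \<phi>" by (intro ext) (simp add: pi_coeff_def)
  then have "\<exists>\<pi>. (\<forall>i. biderivation (\<pi> i)) \<and> \<pi> 0 = bracket \<phi> \<and>
      formal_sum (pi_coeff \<mu> E \<phi> u c cb) = formal_sum \<pi>"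
    by (intro exI[of _ "pi_coeff \<mu> E \<phi> u c cb"]) (simp add: biderivation_pi_coeff[OF assms])
  then show ?thesis
    unfolding formal_deformation_def
    by (rule conjI) (simp only: formal_sum_pi_coeff[OF assms] famB_jacobi[unfolded jac_def] simp_thms)
qed

lemma partial_sum_famB:
  "admissible \<mu> E c cb \<Longrightarrow> nu_cong m (partial_sum m (pi_coeff \<mu> E \<phi> u c cb) F G) (famB c cb F G)"
  using partial_sum_cong formal_sum_pi_coeff by metis

lemma family_order_deformation:
  assumes adm: "admissible \<mu> E c cb"
  shows "order_deformation m (bracket \<phi>) (partial_sum m (pi_coeff \<mu> E \<phi> u c cb))"
proof -
  let ?B = "partial_sum m (pi_coeff \<mu> E \<phi> u c cb)"
  note B = partial_sum_famB[OF adm]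
  have BB: "nu_cong m (?B F (?B G K)) (famB c cb F (famB c cb G K))" for F G K
    using B nu_cong_bilinear[OF nu_bilinear_vb nu_cong_refl B] by (rule nu_cong_trans)
  have "nu_cong m (?B F (?B G K) + ?B G (?B K F) + ?B K (?B F G)) (jac (famB c cb) F G K)" for F G K
    unfolding jac_def by (intro nu_cong_add BB)
  then have "nu_cong m (?B F (?B G K) + ?B G (?B K F) + ?B K (?B F G)) 0" for F G K
    by (simp add: famB_jacobi)
  moreover have "pi_coeff \<mu> E \<phi> u c cb 0 = bracket \<phi>" by (intro ext) (simp add: pi_coeff_def)
  ultimately show ?thesis
    using biderivation_pi_coeff[OF adm] unfolding order_deformation_def
    by (intro conjI exI[of _ "pi_coeff \<mu> E \<phi> u c cb"]) simp_all
qed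

lemma formal_representative:
  assumes "formal_deformation (bracket \<phi>) B"
  shows "\<exists>c cb. admissible \<mu> E c cb \<and> equivalent_deformations B (formal_sum (pi_coeff \<mu> E \<phi> u c cb))"
proof -
  obtain Y1 Y2 Y3 where Y: "B = vb Y1 Y2 Y3" "Y1 $ 0 = p1" "Y2 $ 0 = p2" "Y3 $ 0 = p3"
    "\<And>F G K. jac (vb Y1 Y2 Y3) F G K = 0"
    using formal_deformation_vb[OF assms] by blast
  obtain c cb \<Phi> where adm: "admissible \<mu> E c cb" and \<Phi>: "nu_auto \<Phi>"
    and eq: "\<forall>F G. \<forall>k\<in>UNIV. \<Phi> (vb Y1 Y2 Y3 F G) $ k = famB c cb (\<Phi> F) (\<Phi> G) $ k"
    using representatives_exist[OF Y(2-4), of UNIV] Y(5) by auto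
  have "\<Phi> (B F G) = famB c cb (\<Phi> F) (\<Phi> G)" for F G
    unfolding Y(1) by (rule fps_ext) (use eq in simp)
  then show ?thesis
    using adm \<Phi> unfolding equivalent_deformations_iff by (auto simp: formal_sum_pi_coeff intro!: exI[of _ c] exI[of _ cb])
qed

text \<open>The vanishing beyond order \<open>m\<close>, obtained from \<open>S\<close> =
  \<open>{..m}\<close>, supplies existence in the normalised uniqueness statement.\<close>

lemma order_representative:
  assumes "order_deformation m (bracket \<phi>) B"
  shows "\<exists>c cb. admissible \<mu> E c cb \<and> (\<forall>k\<ge>m + 1. (\<forall>l i. c k l i = 0) \<and> (\<forall>r. cb k r = 0))
    \<and> order_equivalent m B (partial_sum m (pi_coeff \<mu> E \<phi> u c cb))"
proof -
  obtain Y1 Y2 Y3 where Y: "\<And>F G. nu_cong m (B F G) (vb Y1 Y2 Y3 F G)" "Y1 $ 0 = p1" "Y2 $ 0 = p2" "Y3 $ 0 = p3"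
    "\<And>k F G K. k \<le> m \<Longrightarrow> jac (vb Y1 Y2 Y3) F G K $ k = 0"
    using order_deformation_vb[OF assms] by blast
  obtain c cb \<Phi> where adm: "admissible \<mu> E c cb" and z: "\<forall>k. k \<notin> {..m} \<longrightarrow> c k = (\<lambda>_ _. 0) \<and> cb k = (\<lambda>_. 0)"
    and \<Phi>: "nu_auto \<Phi>"
    and eq: "\<forall>F G. \<forall>k\<in>{..m}. \<Phi> (vb Y1 Y2 Y3 F G) $ k = famB c cb (\<Phi> F) (\<Phi> G) $ k"
    using representatives_exist[OF Y(2-4), of "{..m}"] Y(5) by auto
  note M = nu_auto_imp_morph[OF \<Phi>, of m]
  have "nu_cong m (\<Phi> (B F G)) (partial_sum m (pi_coeff \<mu> E \<phi> u c cb) (\<Phi> F) (\<Phi> G))" for F G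
  proof -
    have "nu_cong m (\<Phi> (B F G)) (\<Phi> (vb Y1 Y2 Y3 F G))" by (rule nu_morphD(1)[OF M Y(1)])
    moreover have "nu_cong m (\<Phi> (vb Y1 Y2 Y3 F G)) (famB c cb (\<Phi> F) (\<Phi> G))"
      using eq by (simp add: nu_cong_iff)
    ultimately show ?thesis using nu_cong_trans nu_cong_sym[OF partial_sum_famB[OF adm]] by blast
  qed
  then have "order_equivalent m B (partial_sum m (pi_coeff \<mu> E \<phi> u c cb))"
    unfolding order_equivalent_iff using M by blast
  moreover have "\<forall>k\<ge>m + 1. (\<forall>l i. c k l i = 0) \<and> (\<forall>r. cb k r = 0)" using z by auto
  ultimately show ?thesis using adm by blast
qed

text \<open>For an inverse \<open>\<Psi>\<close> of \<open>\<Phi>\<close>, the composition of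
  \<open>\<Phi>'\<close> with \<open>\<Psi>\<close> is an equivalence between the two families, to
  which \<open>representatives_unique\<close> applies. Injectivity of \<open>\<Phi>\<close> shows
  that \<open>\<Psi>\<close> respects the brackets.\<close>

lemma equivalent_representatives_agree:
  assumes dw: "d \<noteq> w1 + w2 + w3" and adm: "admissible \<mu> E c cb" and adm': "admissible \<mu> E c' cb'"
    and \<Phi>: "nu_morph m \<Phi>" and \<Phi>': "nu_morph m \<Phi>'"
    and eq: "\<And>F G. nu_cong m (\<Phi> (B F G)) (famB c cb (\<Phi> F) (\<Phi> G))"
    and eq': "\<And>F G. nu_cong m (\<Phi>' (B F G)) (famB c' cb' (\<Phi>' F) (\<Phi>' G))"
    and k: "k \<le> m"
  shows "c k = c' k \<and> cb k = cb' k"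
proof -
  obtain \<Psi> where \<Psi>: "nu_morph m \<Psi>" and inv: "\<And>F. nu_cong m (\<Phi> (\<Psi> F)) F"
    using nu_morph_inverse[OF \<Phi>] by blast
  have "nu_cong m (\<Phi>' (\<Psi> (famB c cb F G))) (famB c' cb' (\<Phi>' (\<Psi> F)) (\<Phi>' (\<Psi> G)))" for F G
  proof -
    have "nu_cong m (famB c cb F G) (famB c cb (\<Phi> (\<Psi> F)) (\<Phi> (\<Psi> G)))"
      by (rule nu_cong_bilinear[OF nu_bilinear_vb nu_cong_sym[OF inv] nu_cong_sym[OF inv]])
    then have "nu_cong m (famB c cb F G) (\<Phi> (B (\<Psi> F) (\<Psi> G)))"
      by (rule nu_cong_trans[OF _ nu_cong_sym[OF eq]])
    then have "nu_cong m (\<Phi> (\<Psi> (famB c cb F G))) (\<Phi> (B (\<Psi> F) (\<Psi> G)))"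
      by (rule nu_cong_trans[OF inv])
    then have "nu_cong m (\<Psi> (famB c cb F G)) (B (\<Psi> F) (\<Psi> G))" by (rule nu_morph_inj[OF \<Phi>])
    then show ?thesis by (rule nu_cong_trans[OF nu_morphD(1)[OF \<Phi>'] eq'])
  qed
  then show ?thesis
    by (intro representatives_unique[OF dw adm adm' nu_morph_comp[OF \<Phi>' \<Psi>] _ k]) simp
qed

lemma formal_representative_unique:
  assumes dw: "d \<noteq> w1 + w2 + w3" and B: "formal_deformation (bracket \<phi>) B"
  shows "\<exists>!p. admissible \<mu> E (fst p) (snd p) \<and>
    equivalent_deformations B (formal_sum (pi_coeff \<mu> E \<phi> u (fst p) (snd p)))"
proof (rule ex_ex1I)
  show "\<exists>p. admissible \<mu> E (fst p) (snd p) \<and>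
      equivalent_deformations B (formal_sum (pi_coeff \<mu> E \<phi> u (fst p) (snd p)))"
    using formal_representative[OF B] by (metis fst_conv snd_conv)
  have morph: "\<exists>\<Phi>. \<forall>m. nu_morph m \<Phi> \<and> (\<forall>F G. nu_cong m (\<Phi> (B F G)) (famB (fst p) (snd p) (\<Phi> F) (\<Phi> G)))"
    if "admissible \<mu> E (fst p) (snd p) \<and>
      equivalent_deformations B (formal_sum (pi_coeff \<mu> E \<phi> u (fst p) (snd p)))" for p
    using that unfolding equivalent_deformations_iff
    by (metis formal_sum_pi_coeff nu_auto_imp_morph nu_cong_refl)
  fix p q
  assume p: "admissible \<mu> E (fst p) (snd p) \<and>
      equivalent_deformations B (formal_sum (pi_coeff \<mu> E \<phi> u (fst p) (snd p)))"
    and q: "admissible \<mu> E (fst q) (snd q) \<and>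
      equivalent_deformations B (formal_sum (pi_coeff \<mu> E \<phi> u (fst q) (snd q)))"
  obtain \<Phi> where \<Phi>: "\<And>m. nu_morph m \<Phi>" "\<And>m F G. nu_cong m (\<Phi> (B F G)) (famB (fst p) (snd p) (\<Phi> F) (\<Phi> G))"
    using morph[OF p] by blast
  obtain \<Psi> where \<Psi>: "\<And>m. nu_morph m \<Psi>" "\<And>m F G. nu_cong m (\<Psi> (B F G)) (famB (fst q) (snd q) (\<Psi> F) (\<Psi> G))"
    using morph[OF q] by blast
  \<comment> \<open>A formal equivalence is one modulo every power of \<nu>; constants of order k
    are compared modulo \<nu>^(k + 1).\<close>
  have "fst p k = fst q k \<and> snd p k = snd q k" for k
    by (rule equivalent_representatives_agree[OF dw conjunct1[OF p] conjunct1[OF q] \<Phi>(1) \<Psi>(1) \<Phi>(2) \<Psi>(2) order_refl])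
  then show "p = q" by (simp add: prod_eq_iff fun_eq_iff)
qed

lemma order_representative_unique:
  assumes dw: "d \<noteq> w1 + w2 + w3" and B: "order_deformation m (bracket \<phi>) B"
  shows "\<exists>!p. admissible \<mu> E (fst p) (snd p) \<and>
    (\<forall>k\<ge>m + 1. (\<forall>l i. fst p k l i = 0) \<and> (\<forall>r. snd p k r = 0)) \<and>
    order_equivalent m B (partial_sum m (pi_coeff \<mu> E \<phi> u (fst p) (snd p)))"
proof (rule ex_ex1I)
  let ?P = "\<lambda>p. admissible \<mu> E (fst p) (snd p) \<and>
    (\<forall>k\<ge>m + 1. (\<forall>l i. fst p k l i = 0) \<and> (\<forall>r. snd p k r = 0)) \<and>
    order_equivalent m B (partial_sum m (pi_coeff \<mu> E \<phi> u (fst p) (snd p)))"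
  obtain c cb where "admissible \<mu> E c cb" "\<forall>k\<ge>m + 1. (\<forall>l i. c k l i = 0) \<and> (\<forall>r. cb k r = 0)"
    "order_equivalent m B (partial_sum m (pi_coeff \<mu> E \<phi> u c cb))"
    using order_representative[OF B] by blast
  then have "?P (c, cb)" by simp
  then show "\<exists>p. ?P p" by (rule exI)
  have morph: "\<exists>\<Phi>. nu_morph m \<Phi> \<and> (\<forall>F G. nu_cong m (\<Phi> (B F G)) (famB (fst p) (snd p) (\<Phi> F) (\<Phi> G)))"
    if p: "?P p" for p
  proof -
    have adm: "admissible \<mu> E (fst p) (snd p)" using p by (rule conjunct1)
    have "order_equivalent m B (partial_sum m (pi_coeff \<mu> E \<phi> u (fst p) (snd p)))"
      using p by (elim conjE)
    then obtain \<Phi> where \<Phi>: "nu_morph m \<Phi>"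
      and eq: "\<And>F G. nu_cong m (\<Phi> (B F G)) (partial_sum m (pi_coeff \<mu> E \<phi> u (fst p) (snd p)) (\<Phi> F) (\<Phi> G))"
      unfolding order_equivalent_iff by blast
    have "nu_cong m (\<Phi> (B F G)) (famB (fst p) (snd p) (\<Phi> F) (\<Phi> G))" for F G
      by (rule nu_cong_trans[OF eq partial_sum_famB[OF adm]])
    then show ?thesis using \<Phi> by blast
  qed
  fix p q
  assume p: "?P p" and q: "?P q"
  obtain \<Phi> where \<Phi>: "nu_morph m \<Phi>" "\<And>F G. nu_cong m (\<Phi> (B F G)) (famB (fst p) (snd p) (\<Phi> F) (\<Phi> G))"
    using morph[OF p] by blast
  obtain \<Psi> where \<Psi>: "nu_morph m \<Psi>" "\<And>F G. nu_cong m (\<Psi> (B F G)) (famB (fst q) (snd q) (\<Psi> F) (\<Psi> G))"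
    using morph[OF q] by blast
  have "fst p k = fst q k \<and> snd p k = snd q k" for k
  proof (cases "k \<le> m")
    case True
    show ?thesis
      by (rule equivalent_representatives_agree[OF dw conjunct1[OF p] conjunct1[OF q] \<Phi>(1) \<Psi>(1) \<Phi>(2) \<Psi>(2) True])
  next
    case False
    then show ?thesis using p q by (simp add: fun_eq_iff)
  qed
  then show "p = q" by (simp add: prod_eq_iff fun_eq_iff)
qed

end

theorem proposition3p3:
  fixes \<phi> :: "'a::field_char_0 poly3"
    and u :: "nat \<Rightarrow> 'a poly3"
    and w1 w2 w3 d \<mu> :: nat
    and E :: "nat set"
  assumes weights: "w1 > 0" "w2 > 0" "w3 > 0" "gcd w1 (gcd w2 w3) = 1"
    and homogeneous: "weight_homogeneous w1 w2 w3 d \<phi>"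
    and isolated: "isolated_singularity \<phi>"
    and mu: "\<mu> = milnor_number \<phi>" "\<mu> \<ge> 1"
    and E: "E = E_index w1 w2 w3 d \<mu>"
    and u0: "u 0 = 1"
    and u_homogeneous: "\<forall>i<\<mu>. \<exists>e. weight_homogeneous w1 w2 w3 e (u i)"
    and u_basis: "sing_basis \<phi> \<mu> u"
  shows
    "(\<forall>c cb. admissible \<mu> E c cb \<longrightarrow>
        formal_deformation (bracket \<phi>) (formal_sum (pi_coeff \<mu> E \<phi> u c cb)))
     \<and>
     (\<forall>B. formal_deformation (bracket \<phi>) B \<longrightarrow>
        (\<exists>c cb. admissible \<mu> E c cb \<and>
           equivalent_deformations B (formal_sum (pi_coeff \<mu> E \<phi> u c cb))))
     \<and>
     (d \<noteq> w1 + w2 + w3 \<longrightarrow>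
        (\<forall>B. formal_deformation (bracket \<phi>) B \<longrightarrow>
          (\<exists>!p. admissible \<mu> E (fst p) (snd p) \<and>
             equivalent_deformations B (formal_sum (pi_coeff \<mu> E \<phi> u (fst p) (snd p))))))
     \<and>
     (\<forall>m\<ge>1.
        (\<forall>c cb. admissible \<mu> E c cb \<longrightarrow>
           order_deformation m (bracket \<phi>) (partial_sum m (pi_coeff \<mu> E \<phi> u c cb)))
        \<and>
        (\<forall>B. order_deformation m (bracket \<phi>) B \<longrightarrow>
           (\<exists>c cb. admissible \<mu> E c cb \<and>
              order_equivalent m B (partial_sum m (pi_coeff \<mu> E \<phi> u c cb))))
        \<and>
        (d \<noteq> w1 + w2 + w3 \<longrightarrow>
           (\<forall>B. order_deformation m (bracket \<phi>) B \<longrightarrow>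
             (\<exists>!p. admissible \<mu> E (fst p) (snd p) \<and>
                (\<forall>k\<ge>m + 1. (\<forall>l i. fst p k l i = 0) \<and> (\<forall>r. snd p k r = 0)) \<and>
                order_equivalent m B (partial_sum m (pi_coeff \<mu> E \<phi> u (fst p) (snd p)))))))"
proof -
  obtain e where e: "\<forall>i<\<mu>. weight_homogeneous w1 w2 w3 (e i) (u i)" using u_homogeneous by metis
  interpret w: weights w1 w2 w3 "TYPE('a)" by unfold_locales (use weights in auto)
  have H: "f \<in> weights.H w1 w2 w3 (int n)" if "weight_homogeneous w1 w2 w3 n f" for f :: "'a poly3" and n
    using that by (simp add: w.H_def weight_homogeneous_def euler_def)
  interpret singularity w1 w2 w3 "TYPE('a)" \<phi> d \<mu> u e
    by unfold_locales (use H e homogeneous mu(2) u0 u_basis in auto)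
  have order: "\<exists>c cb. admissible \<mu> E c cb \<and> order_equivalent m B (partial_sum m (pi_coeff \<mu> E \<phi> u c cb))"
    if "order_deformation m (bracket \<phi>) B" for m B
    using order_representative[OF that] unfolding E by (elim exE conjE) (intro exI conjI)
  show ?thesis
    by (intro conjI allI impI)
      (erule family_formal_deformation[folded E] formal_representative[folded E] order
        family_order_deformation[folded E] formal_representative_unique[folded E, rotated]
        order_representative_unique[folded E, rotated], assumption?)+
qed

end
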